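(* Let $1\le p<\infty$. Every element of $\mathcal{T}^p$ can be written as $f\ast S$ for some $f\in L^1(\mathbb{R}^{2d})$ and some $S\in\mathcal{T}^p$.
   Context: $\mathcal{T}^p$ is the Schatten $p$-class of operators on $L^2(\mathbb{R}^d)$. For $z=(x,\omega)\in\mathbb{R}^{2d}$, $\pi(z)\psi(t)=e^{2\pi i\omega\cdot t}\psi(t-x)$ on $L^2(\mathbb{R}^d)$, and $\alpha_z(A)=\pi(z)A\pi(z)^*$. For $f\in L^1(\mathbb{R}^{2d})$ and $S\in\mathcal{T}^p$, the convolution is the operator $f\ast S=\int_{\mathbb{R}^{2d}} f(z)\alpha_z(S)\,dz$ (applied to each vector and taken as a weak vector-valued integral), which belongs to $\mathcal{T}^p$ with $\|f\ast S\|_{\mathcal{T}^p}\le\|f\|_{L^1}\|S\|_{\mathcal{T}^p}$. *)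

theory Defs
  imports "HOL-Analysis.Analysis"
begin

section \<open>The Hilbert space of square-integrable functions\<close>

text \<open>
  Every Lebesgue measurable function agrees almost everywhere with a Borel measurable one, so
  Borel measurable representatives yield the usual space.
\<close>

definition square_integrable :: "('a::euclidean_space \<Rightarrow> complex) \<Rightarrow> bool" where
  "square_integrable f \<longleftrightarrow>
     f \<in> borel_measurable lborel \<and> integrable lborel (\<lambda>x. (norm (f x))\<^sup>2)"

lemma square_integrable_measurable [measurable_dest]:
  "square_integrable f \<Longrightarrow> f \<in> borel_measurable lborel"
  by (simp add: square_integrable_def)

lemma square_integrable_zero: "square_integrable (\<lambda>x. 0)"
  by (simp add: square_integrable_def)

lemma square_integrable_mult:
  assumes "square_integrable f" shows "square_integrable (\<lambda>x. c * f x)"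
  using assms unfolding square_integrable_def norm_mult power_mult_distrib
  by (auto intro: borel_measurable_times)

lemma square_integrable_add:
  assumes f: "square_integrable f" and g: "square_integrable g"
  shows "square_integrable (\<lambda>x. f x + g x)"
proof -
  note [measurable] = square_integrable_measurable[OF f] square_integrable_measurable[OF g]
  have le: "(norm (a + b))\<^sup>2 \<le> 2 * (norm a)\<^sup>2 + 2 * (norm b)\<^sup>2" for a b :: complex
  proof -
    have "(norm (a + b))\<^sup>2 \<le> (norm a + norm b)\<^sup>2"
      by (intro power_mono norm_triangle_ineq) auto
    also have "\<dots> \<le> 2 * (norm a)\<^sup>2 + 2 * (norm b)\<^sup>2"
      using sum_squares_bound[of "norm a" "norm b"] by (simp add: power2_sum)
    finally show ?thesis .
  qed
  have "integrable lborel (\<lambda>x. 2 * (norm (f x))\<^sup>2 + 2 * (norm (g x))\<^sup>2)"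
    using f g by (auto simp: square_integrable_def)
  then have "integrable lborel (\<lambda>x. (norm (f x + g x))\<^sup>2)"
    by (rule Bochner_Integration.integrable_bound) (use le in auto)
  then show ?thesis by (simp add: square_integrable_def)
qed

lemma integrable_mult_cnj:
  assumes f: "square_integrable f" and g: "square_integrable g"
  shows "integrable lborel (\<lambda>x. f x * cnj (g x))"
proof -
  note [measurable] = square_integrable_measurable[OF f] square_integrable_measurable[OF g]
  have [measurable]: "(\<lambda>x. cnj (g x)) \<in> borel_measurable lborel"
    by (rule measurable_compose[OF square_integrable_measurable[OF g]])
       (intro borel_measurable_continuous_onI continuous_intros)
  have le: "norm (a * cnj b) \<le> (norm a)\<^sup>2 + (norm b)\<^sup>2" for a b :: complex
  proof -
    have "2 * (norm a * norm b) \<le> (norm a)\<^sup>2 + (norm b)\<^sup>2"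
      using sum_squares_bound[of "norm a" "norm b"] by simp
    moreover have "0 \<le> norm a * norm b" by simp
    ultimately show ?thesis unfolding norm_mult complex_mod_cnj by linarith
  qed
  have "integrable lborel (\<lambda>x. (norm (f x))\<^sup>2 + (norm (g x))\<^sup>2)"
    using f g by (auto simp: square_integrable_def)
  then show ?thesis
    by (rule Bochner_Integration.integrable_bound) (use le in auto)
qed

lemma square_integrable_translate:
  assumes f: "square_integrable f" shows "square_integrable (\<lambda>t. f (t - x))"
proof -
  note [measurable] = square_integrable_measurable[OF f]
  have "integrable (distr lborel borel ((+) (-x))) (\<lambda>t. (norm (f t))\<^sup>2)"
    using f by (simp add: lborel_distr_plus square_integrable_def)
  then have "integrable lborel (\<lambda>t. (norm (f (- x + t)))\<^sup>2)"
    by (subst (asm) integrable_distr_eq) auto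
  then show ?thesis by (simp add: square_integrable_def)
qed

lemma AE_lborel_translate:
  fixes x :: "'a::euclidean_space"
  assumes "AE t in lborel. P t" shows "AE t in lborel. P (t - x)"
proof -
  have "AE t in distr lborel borel ((+) (-x)). P t"
    using assms by (subst lborel_distr_plus)
  from AE_distrD[OF _ this] show ?thesis by simp
qed

definition L2_rel :: "('a::euclidean_space \<Rightarrow> complex) \<Rightarrow> ('a \<Rightarrow> complex) \<Rightarrow> bool" where
  "L2_rel f g \<longleftrightarrow> square_integrable f \<and> square_integrable g \<and> (AE x in lborel. f x = g x)"

quotient_type (overloaded) 'a L2 = "'a::euclidean_space \<Rightarrow> complex" / partial: L2_rel
proof (rule part_equivpI)
  show "\<exists>f::'a \<Rightarrow> complex. L2_rel f f"
    by (rule exI[of _ "\<lambda>x. 0"]) (simp add: L2_rel_def square_integrable_zero)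
  show "symp (L2_rel :: ('a \<Rightarrow> complex) \<Rightarrow> _)"
    by (rule sympI) (auto simp: L2_rel_def elim: eventually_mono)
  show "transp (L2_rel :: ('a \<Rightarrow> complex) \<Rightarrow> _)"
    by (rule transpI) (auto simp: L2_rel_def elim: eventually_elim2)
qed

lift_definition scaleC :: "complex \<Rightarrow> 'a::euclidean_space L2 \<Rightarrow> 'a L2"  (infixr \<open>*\<^sub>C\<close> 75)
  is "\<lambda>c f x. c * f x"
  by (auto simp: L2_rel_def square_integrable_mult elim: eventually_mono)

text \<open>The inner product is linear in its first argument.\<close>

lift_definition cinner :: "'a::euclidean_space L2 \<Rightarrow> 'a L2 \<Rightarrow> complex"
  is "\<lambda>f g. LINT x|lborel. f x * cnj (g x)"
proof -
  fix f f' g g' :: "'a \<Rightarrow> complex"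
  assume f: "L2_rel f f'" and g: "L2_rel g g'"
  have "AE x in lborel. f x * cnj (g x) = f' x * cnj (g' x)"
    using f g by (auto simp: L2_rel_def elim: eventually_elim2)
  moreover have "integrable lborel (\<lambda>x. f x * cnj (g x))"
    "integrable lborel (\<lambda>x. f' x * cnj (g' x))"
    using f g by (auto simp: L2_rel_def intro: integrable_mult_cnj)
  ultimately show "(LINT x|lborel. f x * cnj (g x)) = (LINT x|lborel. f' x * cnj (g' x))"
    by (intro integral_cong_AE borel_measurable_integrable)
qed

text \<open>
  The underlying real inner product is the real part of the complex one; both induce the same norm.
\<close>

instantiation L2 :: (euclidean_space) real_inner
begin

lift_definition zero_L2 :: "'a L2" is "\<lambda>x. 0"
  by (simp add: L2_rel_def square_integrable_zero)

lift_definition plus_L2 :: "'a L2 \<Rightarrow> 'a L2 \<Rightarrow> 'a L2" is "\<lambda>f g x. f x + g x"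
  by (auto simp: L2_rel_def square_integrable_add elim: eventually_elim2)

definition uminus_L2 :: "'a L2 \<Rightarrow> 'a L2" where "uminus_L2 f = (- 1) *\<^sub>C f"

definition minus_L2 :: "'a L2 \<Rightarrow> 'a L2 \<Rightarrow> 'a L2" where "minus_L2 f g = f + (- g)"

definition scaleR_L2 :: "real \<Rightarrow> 'a L2 \<Rightarrow> 'a L2" where "scaleR_L2 r f = complex_of_real r *\<^sub>C f"

definition inner_L2 :: "'a L2 \<Rightarrow> 'a L2 \<Rightarrow> real" where "inner_L2 f g = Re (cinner f g)"

definition norm_L2 :: "'a L2 \<Rightarrow> real" where "norm_L2 f = sqrt (inner f f)"

definition sgn_L2 :: "'a L2 \<Rightarrow> 'a L2" where "sgn_L2 f = inverse (norm f) *\<^sub>R f"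

definition dist_L2 :: "'a L2 \<Rightarrow> 'a L2 \<Rightarrow> real" where "dist_L2 f g = norm (f - g)"

definition uniformity_L2 :: "('a L2 \<times> 'a L2) filter" where
  "uniformity_L2 = (INF e\<in>{0 <..}. principal {(f, g). dist f g < e})"

definition open_L2 :: "'a L2 set \<Rightarrow> bool" where
  "open_L2 U = (\<forall>f\<in>U. eventually (\<lambda>(f', g). f' = f \<longrightarrow> g \<in> U) uniformity)"

instance
proof
  fix f g h :: "'a L2" and r q :: real
  show "f + g + h = f + (g + h)"
    by transfer (auto simp: L2_rel_def square_integrable_add add.assoc)
  show "f + g = g + f"
    by transfer (auto simp: L2_rel_def square_integrable_add add.commute)
  show "0 + f = f"
    by transfer (auto simp: L2_rel_def)
  show "- f + f = 0"
    unfolding uminus_L2_def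
    by transfer (auto simp: L2_rel_def square_integrable_zero)
  show "f - g = f + - g"
    by (rule minus_L2_def)
  show "r *\<^sub>R (f + g) = r *\<^sub>R f + r *\<^sub>R g"
    unfolding scaleR_L2_def
    by transfer (auto simp: L2_rel_def distrib_left
        intro!: square_integrable_add square_integrable_mult)
  show "(r + q) *\<^sub>R f = r *\<^sub>R f + q *\<^sub>R f"
    unfolding scaleR_L2_def
    by transfer (auto simp: L2_rel_def distrib_right
        intro!: square_integrable_add square_integrable_mult)
  show "r *\<^sub>R q *\<^sub>R f = (r * q) *\<^sub>R f"
    unfolding scaleR_L2_def
    by transfer (auto simp: L2_rel_def mult.assoc square_integrable_mult)
  show "1 *\<^sub>R f = f"
    unfolding scaleR_L2_def
    by transfer (auto simp: L2_rel_def)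
  show "sgn f = inverse (norm f) *\<^sub>R f" by (rule sgn_L2_def)
  show "dist f g = norm (f - g)" by (rule dist_L2_def)
  show "uniformity = (INF e\<in>{0 <..}. principal {(f, g :: 'a L2). dist f g < e})"
    by (rule uniformity_L2_def)
  show "open U = (\<forall>f\<in>U. eventually (\<lambda>(f', g). f' = f \<longrightarrow> g \<in> U) uniformity)"
    for U :: "'a L2 set"
    by (rule open_L2_def)
  show "norm f = sqrt (inner f f)" by (rule norm_L2_def)
  show "inner f g = inner g f"
    unfolding inner_L2_def
  proof transfer
    fix f g :: "'a \<Rightarrow> complex"
    have "(LINT x|lborel. f x * cnj (g x)) = (LINT x|lborel. cnj (g x * cnj (f x)))"
      by (simp add: mult.commute)
    also have "\<dots> = cnj (LINT x|lborel. g x * cnj (f x))"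
      by (rule Bochner_Integration.integral_cnj)
    finally show "Re (LINT x|lborel. f x * cnj (g x)) = Re (LINT x|lborel. g x * cnj (f x))"
      by simp
  qed
  show "inner (f + g) h = inner f h + inner g h"
    unfolding inner_L2_def
    by transfer (auto simp: L2_rel_def distrib_right integrable_mult_cnj)
  show "inner (r *\<^sub>R f) g = r * inner f g"
    unfolding inner_L2_def scaleR_L2_def
    by transfer (simp add: mult.assoc)
  have sq: "(LINT x|lborel. f x * cnj (f x)) = complex_of_real (LINT x|lborel. (norm (f x))\<^sup>2)"
    for f :: "'a \<Rightarrow> complex"
    by (simp flip: complex_norm_square integral_complex_of_real)
  show "0 \<le> inner f f"
    unfolding inner_L2_def
    by transfer (simp add: sq)
  show "(inner f f = 0) = (f = 0)"
    unfolding inner_L2_def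
  proof transfer
    fix f :: "'a \<Rightarrow> complex"
    assume "L2_rel f f"
    then have "integrable lborel (\<lambda>x. (norm (f x))\<^sup>2)" "square_integrable f"
      by (auto simp: L2_rel_def square_integrable_def)
    then show "(Re (LINT x|lborel. f x * cnj (f x)) = 0) = L2_rel f (\<lambda>x. 0)"
      by (simp add: sq integral_nonneg_eq_0_iff_AE L2_rel_def square_integrable_zero)
  qed
qed

end

section \<open>Operators and Schatten classes\<close>

text \<open>
  Operators are functions on \<open>'a L2\<close>; \<^const>\<open>bounded_linear\<close> only expresses real linearity.
\<close>

definition bounded_clinear :: "('a::euclidean_space L2 \<Rightarrow> 'a L2) \<Rightarrow> bool" where
  "bounded_clinear A \<longleftrightarrow> bounded_linear A \<and> (\<forall>c \<psi>. A (c *\<^sub>C \<psi>) = c *\<^sub>C A \<psi>)"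

definition compact_operator :: "('a::euclidean_space L2 \<Rightarrow> 'a L2) \<Rightarrow> bool" where
  "compact_operator A \<longleftrightarrow> bounded_clinear A \<and> compact (closure (A ` cball 0 1))"

definition orthonormal :: "(nat \<Rightarrow> 'a::euclidean_space L2) \<Rightarrow> bool" where
  "orthonormal e \<longleftrightarrow> (\<forall>m n. cinner (e m) (e n) = (if m = n then 1 else 0))"

text \<open>
  The singular values of a compact operator, in decreasing order and repeated according to
  multiplicity, are the coefficients of its singular value decomposition
  \<open>A \<psi> = (\<Sum>n. s\<^sub>n \<langle>\<psi>, e\<^sub>n\<rangle> g\<^sub>n)\<close>. Operators of finite rank are covered by taking \<open>s\<^sub>n = 0\<close> for large
  \<open>n\<close>; as the space is infinite-dimensional, the orthonormal systems can always be continued.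
  In the definition of the Schatten classes, note that \<open>0 powr p = 0\<close>.
\<close>

definition singular_values :: "('a::euclidean_space L2 \<Rightarrow> 'a L2) \<Rightarrow> (nat \<Rightarrow> real) \<Rightarrow> bool" where
  "singular_values A s \<longleftrightarrow>
     (\<forall>n. 0 \<le> s n) \<and> decseq s \<and>
     (\<exists>e g. orthonormal e \<and> orthonormal g \<and>
        (\<forall>\<psi>. (\<lambda>n. (complex_of_real (s n) * cinner \<psi> (e n)) *\<^sub>C g n) sums A \<psi>))"

definition schatten_class :: "real \<Rightarrow> ('a::euclidean_space L2 \<Rightarrow> 'a L2) set" where
  "schatten_class p =
     {A. compact_operator A \<and> (\<exists>s. singular_values A s \<and> summable (\<lambda>n. s n powr p))}"

definition cadjoint :: "('a::euclidean_space L2 \<Rightarrow> 'a L2) \<Rightarrow> ('a L2 \<Rightarrow> 'a L2)" where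
  "cadjoint A = (THE B. \<forall>\<phi> \<psi>. cinner (A \<phi>) \<psi> = cinner \<phi> (B \<psi>))"

section \<open>Time-frequency shifts and convolutions\<close>

lift_definition tf_shift :: "'a::euclidean_space \<times> 'a \<Rightarrow> 'a L2 \<Rightarrow> 'a L2"
  is "\<lambda>(x, \<omega>) \<psi> t. exp (2 * complex_of_real pi * \<i> * complex_of_real (\<omega> \<bullet> t)) * \<psi> (t - x)"
proof (clarsimp simp: L2_rel_def)
  fix x \<omega> :: 'a and f g :: "'a \<Rightarrow> complex"
  let ?e = "\<lambda>t. exp (2 * complex_of_real pi * \<i> * complex_of_real (\<omega> \<bullet> t))"
  assume f: "square_integrable f" and g: "square_integrable g" and eq: "AE t in lborel. f t = g t"
  have [measurable]: "?e \<in> borel_measurable lborel"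
    unfolding measurable_lborel2 by (intro borel_measurable_continuous_onI continuous_intros)
  have norm_e: "norm (?e t) = 1" for t
    by simp
  have "square_integrable (\<lambda>t. ?e t * h (t - x))" if "square_integrable h" for h :: "'a \<Rightarrow> complex"
    using square_integrable_translate[OF that, of x]
    by (auto simp: square_integrable_def norm_mult norm_e simp del: norm_exp_eq_Re)
  with f g AE_lborel_translate[OF eq, of x]
  show "square_integrable (\<lambda>t. ?e t * f (t - x)) \<and> square_integrable (\<lambda>t. ?e t * g (t - x)) \<and>
        (AE t in lborel. f (t - x) = g (t - x))"
    by blast
qed

definition op_translate ::
    "'a::euclidean_space \<times> 'a \<Rightarrow> ('a L2 \<Rightarrow> 'a L2) \<Rightarrow> ('a L2 \<Rightarrow> 'a L2)" where
  "op_translate z A = tf_shift z \<circ> A \<circ> cadjoint (tf_shift z)"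

text \<open>
  By the Riesz representation theorem, the weak integral defining \<open>f \<star> S\<close> exists for every integrable
  \<open>f\<close> and every bounded operator \<open>S\<close>; the definite descriptions here and in \<^const>\<open>cadjoint\<close> are
  unique as the inner product is nondegenerate.
\<close>

definition weak_integral :: "'z measure \<Rightarrow> ('z \<Rightarrow> 'a::euclidean_space L2) \<Rightarrow> 'a L2" where
  "weak_integral M F =
     (THE v. \<forall>\<phi>. has_bochner_integral M (\<lambda>z. cinner (F z) \<phi>) (cinner v \<phi>))"

definition op_convolution ::
    "('a::euclidean_space \<times> 'a \<Rightarrow> complex) \<Rightarrow> ('a L2 \<Rightarrow> 'a L2) \<Rightarrow> ('a L2 \<Rightarrow> 'a L2)"
    (infixl \<open>\<star>\<close> 70) where
  "f \<star> S = (\<lambda>\<psi>. weak_integral lborel (\<lambda>z. f z *\<^sub>C op_translate z S \<psi>))"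

end

theory Submission
  imports Defs
begin

text \<open>
  This is a concrete version of the Cohen--Hewitt factorization argument. Suppose
  \<open>T = f \<star> S + a S\<close>, beginning with \<open>f = 0\<close>, \<open>S = T\<close>, \<open>a = 1\<close>. Take a probability density \<open>k\<close>
  supported in a small ball, let \<open>S'\<close> be the solution, given by a Neumann series, of
  \<open>3/4 S' + 1/4 (k \<star> S') = S\<close>, and put \<open>f' = 3/4 f + 1/4 (k * f) + 1/4 a k\<close>, \<open>a' = 3/4 a\<close>. Then
  \<open>T = f' \<star> S' + a' S'\<close>. If the supports shrink fast enough, then iterating this makes \<open>f\<close>
  converge in \<open>L\<^sup>1\<close>, \<open>S\<close> in the Schatten norm, and \<open>a\<close> to \<open>0\<close>.

  The Schatten norm is treated as a supremum of moduli of linear functionals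
  \<open>A \<mapsto> \<Sum>n<N. b\<^sub>n \<langle>A e\<^sub>n, g\<^sub>n\<rangle>\<close>, with orthonormal systems \<open>e\<close>, \<open>g\<close> and \<open>b\<close> in the unit ball of the dual
  of \<open>\<ell>\<^sup>p\<close>, so that sums and integrals of operators are estimated as scalars. Compactness comes from
  the condition that \<open>A e\<^sub>n\<close> tends to \<open>0\<close> for every orthonormal sequence \<open>e\<close>, which passes to
  convolutions by dominated convergence.
\<close>

section \<open>Completeness of the Hilbert space\<close>

text \<open>The operator \<open>f \<star> S + a S\<close> is the action on \<open>S\<close> of
  \<open>f + a delta\<close>, an element of the convolution algebra L1 with a unit delta adjoined,
  and the unit part has to disappear in the limit. One step multiplies the scalar side by
  \<open>3/4 delta + 1/4 k\<close> and applies the inverse to \<open>S\<close>; associativity of the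
  action keeps the result equal to \<open>T\<close>. Convolution with \<open>k\<close> is a
  contraction, so any weight of delta above 1/2 makes the factor invertible. With 3/4 and 1/4 the
  Neumann ratio is 1/3. The norm of the inverse alone (at most 2) would let \<open>S\<close> grow.
  That \<open>S' - S\<close> is small comes from \<open>k \<star> S\<close> being close to
  \<open>S\<close>, hence from continuity of translations in the Schatten norm, which rests on
  approximation by finite rank and so on p being finite. Each \<open>k\<close> is chosen after the
  current \<open>f\<close> and \<open>S\<close> and must be close to the identity on both. The
  defining condition, existence of a singular value expansion, does not visibly survive sums or
  limits; hence the detour through dual bounds, from which an expansion is constructed anew.
  Infinite dimension enters through a given orthonormal sequence \<open>u\<close>, read off from the
  expansion of \<open>T\<close>.\<close>

definition L2_of :: "('a::euclidean_space \<Rightarrow> complex) \<Rightarrow> 'a L2" where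
  "L2_of = abs_L2"

lemma L2_cases:
  obtains f where "square_integrable f" "\<psi> = L2_of f"
proof
  show "square_integrable (rep_L2 \<psi>)"
    using Quotient3_rep_reflp[OF Quotient3_L2, of \<psi>] by (simp add: L2_rel_def)
  show "\<psi> = L2_of (rep_L2 \<psi>)"
    unfolding L2_of_def by (simp add: Quotient3_abs_rep[OF Quotient3_L2])
qed

lemma L2_rel_refl: "square_integrable f \<Longrightarrow> L2_rel f f"
  by (simp add: L2_rel_def)

lemma L2_of_add:
  assumes "square_integrable f" "square_integrable g"
  shows "L2_of f + L2_of g = L2_of (\<lambda>x. f x + g x)"
  using assms by (simp add: L2_of_def plus_L2.abs_eq L2_rel_refl)

lemma L2_of_scaleC:
  assumes "square_integrable f"
  shows "c *\<^sub>C L2_of f = L2_of (\<lambda>x. c * f x)"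
  using assms by (simp add: L2_of_def scaleC.abs_eq L2_rel_refl)

lemma cinner_L2_of:
  assumes "square_integrable f" "square_integrable g"
  shows "cinner (L2_of f) (L2_of g) = (LINT x|lborel. f x * cnj (g x))"
  using assms by (simp add: L2_of_def cinner.abs_eq L2_rel_refl)

lemma zero_L2_eq: "0 = L2_of (\<lambda>x. 0)"
  by (simp add: L2_of_def zero_L2.abs_eq)

lemma L2_of_diff:
  assumes f: "square_integrable f" and g: "square_integrable g"
  shows "L2_of f - L2_of g = L2_of (\<lambda>x. f x - g x)"
proof -
  have "L2_of f - L2_of g = L2_of f + (-1) *\<^sub>C L2_of g"
    by (simp add: minus_L2_def uminus_L2_def)
  also have "\<dots> = L2_of (\<lambda>x. f x + (-1) * g x)"
    unfolding L2_of_scaleC[OF g] by (rule L2_of_add[OF f square_integrable_mult[OF g]])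
  finally show ?thesis by simp
qed

lemma square_integrable_diff:
  assumes f: "square_integrable f" and g: "square_integrable g"
  shows "square_integrable (\<lambda>x. f x - g x)"
  using square_integrable_add[OF f square_integrable_mult[OF g, of "-1"]] by simp

lemma L2_of_sum:
  assumes "finite I" "\<And>i. i \<in> I \<Longrightarrow> square_integrable (f i)"
  shows "square_integrable (\<lambda>x. \<Sum>i\<in>I. f i x) \<and> (\<Sum>i\<in>I. L2_of (f i)) = L2_of (\<lambda>x. \<Sum>i\<in>I. f i x)"
  using assms
  by (induction I rule: finite_induct)
     (auto simp: zero_L2_eq L2_of_add square_integrable_zero square_integrable_add)

lemma norm_L2_of_sq:
  assumes "square_integrable f"
  shows "(norm (L2_of f))\<^sup>2 = (LINT x|lborel. (norm (f x))\<^sup>2)"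
proof -
  have "(LINT x|lborel. f x * cnj (f x)) = complex_of_real (LINT x|lborel. (norm (f x))\<^sup>2)"
    by (simp flip: complex_norm_square integral_complex_of_real)
  then show ?thesis
    using assms by (simp add: power2_norm_eq_inner inner_L2_def cinner_L2_of)
qed

section \<open>The complex inner product and its relation to the real one\<close>

lemma cinner_commute: "cinner f g = cnj (cinner g f)"
proof transfer
  fix f g :: "'a \<Rightarrow> complex"
  have "(LINT x|lborel. f x * cnj (g x)) = (LINT x|lborel. cnj (g x * cnj (f x)))"
    by (simp add: mult.commute)
  also have "\<dots> = cnj (LINT x|lborel. g x * cnj (f x))"
    by (rule Bochner_Integration.integral_cnj)
  finally show "(LINT x|lborel. f x * cnj (g x)) = cnj (LINT x|lborel. g x * cnj (f x))" .
qed

lemma cinner_add_left: "cinner (f + g) h = cinner f h + cinner g h"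
  by transfer (auto simp: L2_rel_def distrib_right integrable_mult_cnj)

lemma cinner_scaleC_left [simp]: "cinner (c *\<^sub>C f) g = c * cinner f g"
  by transfer (simp add: mult.assoc)

lemma cinner_add_right: "cinner f (g + h) = cinner f g + cinner f h"
  using cinner_commute[of f "g + h"] cinner_commute[of f g] cinner_commute[of f h]
  by (simp add: cinner_add_left)

lemma cinner_scaleC_right [simp]: "cinner f (c *\<^sub>C g) = cnj c * cinner f g"
  using cinner_commute[of f "c *\<^sub>C g"] cinner_commute[of f g] by simp

lemma cinner_self: "cinner f f = complex_of_real ((norm f)\<^sup>2)"
proof (rule complex_eqI)
  show "Re (cinner f f) = Re (complex_of_real ((norm f)\<^sup>2))"
    by (simp add: power2_norm_eq_inner inner_L2_def)
  show "Im (cinner f f) = Im (complex_of_real ((norm f)\<^sup>2))"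
    using arg_cong[OF cinner_commute[of f f], of Im] by simp
qed

lemma norm_scaleC [simp]: "norm (c *\<^sub>C f) = cmod c * norm f"
proof -
  have "complex_of_real ((cmod c)\<^sup>2) = c * cnj c"
    by (simp only: complex_norm_square)
  then have "complex_of_real ((norm (c *\<^sub>C f))\<^sup>2) = complex_of_real ((cmod c * norm f)\<^sup>2)"
    by (simp only: cinner_self[symmetric] power_mult_distrib of_real_mult
        cinner_scaleC_left cinner_scaleC_right mult.assoc mult.left_commute)
  then show ?thesis
    by (metis norm_ge_zero of_real_eq_iff power2_eq_iff_nonneg zero_le_mult_iff)
qed

lemma scaleC_scaleC [simp]: "b *\<^sub>C c *\<^sub>C f = (b * c) *\<^sub>C f"
  by transfer (auto simp: L2_rel_def mult.assoc square_integrable_mult)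

lemma scaleC_one [simp]: "1 *\<^sub>C f = f"
  by transfer (auto simp: L2_rel_def)

lemma scaleC_of_real: "of_real r *\<^sub>C f = r *\<^sub>R f"
  by (simp add: scaleR_L2_def)

lemma scaleC_add_right: "c *\<^sub>C (f + g) = c *\<^sub>C f + c *\<^sub>C g"
  by transfer (auto simp: L2_rel_def distrib_left intro!: square_integrable_add square_integrable_mult)

lemma scaleC_add_left: "(b + c) *\<^sub>C f = b *\<^sub>C f + c *\<^sub>C f"
  by transfer (auto simp: L2_rel_def distrib_right intro!: square_integrable_add square_integrable_mult)

text \<open>Cauchy-Schwarz for the real inner product controls only the real part of
  \<open>cinner\<close>. Rotating \<open>f\<close> by a unimodular constant makes the complex inner
  product real and nonnegative without changing the norm.\<close>

lemma norm_cinner_le: "cmod (cinner f g) \<le> norm f * norm g"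
proof (cases "cinner f g = 0")
  case False
  define c where "c = cnj (cinner f g) / cmod (cinner f g)"
  have c: "cmod c = 1" using False by (simp add: c_def norm_divide)
  have "c * cinner f g = cmod (cinner f g)"
    using False by (simp add: c_def mult.commute complex_norm_square[symmetric] power2_eq_square)
  then have "cmod (cinner f g) = inner (c *\<^sub>C f) g"
    by (simp add: inner_L2_def)
  also have "\<dots> \<le> norm (c *\<^sub>C f) * norm g" by (rule norm_cauchy_schwarz)
  finally show ?thesis by (simp add: c)
qed simp

interpretation cinner: bounded_bilinear cinner
proof
  show "cinner (r *\<^sub>R a) b = r *\<^sub>R cinner a b" for r :: real and a b :: "'a L2"
    by (simp add: scaleR_L2_def scaleR_conv_of_real)
  show "cinner a (r *\<^sub>R b) = r *\<^sub>R cinner a b" for r :: real and a b :: "'a L2"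
    by (simp add: scaleR_L2_def scaleR_conv_of_real)
  show "\<exists>K. \<forall>a b :: 'a L2. cmod (cinner a b) \<le> norm a * norm b * K"
    by (rule exI[of _ 1]) (simp add: norm_cinner_le)
qed (simp_all add: cinner_add_left cinner_add_right)

interpretation scaleC: bounded_bilinear scaleC
proof
  show "(r *\<^sub>R c) *\<^sub>C f = r *\<^sub>R c *\<^sub>C f" for r c and f :: "'a L2"
    by (simp add: scaleR_L2_def scaleR_conv_of_real)
  show "c *\<^sub>C r *\<^sub>R f = r *\<^sub>R c *\<^sub>C f" for r c and f :: "'a L2"
    by (simp add: scaleR_L2_def mult.commute)
  show "\<exists>K. \<forall>c (f::'a L2). norm (c *\<^sub>C f) \<le> norm c * norm f * K"
    by (rule exI[of _ 1]) simp
qed (simp_all add: scaleC_add_left scaleC_add_right)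

lemma cinner_eqI:
  assumes "\<And>\<phi>. cinner f \<phi> = cinner g \<phi>" shows "f = g"
proof -
  have "cinner (f - g) (f - g) = 0"
    by (simp only: cinner.diff_left assms diff_self)
  then show ?thesis by (simp add: cinner_self)
qed

lemma norm_le_cinner:
  assumes "\<And>\<phi>. cmod (cinner f \<phi>) \<le> M * norm \<phi>" "0 \<le> M" shows "norm f \<le> M"
proof (cases "f = 0")
  case False
  have "(norm f)\<^sup>2 \<le> M * norm f"
    using assms(1)[of f] by (simp add: cinner_self norm_power)
  then show ?thesis using False by (simp add: power2_eq_square)
qed (use assms in simp)

text \<open>Riesz-Fischer argument: by monotone convergence the pointwise sum \<open>g\<close> of
  the moduli is square integrable, so it is finite almost everywhere and provides a majorant for the
  convergence of the partial sums.\<close>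

lemma summable_L2:
  fixes d :: "nat \<Rightarrow> 'a::euclidean_space L2"
  assumes sum: "summable (\<lambda>n. norm (d n))"
  shows "summable d"
proof -
  have "\<forall>n. \<exists>h. square_integrable h \<and> d n = L2_of h"
    by (metis L2_cases)
  then obtain h where h: "\<And>n. square_integrable (h n)" and d: "\<And>n. d n = L2_of (h n)"
    by metis
  note [measurable] = square_integrable_measurable[OF h]
  define C where "C = (\<Sum>n. norm (d n))"
  define G where "G N x = (\<Sum>n<N. norm (h n x))" for N x
  have [measurable]: "G N \<in> borel_measurable lborel" for N
    unfolding G_def by measurable
  have habs: "square_integrable (\<lambda>x. complex_of_real (norm (h n x)))" for n
    using h[of n] by (auto simp: square_integrable_def)
  have G_le: "integrable lborel (\<lambda>x. (G N x)\<^sup>2) \<and> (LINT x|lborel. (G N x)\<^sup>2) \<le> C\<^sup>2" for N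
  proof -
    have eq: "(\<lambda>x. \<Sum>n<N. complex_of_real (norm (h n x))) = (\<lambda>x. complex_of_real (G N x))"
      by (simp add: G_def)
    have sq: "square_integrable (\<lambda>x. complex_of_real (G N x))"
      and sumeq: "(\<Sum>n<N. L2_of (\<lambda>x. complex_of_real (norm (h n x)))) = L2_of (\<lambda>x. complex_of_real (G N x))"
      using L2_of_sum[of "{..<N}" "\<lambda>n x. complex_of_real (norm (h n x))"] habs
      unfolding eq by auto
    have nrm: "norm (L2_of (\<lambda>x. complex_of_real (norm (h n x)))) = norm (d n)" for n
    proof -
      have "(norm (L2_of (\<lambda>x. complex_of_real (norm (h n x)))))\<^sup>2 = (norm (d n))\<^sup>2"
        by (simp add: norm_L2_of_sq habs h d)
      then show ?thesis by simp
    qed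
    have "norm (L2_of (\<lambda>x. complex_of_real (G N x))) \<le> (\<Sum>n<N. norm (d n))"
      unfolding sumeq[symmetric] by (rule order_trans[OF norm_sum]) (simp add: nrm)
    also have "\<dots> \<le> C"
      unfolding C_def by (rule sum_le_suminf[OF sum]) auto
    finally have "(norm (L2_of (\<lambda>x. complex_of_real (G N x))))\<^sup>2 \<le> C\<^sup>2"
      by (simp add: power_mono)
    then show ?thesis using sq by (simp add: norm_L2_of_sq) (simp add: square_integrable_def)
  qed
  have G_mono: "G N x \<le> G M x" if "N \<le> M" for N M x
    unfolding G_def using that by (intro sum_mono2) auto
  have G_nonneg: "0 \<le> G N x" for N x by (simp add: G_def sum_nonneg)
  have "(\<integral>\<^sup>+x. (SUP N. ennreal ((G N x)\<^sup>2)) \<partial>lborel) = (SUP N. \<integral>\<^sup>+x. ennreal ((G N x)\<^sup>2) \<partial>lborel)"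
    by (intro nn_integral_monotone_convergence_SUP)
       (auto simp: incseq_def le_fun_def G_mono G_nonneg intro!: ennreal_leI power_mono)
  also have "\<dots> \<le> ennreal (C\<^sup>2)"
    by (intro SUP_least) (use G_le in \<open>auto simp: nn_integral_eq_integral intro!: ennreal_leI\<close>)
  finally have fin: "(\<integral>\<^sup>+x. (SUP N. ennreal ((G N x)\<^sup>2)) \<partial>lborel) < \<infinity>"
    by (rule le_less_trans) simp
  have "AE x in lborel. (SUP N. ennreal ((G N x)\<^sup>2)) \<noteq> \<infinity>"
    using fin by (intro nn_integral_PInf_AE) auto
  then have AEsum: "AE x in lborel. summable (\<lambda>n. norm (h n x))"
  proof eventually_elim
    case (elim x)
    then obtain B where B: "(SUP N. ennreal ((G N x)\<^sup>2)) = ennreal B" "0 \<le> B"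
      by (metis ennreal_cases infinity_ennreal_def)
    have "(G N x)\<^sup>2 \<le> B" for N
      using SUP_upper[of N UNIV "\<lambda>N. ennreal ((G N x)\<^sup>2)"] B by (auto simp: ennreal_le_iff)
    then have "G N x \<le> sqrt B" for N
      by (simp add: real_le_rsqrt)
    then show ?case
      unfolding G_def by (intro summableI_nonneg_bounded[of _ "sqrt B"]) auto
  qed
  define g where "g x = (\<Sum>n. norm (h n x))" for x
  have [measurable]: "g \<in> borel_measurable lborel"
    unfolding g_def by measurable
  have Glim: "AE x in lborel. (\<lambda>N. G N x) \<longlonglongrightarrow> g x"
    using AEsum unfolding G_def g_def by eventually_elim (rule summable_LIMSEQ)
  have Gle: "AE x in lborel. \<forall>N. G N x \<le> g x"
    using AEsum unfolding G_def g_def by eventually_elim (auto intro!: sum_le_suminf)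
  have g_nn: "(\<integral>\<^sup>+x. ennreal ((g x)\<^sup>2) \<partial>lborel) < \<infinity>"
  proof -
    have "(\<integral>\<^sup>+x. ennreal ((g x)\<^sup>2) \<partial>lborel) = (\<integral>\<^sup>+x. (SUP N. ennreal ((G N x)\<^sup>2)) \<partial>lborel)"
    proof (rule nn_integral_cong_AE)
      show "AE x in lborel. ennreal ((g x)\<^sup>2) = (SUP N. ennreal ((G N x)\<^sup>2))"
        using Glim
      proof eventually_elim
        case (elim x)
        have "(\<lambda>N. ennreal ((G N x)\<^sup>2)) \<longlonglongrightarrow> ennreal ((g x)\<^sup>2)"
          by (intro tendsto_intros tendsto_ennrealI elim)
        moreover have "(\<lambda>N. ennreal ((G N x)\<^sup>2)) \<longlonglongrightarrow> (SUP N. ennreal ((G N x)\<^sup>2))"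
          by (intro LIMSEQ_SUP) (auto simp: incseq_def G_mono G_nonneg intro!: ennreal_leI power_mono)
        ultimately show ?case by (rule LIMSEQ_unique)
      qed
    qed
    then show ?thesis using fin by simp
  qed
  have g_int: "integrable lborel (\<lambda>x. (g x)\<^sup>2)"
    using g_nn by (intro integrableI_nonneg) auto
  define f where "f x = (\<Sum>n. h n x)" for x
  have [measurable]: "f \<in> borel_measurable lborel"
    unfolding f_def by measurable
  have f_le: "AE x in lborel. norm (f x) \<le> g x"
    using AEsum unfolding f_def g_def by eventually_elim (rule summable_norm)
  have f: "square_integrable f"
    unfolding square_integrable_def
  proof safe
    show "integrable lborel (\<lambda>x. (norm (f x))\<^sup>2)"
    proof (rule Bochner_Integration.integrable_bound[OF g_int])
      show "AE x in lborel. norm ((norm (f x))\<^sup>2) \<le> norm ((g x)\<^sup>2)"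
        using f_le by eventually_elim (auto intro: power_mono)
    qed measurable
  qed measurable
  have psum: "square_integrable (\<lambda>x. \<Sum>n<N. h n x)" "(\<Sum>n<N. d n) = L2_of (\<lambda>x. \<Sum>n<N. h n x)" for N
    using L2_of_sum[of "{..<N}" h] h by (auto simp: d)
  \<comment> \<open>The partial sums and \<open>f\<close> are both bounded by \<open>g\<close> in
    modulus, so the squared difference is at most \<open>(2 * g x)\<^sup>2\<close>.\<close>
  have "(\<lambda>N. LINT x|lborel. (norm ((\<Sum>n<N. h n x) - f x))\<^sup>2) \<longlonglongrightarrow> (LINT x|(lborel :: 'a measure). (0::real))"
  proof (rule integral_dominated_convergence[where s="\<lambda>N x. (norm ((\<Sum>n<N. h n x) - f x))\<^sup>2" and w="\<lambda>x. 4 * (g x)\<^sup>2"])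
    show "AE x in lborel. (\<lambda>N. (norm ((\<Sum>n<N. h n x) - f x))\<^sup>2) \<longlonglongrightarrow> 0"
      using AEsum
    proof eventually_elim
      case (elim x)
      have "(\<lambda>N. (norm ((\<Sum>n<N. h n x) - f x))\<^sup>2) \<longlonglongrightarrow> (norm (f x - f x))\<^sup>2"
        unfolding f_def by (intro tendsto_intros summable_LIMSEQ summable_norm_cancel[OF elim])
      then show ?case by simp
    qed
    show "AE x in lborel. norm ((norm ((\<Sum>n<N. h n x) - f x))\<^sup>2) \<le> 4 * (g x)\<^sup>2" for N
      using f_le Gle
    proof eventually_elim
      case (elim x)
      have "norm (\<Sum>n<N. h n x) \<le> G N x" unfolding G_def by (rule norm_sum)
      then have "norm ((\<Sum>n<N. h n x) - f x) \<le> g x + g x"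
        using elim by (intro order_trans[OF norm_triangle_ineq4] add_mono) (auto intro: order_trans)
      then have "(norm ((\<Sum>n<N. h n x) - f x))\<^sup>2 \<le> (2 * g x)\<^sup>2"
        by (intro power_mono) auto
      then show ?case by simp
    qed
    show "integrable lborel (\<lambda>x. 4 * (g x)\<^sup>2)" using g_int by simp
  qed auto
  then have "(\<lambda>N. (norm ((\<Sum>n<N. d n) - L2_of f))\<^sup>2) \<longlonglongrightarrow> 0"
    by (simp add: psum L2_of_diff f norm_L2_of_sq square_integrable_diff)
  then have "(\<lambda>N. norm ((\<Sum>n<N. d n) - L2_of f)) \<longlonglongrightarrow> 0"
    by (simp add: power_tendsto_0_iff)
  then have "d sums L2_of f"
    unfolding sums_def by (rule LIM_zero_cancel[OF tendsto_norm_zero_cancel])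
  then show ?thesis by (rule sums_summable)
qed

instance L2 :: (euclidean_space) banach
proof
  fix X :: "nat \<Rightarrow> 'a L2"
  assume X: "Cauchy X"
  have ex: "\<exists>N. \<forall>m\<ge>N. \<forall>n\<ge>N. norm (X m - X n) < (1/2) ^ k" for k
    using X unfolding Cauchy_def dist_norm by simp
  \<comment> \<open>Along a subsequence with gaps below \<open>(1/2) ^ k\<close> the telescoping
    series converges absolutely, which is what \<open>summable_L2\<close> needs.\<close>
  have "\<exists>r. \<forall>k. (\<forall>m\<ge>r k. \<forall>n\<ge>r k. norm (X m - X n) < (1/2) ^ k) \<and> r k < r (Suc k)"
  proof (rule dependent_nat_choice)
    show "\<exists>N. \<forall>m\<ge>N. \<forall>n\<ge>N. norm (X m - X n) < (1/2) ^ 0" by (rule ex)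
    fix N k
    obtain N' where N': "\<forall>m\<ge>N'. \<forall>n\<ge>N'. norm (X m - X n) < (1/2) ^ Suc k"
      using ex by blast
    show "\<exists>N'. (\<forall>m\<ge>N'. \<forall>n\<ge>N'. norm (X m - X n) < (1/2) ^ Suc k) \<and> N < N'"
      by (rule exI[of _ "max N' (Suc N)"]) (use N' in auto)
  qed
  then obtain r where r: "\<And>k. \<forall>m\<ge>r k. \<forall>n\<ge>r k. norm (X m - X n) < (1/2) ^ k"
    and mono: "\<And>k. r k < r (Suc k)" by blast
  have sm: "strict_mono r" using mono by (simp add: strict_mono_Suc_iff)
  have "summable (\<lambda>k. X (r (Suc k)) - X (r k))"
  proof (rule summable_L2)
    show "summable (\<lambda>k. norm (X (r (Suc k)) - X (r k)))"
    proof (rule summable_comparison_test[OF _ complete_algebra_summable_geometric[of "1/2::real"]])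
      show "\<exists>N. \<forall>n\<ge>N. norm (norm (X (r (Suc n)) - X (r n))) \<le> (1/2) ^ n"
      proof (intro exI allI impI)
        fix n
        have "norm (X (r (Suc n)) - X (r n)) < (1/2) ^ n"
          using r[of n] mono[of n] by (meson less_imp_le order_refl)
        then show "norm (norm (X (r (Suc n)) - X (r n))) \<le> (1/2) ^ n" by simp
      qed
    qed simp
  qed
  then have "convergent (\<lambda>n. \<Sum>k<n. X (r (Suc k)) - X (r k))"
    by (simp add: summable_iff_convergent)
  then have "convergent (\<lambda>n. X (r n) - X (r 0))"
    by (simp add: sum_lessThan_telescope[of "\<lambda>k. X (r k)"])
  then obtain l where "(\<lambda>n. X (r n) - X (r 0)) \<longlonglongrightarrow> l" by (auto simp: convergent_def)
  then have "(\<lambda>n. X (r n) - X (r 0) + X (r 0)) \<longlonglongrightarrow> l + X (r 0)" by (intro tendsto_add tendsto_const)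
  then have "(X \<circ> r) \<longlonglongrightarrow> l + X (r 0)" by (simp add: o_def)
  with X sm show "convergent X"
    using Cauchy_converges_subseq convergent_def by metis
qed

section \<open>Riesz representation by minimization\<close>

lemma parallelogram_Cauchy:
  fixes x :: "nat \<Rightarrow> 'a::real_inner"
  assumes "\<And>m n. (norm (x m - x n))\<^sup>2 \<le> e m + e n" "e \<longlonglongrightarrow> 0"
  shows "Cauchy x"
proof (rule metric_CauchyI)
  fix r :: real assume r: "0 < r"
  then have "\<forall>\<^sub>F n in sequentially. e n < r\<^sup>2 / 2"
    using assms(2) by (intro order_tendstoD) auto
  then obtain N where N: "\<And>n. n \<ge> N \<Longrightarrow> e n < r\<^sup>2 / 2" by (auto simp: eventually_sequentially)
  show "\<exists>M. \<forall>m\<ge>M. \<forall>n\<ge>M. dist (x m) (x n) < r"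
  proof (intro exI[of _ N] allI impI)
    fix m n assume "N \<le> m" "N \<le> n"
    then have "(norm (x m - x n))\<^sup>2 < r\<^sup>2"
      using assms(1)[of m n] N[of m] N[of n] by linarith
    then show "dist (x m) (x n) < r" using r by (simp add: dist_norm power2_less_imp_less)
  qed
qed

text \<open>The representing vector is the minimizer of \<open>J x = |x|^2 - 2 l(x)\<close>. A
  minimizing sequence is Cauchy by the parallelogram law, and at the minimum the derivative in every
  direction vanishes.\<close>

lemma real_Riesz:
  fixes l :: "'a::{real_inner, complete_space} \<Rightarrow> real"
  assumes "bounded_linear l"
  shows "\<exists>v. \<forall>x. l x = inner v x"
proof -
  interpret bounded_linear l by fact
  obtain K where K: "\<And>x. \<bar>l x\<bar> \<le> norm x * K" "0 \<le> K"
    using nonneg_bounded by (auto simp: mult.commute)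
  define J where "J x = (norm x)\<^sup>2 - 2 * l x" for x
  have J_ge: "J x \<ge> - K\<^sup>2" for x
  proof -
    have "l x \<le> norm x * K" using K(1)[of x] by linarith
    moreover have "0 \<le> (norm x - K)\<^sup>2" by simp
    ultimately show ?thesis by (simp add: J_def power2_diff)
  qed
  define m where "m = Inf (range J)"
  have bdd: "bdd_below (range J)" using J_ge by (auto intro!: bdd_belowI[of _ "- K\<^sup>2"])
  have m_le: "m \<le> J x" for x unfolding m_def by (rule cInf_lower[OF _ bdd]) auto
  have "\<exists>x. J x < m + 1 / real (Suc n)" for n
  proof -
    have "m < m + 1 / real (Suc n)" by simp
    then show ?thesis
      using cInf_less_iff[of "range J" "m + 1 / real (Suc n)"] bdd unfolding m_def by auto
  qed
  then obtain x where x: "\<And>n. J (x n) < m + 1 / real (Suc n)" by metis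
  \<comment> \<open>In the parallelogram law for \<open>J\<close> the linear terms cancel. As
    \<open>J\<close> at the midpoint is at least \<open>m\<close>, two nearly minimal points are
    close to each other.\<close>
  have par: "(norm (a - b))\<^sup>2 = 2 * J a + 2 * J b - 4 * J ((1/2) *\<^sub>R (a + b))" for a b
    unfolding J_def power2_norm_eq_inner
    by (simp add: scaleR add inner_add_left inner_add_right
        inner_diff_left inner_diff_right inner_commute algebra_simps del: inner_same_Basis)
  have lim0: "(\<lambda>n. 2 * (1 / real (Suc n))) \<longlonglongrightarrow> 0"
    using tendsto_mult[OF tendsto_const[of "2::real"] LIMSEQ_inverse_real_of_nat]
    by (simp add: divide_inverse)
  have "Cauchy x"
  proof (rule parallelogram_Cauchy[OF _ lim0])
    fix i j
    show "(norm (x i - x j))\<^sup>2 \<le> 2 * (1 / real (Suc i)) + 2 * (1 / real (Suc j))"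
      using par[of "x i" "x j"] x[of i] x[of j] m_le[of "(1/2) *\<^sub>R (x i + x j)"] by linarith
  qed
  then obtain v where v: "x \<longlonglongrightarrow> v" by (auto simp: convergent_eq_Cauchy[symmetric])
  have "(\<lambda>n. J (x n)) \<longlonglongrightarrow> J v"
    unfolding J_def by (intro tendsto_intros v tendsto)
  moreover have "(\<lambda>n. J (x n)) \<longlonglongrightarrow> m"
  proof (rule tendsto_sandwich[OF _ _ tendsto_const])
    show "(\<lambda>n. m + 1 / real (Suc n)) \<longlonglongrightarrow> m"
      using tendsto_add[OF tendsto_const[of m] LIMSEQ_inverse_real_of_nat] by (simp add: divide_inverse)
  qed (use m_le x in \<open>auto intro!: always_eventually less_imp_le\<close>)
  ultimately have Jv: "J v = m" by (rule LIMSEQ_unique)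
  have "l y = inner v y" for y
  proof (rule ccontr)
    assume ne: "l y \<noteq> inner v y"
    define D where "D = l y - inner v y"
    have D: "D \<noteq> 0" using ne by (simp add: D_def)
    then have y: "y \<noteq> 0" using zero by (auto simp: D_def)
    \<comment> \<open>The minimizer of the quadratic polynomial \<open>J (v + t *\<^sub>R y)\<close>
      in \<open>t\<close>; for \<open>D \<noteq> 0\<close> its value lies below
      \<open>J v\<close>.\<close>
    define t where "t = D / (norm y)\<^sup>2"
    have "J (v + t *\<^sub>R y) = J v - 2 * t * D + t\<^sup>2 * (norm y)\<^sup>2"
      unfolding J_def D_def power2_norm_eq_inner
      by (simp add: add scaleR inner_add_left inner_add_right inner_commute algebra_simps
          power2_eq_square)
    also have "\<dots> = J v - D\<^sup>2 / (norm y)\<^sup>2"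
      using y by (simp add: t_def power2_eq_square field_simps)
    also have "\<dots> < J v" using D y by simp
    finally show False using m_le[of "v + t *\<^sub>R y"] Jv by simp
  qed
  then show ?thesis by blast
qed

text \<open>\<open>cinner v x\<close> is conjugate linear in \<open>x\<close>, hence the form of
  \<open>sc\<close>. The real theorem yields the real part, and inserting
  \<open>\<i> *\<^sub>C x\<close> yields the imaginary part.\<close>

lemma complex_Riesz:
  fixes l :: "'a::euclidean_space L2 \<Rightarrow> complex"
  assumes add: "\<And>x y. l (x + y) = l x + l y" and sc: "\<And>c x. l (c *\<^sub>C x) = cnj c * l x"
    and bd: "\<And>x. cmod (l x) \<le> K * norm x"
  shows "\<exists>v. \<forall>x. l x = cinner v x"
proof -
  have "bounded_linear (\<lambda>x. Re (l x))"
  proof (rule bounded_linear_intro[of _ K])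
    show "Re (l (r *\<^sub>R x)) = r *\<^sub>R Re (l x)" for r x
      using sc[of "complex_of_real r" x] by (simp add: scaleC_of_real)
    show "norm (Re (l x)) \<le> norm x * K" for x
      using bd[of x] abs_Re_le_cmod[of "l x"] by (simp add: mult.commute)
  qed (simp add: add)
  then obtain v where v: "\<And>x. Re (l x) = inner v x" using real_Riesz by blast
  have "l x = cinner v x" for x
  proof (rule complex_eqI)
    show "Re (l x) = Re (cinner v x)" by (simp add: v inner_L2_def)
    show "Im (l x) = Im (cinner v x)"
      using v[of "\<i> *\<^sub>C x"] by (simp add: sc inner_L2_def)
  qed
  then show ?thesis by blast
qed

section \<open>Orthonormal systems\<close>

lemma bounded_clinearI:
  assumes "\<And>x y. A (x + y) = A x + A y" "\<And>c x. A (c *\<^sub>C x) = c *\<^sub>C A x"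
    and "\<And>x. norm (A x) \<le> K * norm x"
  shows "bounded_clinear A"
  unfolding bounded_clinear_def
proof
  show "bounded_linear A"
    using assms(1) assms(2)[of "complex_of_real _"] assms(3)
    by (intro bounded_linear_intro[of A K]) (auto simp: scaleC_of_real mult.commute)
qed (use assms(2) in blast)

lemma bounded_clinearD:
  assumes "bounded_clinear A"
  shows "bounded_linear A" "A (c *\<^sub>C x) = c *\<^sub>C A x"
    "A (x + y) = A x + A y" "A (x - y) = A x - A y" "A 0 = 0" "A (\<Sum>i\<in>I. f i) = (\<Sum>i\<in>I. A (f i))"
proof -
  show bl: "bounded_linear A" using assms by (simp add: bounded_clinear_def)
  interpret bounded_linear A by (rule bl)
  show "A (c *\<^sub>C x) = c *\<^sub>C A x" using assms by (simp add: bounded_clinear_def)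
  show "A (x + y) = A x + A y" "A (x - y) = A x - A y" "A 0 = 0"
    "A (\<Sum>i\<in>I. f i) = (\<Sum>i\<in>I. A (f i))"
    by (simp_all add: add diff zero sum)
qed

lemma bounded_clinear_bound:
  assumes "bounded_clinear A"
  obtains K where "0 \<le> K" "\<And>x. norm (A x) \<le> K * norm x"
  using bounded_linear.nonneg_bounded[OF bounded_clinearD(1)[OF assms]] by (auto simp: mult.commute)

text \<open>Partial systems occur as initial segments that are still to be extended, as finite index
  sets in Bessel's inequality, and on the indices of the positive singular values.\<close>

definition orthonormal_on :: "nat set \<Rightarrow> (nat \<Rightarrow> 'a::euclidean_space L2) \<Rightarrow> bool" where
  "orthonormal_on I e \<longleftrightarrow> (\<forall>m\<in>I. \<forall>n\<in>I. cinner (e m) (e n) = (if m = n then 1 else 0))"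

lemma orthonormal_on_UNIV: "orthonormal_on UNIV e \<longleftrightarrow> orthonormal e"
  by (simp add: orthonormal_on_def orthonormal_def)

lemma orthonormal_imp_on: "orthonormal e \<Longrightarrow> orthonormal_on I e"
  by (auto simp: orthonormal_on_def orthonormal_def)

lemma orthonormalD:
  "orthonormal e \<Longrightarrow> cinner (e m) (e n) = (if m = n then 1 else 0)"
  by (simp add: orthonormal_def)

lemma norm_eq_1_cinner: "norm x = 1 \<longleftrightarrow> cinner x x = 1"
  by (metis cinner_self norm_ge_zero of_real_1 of_real_eq_iff one_power2 power2_eq_iff_nonneg zero_le_one)

lemma norm_orthonormal: "orthonormal e \<Longrightarrow> norm (e n) = 1"
  by (simp add: norm_eq_1_cinner orthonormalD)

lemma orthonormalI:
  assumes "\<And>n. norm (e n) = 1" "\<And>m n. m < n \<Longrightarrow> cinner (e n) (e m) = 0"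
  shows "orthonormal e"
  unfolding orthonormal_def
proof (intro allI)
  fix m n
  have "cinner (e m) (e n) = 0" if "m \<noteq> n"
    using that assms(2)[of m n] assms(2)[of n m] cinner_commute[of "e m" "e n"]
    by (cases "m < n") auto
  then show "cinner (e m) (e n) = (if m = n then 1 else 0)"
    using assms(1)[of n] by (auto simp: norm_eq_1_cinner)
qed

lemma norm_sum_orthonormal:
  assumes "orthonormal_on I e" "finite I"
  shows "(norm (\<Sum>n\<in>I. c n *\<^sub>C e n))\<^sup>2 = (\<Sum>n\<in>I. (cmod (c n))\<^sup>2)"
proof -
  have "complex_of_real ((norm (\<Sum>n\<in>I. c n *\<^sub>C e n))\<^sup>2) =
      (\<Sum>n\<in>I. \<Sum>m\<in>I. c n * cnj (c m) * cinner (e n) (e m))"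
    unfolding cinner_self[symmetric] cinner.sum_left
    by (intro sum.cong refl) (simp only: cinner.sum_right cinner_scaleC_left cinner_scaleC_right
        sum_distrib_left mult.assoc mult.left_commute)
  also have "\<dots> = (\<Sum>n\<in>I. \<Sum>m\<in>I. if n = m then c n * cnj (c n) else 0)"
    using assms(1) by (intro sum.cong refl) (auto simp: orthonormal_on_def)
  also have "\<dots> = complex_of_real (\<Sum>n\<in>I. (cmod (c n))\<^sup>2)"
    using assms(2) by (simp add: complex_norm_square del: of_real_power)
  finally show ?thesis by (simp only: of_real_eq_iff)
qed

definition ortho_proj :: "nat set \<Rightarrow> (nat \<Rightarrow> 'a::euclidean_space L2) \<Rightarrow> 'a L2 \<Rightarrow> 'a L2" where
  "ortho_proj I e \<psi> = (\<Sum>n\<in>I. cinner \<psi> (e n) *\<^sub>C e n)"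

lemma cinner_ortho_proj:
  assumes "orthonormal_on I e" "finite I" "m \<in> I"
  shows "cinner (\<psi> - ortho_proj I e \<psi>) (e m) = 0"
proof -
  have "cinner (ortho_proj I e \<psi>) (e m) = (\<Sum>n\<in>I. if n = m then cinner \<psi> (e m) else 0)"
    unfolding ortho_proj_def cinner.sum_left
    using assms by (intro sum.cong refl) (auto simp: orthonormal_on_def)
  then show ?thesis using assms by (simp add: cinner.diff_left)
qed

lemma Pythagoras_ortho_proj:
  assumes "orthonormal_on I e" "finite I"
  shows "(norm \<psi>)\<^sup>2 = (norm (\<psi> - ortho_proj I e \<psi>))\<^sup>2 + (\<Sum>n\<in>I. (cmod (cinner \<psi> (e n)))\<^sup>2)"
proof -
  define P where "P = ortho_proj I e \<psi>"
  have P: "P = (\<Sum>n\<in>I. cinner \<psi> (e n) *\<^sub>C e n)" by (simp add: P_def ortho_proj_def)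
  have "cinner v P = (\<Sum>n\<in>I. cnj (cinner \<psi> (e n)) * cinner v (e n))" for v
    unfolding P by (simp add: cinner.sum_right)
  then have "cinner (\<psi> - P) P = 0"
    using cinner_ortho_proj[OF assms] by (simp add: P_def)
  then have "inner (\<psi> - P) P = 0" by (simp add: inner_L2_def)
  then have "(norm \<psi>)\<^sup>2 = (norm (\<psi> - P))\<^sup>2 + (norm P)\<^sup>2"
    using norm_add_Pythagorean[of "\<psi> - P" P] by (simp add: orthogonal_def)
  then show ?thesis
    using norm_sum_orthonormal[OF assms, of "\<lambda>n. cinner \<psi> (e n)"]
    by (simp only: P_def[symmetric] P[symmetric])
qed

lemma Bessel:
  assumes "orthonormal_on I e" "finite I"
  shows "(\<Sum>n\<in>I. (cmod (cinner \<psi> (e n)))\<^sup>2) \<le> (norm \<psi>)\<^sup>2"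
  using Pythagoras_ortho_proj[OF assms, of \<psi>] zero_le_power2[of "norm (\<psi> - ortho_proj I e \<psi>)"]
  by linarith

lemma norm_diff_ortho_proj_le:
  assumes "orthonormal_on I e" "finite I"
  shows "norm (\<psi> - ortho_proj I e \<psi>) \<le> norm \<psi>"
proof (rule power2_le_imp_le)
  show "(norm (\<psi> - ortho_proj I e \<psi>))\<^sup>2 \<le> (norm \<psi>)\<^sup>2"
    using Pythagoras_ortho_proj[OF assms, of \<psi>] sum_nonneg[of I "\<lambda>n. (cmod (cinner \<psi> (e n)))\<^sup>2"]
    by simp
qed simp

lemma orthonormal_weakly_null:
  assumes "orthonormal e"
  shows "(\<lambda>n. cinner \<psi> (e n)) \<longlonglongrightarrow> 0"
proof -
  have "summable (\<lambda>n. (cmod (cinner \<psi> (e n)))\<^sup>2)"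
    using Bessel[OF orthonormal_imp_on[OF assms]]
    by (intro summableI_nonneg_bounded[of _ "(norm \<psi>)\<^sup>2"]) auto
  then have "(\<lambda>n. (cmod (cinner \<psi> (e n)))\<^sup>2) \<longlonglongrightarrow> 0" by (rule summable_LIMSEQ_zero)
  then show ?thesis by (simp add: power_tendsto_0_iff tendsto_norm_zero_iff)
qed

text \<open>The plane spanned by \<open>u (2 * k)\<close> and \<open>u (2 * k + 1)\<close> contains
  a unit vector orthogonal to \<open>f\<close>, and different planes are orthogonal. The last clause
  holds as each \<open>w k\<close> is a combination of members of \<open>u\<close>; it preserves
  what was achieved for earlier vectors, which makes the construction iterable.\<close>

lemma orthonormal_avoid_vector:
  assumes u: "orthonormal u"
  shows "\<exists>w. orthonormal w \<and> (\<forall>k. cinner (w k) f = 0) \<and>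
           (\<forall>g. (\<forall>k. cinner (u k) g = 0) \<longrightarrow> (\<forall>k. cinner (w k) g = 0))"
proof -
  have ex: "\<exists>\<alpha> \<beta>. (cmod \<alpha>)\<^sup>2 + (cmod \<beta>)\<^sup>2 = 1 \<and> \<alpha> * a + \<beta> * b = 0" for a b :: complex
  proof (cases "a = 0 \<and> b = 0")
    case True
    then show ?thesis by (intro exI[of _ 1] exI[of _ 0]) simp
  next
    case False
    \<comment> \<open>The witness is \<open>(b, -a)\<close>, which solves the linear equation,
      divided by its length \<open>sqrt r\<close>.\<close>
    define r where "r = (cmod a)\<^sup>2 + (cmod b)\<^sup>2"
    have r: "r > 0"
      using False by (auto simp: r_def add_pos_nonneg add_nonneg_pos)
    show ?thesis
    proof (intro exI conjI)
      show "(cmod (b / sqrt r))\<^sup>2 + (cmod (- a / sqrt r))\<^sup>2 = 1"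
        using r by (simp add: norm_divide power_divide add_divide_distrib[symmetric])
          (simp add: r_def add.commute)
    qed (simp add: mult.commute)
  qed
  obtain \<alpha> \<beta> where ab: "\<And>k. (cmod (\<alpha> k))\<^sup>2 + (cmod (\<beta> k))\<^sup>2 = 1"
    "\<And>k. \<alpha> k * cinner (u (2 * k)) f + \<beta> k * cinner (u (2 * k + 1)) f = 0"
  proof -
    have "\<forall>k. \<exists>\<alpha> \<beta>. (cmod \<alpha>)\<^sup>2 + (cmod \<beta>)\<^sup>2 = 1 \<and>
        \<alpha> * cinner (u (2 * k)) f + \<beta> * cinner (u (2 * k + 1)) f = 0"
      by (intro allI ex)
    then show thesis using that by (simp only: choice_iff) blast
  qed
  define w where "w k = \<alpha> k *\<^sub>C u (2 * k) + \<beta> k *\<^sub>C u (2 * k + 1)" for k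
  have ne: "2 * m \<noteq> 2 * n + 1" "2 * m + 1 \<noteq> 2 * n" "Suc (2 * m) \<noteq> 2 * n" "2 * m \<noteq> Suc (2 * n)" for m n :: nat
    by presburger+
  have "orthonormal w"
    unfolding orthonormal_def
  proof (intro allI)
    fix m n
    have "cinner (w m) (w n) = (if m = n then \<alpha> m * cnj (\<alpha> m) + \<beta> m * cnj (\<beta> m) else 0)"
      using ne by (simp add: w_def cinner_add_left cinner_add_right orthonormalD[OF u])
    also have "\<alpha> m * cnj (\<alpha> m) + \<beta> m * cnj (\<beta> m) = complex_of_real ((cmod (\<alpha> m))\<^sup>2 + (cmod (\<beta> m))\<^sup>2)"
      by (simp only: complex_norm_square of_real_add)
    finally show "cinner (w m) (w n) = (if m = n then 1 else 0)" by (simp add: ab)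
  qed
  moreover have "cinner (w k) f = 0" for k
    using ab(2)[of k] by (simp add: w_def cinner_add_left)
  ultimately show ?thesis
    by (intro exI[of _ w]) (simp add: w_def cinner_add_left)
qed

text \<open>The sequence \<open>u\<close> witnesses infinite dimension: pairing up its members once
  for every element of \<open>F\<close> still leaves a whole orthonormal sequence orthogonal to
  \<open>F\<close>.\<close>

lemma unit_vector_orthogonal_finite:
  fixes u :: "nat \<Rightarrow> 'a::euclidean_space L2" and F :: "'a L2 set"
  assumes u: "orthonormal u" and F: "finite F"
  shows "\<exists>v. norm v = 1 \<and> (\<forall>f\<in>F. cinner v f = 0)"
proof -
  have "\<exists>w. orthonormal w \<and> (\<forall>f\<in>F. \<forall>k. cinner (w k) f = 0)"
    using F
  proof (induction F rule: finite_induct)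
    case empty
    then show ?case using u by auto
  next
    case (insert f F)
    then obtain w where w: "orthonormal w" "\<forall>f\<in>F. \<forall>k. cinner (w k) f = 0" by blast
    with orthonormal_avoid_vector[OF w(1), of f] show ?case by blast
  qed
  then show ?thesis using norm_orthonormal by blast
qed

lemma orthonormal_extend:
  fixes u e :: "nat \<Rightarrow> 'a::euclidean_space L2"
  assumes u: "orthonormal u" and e: "orthonormal_on {..<N} e"
  shows "\<exists>e'. orthonormal e' \<and> (\<forall>n<N. e' n = e n)"
proof -
  \<comment> \<open>Orthonormality is expressed as unit norm and orthogonality to the predecessors,
    so that members can be chosen one after the other; below \<open>N\<close> the choice is
    forced.\<close>
  define P where "P f n x \<longleftrightarrow> norm x = 1 \<and> (\<forall>k<n. cinner x (f k) = 0) \<and> (n < N \<longrightarrow> x = e n)"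
    for f :: "nat \<Rightarrow> 'a L2" and n x
  have "\<exists>f. \<forall>n. P f n (f n)"
  proof (rule dependent_wellorder_choice)
    show "P f n x = P g n x" if "\<And>k. k < n \<Longrightarrow> f k = g k" for x f g n
      using that by (simp add: P_def)
    fix n f assume IH: "\<And>k. k < n \<Longrightarrow> P f k (f k)"
    show "\<exists>x. P f n x"
    proof (cases "n < N")
      case True
      have "f k = e k" if "k < n" for k using IH[OF that] True that by (simp add: P_def)
      then have "P f n (e n)"
        using True e by (simp add: P_def orthonormal_on_def norm_eq_1_cinner)
      then show ?thesis by blast
    next
      case False
      then show ?thesis
        using unit_vector_orthogonal_finite[OF u, of "f ` {..<n}"] by (auto simp: P_def)
    qed
  qed
  then obtain f where "\<And>n. P f n (f n)" by blast
  then show ?thesis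
    by (intro exI[of _ f] conjI orthonormalI) (auto simp: P_def)
qed

text \<open>The functionals that describe the Schatten norm take infinite orthonormal sequences;
  this allows them to be evaluated at a single unit vector, placed at index 0.\<close>

lemma orthonormal_start:
  fixes u :: "nat \<Rightarrow> 'a::euclidean_space L2" and v :: "'a L2"
  assumes "orthonormal u" "norm v = 1"
  shows "\<exists>e. orthonormal e \<and> e 0 = v"
proof -
  have "orthonormal_on {..<1} (\<lambda>_. v)"
    using assms(2) by (simp add: orthonormal_on_def norm_eq_1_cinner)
  from orthonormal_extend[OF assms(1) this] show ?thesis by auto
qed

section \<open>Continuity of translations\<close>

lemma lborel_translate:
  fixes g :: "'a::euclidean_space \<Rightarrow> 'b::{banach, second_countable_topology}"
  assumes [measurable]: "g \<in> borel_measurable borel"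
  shows integral_translate: "(LINT t|lborel. g (t - x)) = (LINT t|lborel. g t)"
    and integrable_translate: "integrable lborel (\<lambda>t. g (t - x)) \<longleftrightarrow> integrable lborel g"
proof -
  have "(LINT t|lborel. g t) = (LINT t|distr lborel borel ((+) (- x)). g t)"
    by (simp only: lborel_distr_plus)
  also have "\<dots> = (LINT t|lborel. g (- x + t))"
    by (rule integral_distr) auto
  finally show "(LINT t|lborel. g (t - x)) = (LINT t|lborel. g t)" by simp
  have "integrable lborel g \<longleftrightarrow> integrable (distr lborel borel ((+) (- x))) g"
    by (simp only: lborel_distr_plus)
  also have "\<dots> \<longleftrightarrow> integrable lborel (\<lambda>t. g (- x + t))"
    by (rule integrable_distr_eq) auto
  finally show "integrable lborel (\<lambda>t. g (t - x)) \<longleftrightarrow> integrable lborel g" by simp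
qed

text \<open>The sequential form fits dominated convergence, and it determines the limit at 0 since
  Euclidean spaces are first countable.\<close>

definition L1_shift_continuous :: "('a::euclidean_space \<Rightarrow> 'b::{banach, second_countable_topology}) \<Rightarrow> bool" where
  "L1_shift_continuous f \<longleftrightarrow>
     (\<forall>X. X \<longlonglongrightarrow> 0 \<longrightarrow> (\<lambda>n. LINT t|lborel. norm (f (t - X n) - f t)) \<longlonglongrightarrow> 0)"

text \<open>The property is closed in L1: translations are isometries there, so the distance of
  \<open>f\<close> and \<open>g\<close> enters twice and the shift of \<open>g\<close> once, each
  below \<open>r / 3\<close>.\<close>

lemma L1_shift_continuous_approx:
  fixes f :: "'a::euclidean_space \<Rightarrow> 'b::{banach, second_countable_topology}"
  assumes f: "integrable lborel f"
    and ap: "\<And>eps. 0 < eps \<Longrightarrow> \<exists>g. integrable lborel g \<and> L1_shift_continuous g \<and>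
               (LINT t|lborel. norm (f t - g t)) < eps"
  shows "L1_shift_continuous f"
  unfolding L1_shift_continuous_def
proof (intro allI impI, rule LIMSEQ_I)
  fix X :: "nat \<Rightarrow> 'a" and r :: real
  assume X: "X \<longlonglongrightarrow> 0" and r: "0 < r"
  obtain g where g: "integrable lborel g" "L1_shift_continuous g"
    and fg: "(LINT t|lborel. norm (f t - g t)) < r / 3"
    using ap[of "r / 3"] r by auto
  have [measurable]: "f \<in> borel_measurable borel" "g \<in> borel_measurable borel"
    using borel_measurable_integrable[OF f] borel_measurable_integrable[OF g(1)] by simp_all
  have "(\<lambda>n. LINT t|lborel. norm (g (t - X n) - g t)) \<longlonglongrightarrow> 0"
    using g(2) X unfolding L1_shift_continuous_def by blast
  from LIMSEQ_D[OF this, of "r / 3"] r obtain N where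
    N: "\<And>n. n \<ge> N \<Longrightarrow> norm (LINT t|lborel. norm (g (t - X n) - g t)) < r / 3" by auto
  show "\<exists>N. \<forall>n\<ge>N. norm ((LINT t|lborel. norm (f (t - X n) - f t)) - 0) < r"
  proof (intro exI[of _ N] allI impI)
    fix n assume n: "n \<ge> N"
    let ?x = "X n"
    have fx: "integrable lborel (\<lambda>t. f (t - ?x))" and gx: "integrable lborel (\<lambda>t. g (t - ?x))"
      using f g by (simp_all add: integrable_translate)
    have "(LINT t|lborel. norm (f (t - ?x) - f t)) \<le>
        (LINT t|lborel. norm (f (t - ?x) - g (t - ?x)) + norm (g (t - ?x) - g t) + norm (f t - g t))"
    proof (rule integral_mono)
      fix t
      have "f (t - ?x) - f t = (f (t - ?x) - g (t - ?x)) + (g (t - ?x) - g t) + (g t - f t)" by simp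
      then show "norm (f (t - ?x) - f t) \<le>
          norm (f (t - ?x) - g (t - ?x)) + norm (g (t - ?x) - g t) + norm (f t - g t)"
        by (metis norm_triangle_le norm_triangle_ineq norm_minus_commute add_mono order_refl)
    qed (use f g fx gx in auto)
    also have "\<dots> = (LINT t|lborel. norm (f (t - ?x) - g (t - ?x))) +
        (LINT t|lborel. norm (g (t - ?x) - g t)) + (LINT t|lborel. norm (f t - g t))"
      using f g fx gx by (subst Bochner_Integration.integral_add | simp)+
    also have "(LINT t|lborel. norm (f (t - ?x) - g (t - ?x))) = (LINT t|lborel. norm (f t - g t))"
      by (rule integral_translate) measurable
    finally have "(LINT t|lborel. norm (f (t - ?x) - f t)) < r"
      using fg N[OF n] by (simp add: abs_if split: if_splits)
    then show "norm ((LINT t|lborel. norm (f (t - ?x) - f t)) - 0) < r"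
      by simp
  qed
qed

text \<open>Openness gives pointwise convergence of the positive part \<open>?m\<close> only; the
  boundary of \<open>U\<close> may have positive measure. But the modulus of the difference is
  \<open>2 * ?m\<close> plus a term whose integral vanishes by translation invariance, so the
  positive part suffices.\<close>

lemma L1_shift_continuous_open:
  fixes c :: "'b::{banach, second_countable_topology}"
  assumes U: "open U" "emeasure lborel U < \<infinity>"
  shows "L1_shift_continuous (\<lambda>t::'a::euclidean_space. indicator U t *\<^sub>R c)"
  unfolding L1_shift_continuous_def
proof (intro allI impI)
  fix X :: "nat \<Rightarrow> 'a" assume X: "X \<longlonglongrightarrow> 0"
  let ?i = "indicator U :: 'a \<Rightarrow> real"
  have [measurable]: "U \<in> sets borel" using U by simp
  have i: "integrable lborel ?i" using U by (simp add: integrable_indicator_iff)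
  have ix: "integrable lborel (\<lambda>t. ?i (t - x))" for x
    using i by (subst integrable_translate) auto
  let ?m = "\<lambda>n t. max 0 (?i t - ?i (t - X n))"
  have mint: "integrable lborel (?m n)" for n
    using i ix by (intro integrable_max) auto
  have "(\<lambda>n. LINT t|lborel. ?m n t) \<longlonglongrightarrow> (LINT t|(lborel::'a measure). (0::real))"
  proof (rule integral_dominated_convergence[where w="?i"])
    show "AE t in lborel. (\<lambda>n. ?m n t) \<longlonglongrightarrow> 0"
    proof (rule AE_I2)
      fix t
      have "(\<lambda>n. t - X n) \<longlonglongrightarrow> t - 0" by (intro tendsto_intros X)
      then have ev: "\<forall>\<^sub>F n in sequentially. t - X n \<in> U" if "t \<in> U"
        using that U(1) topological_tendstoD by fastforce
      have "\<forall>\<^sub>F n in sequentially. ?m n t = 0"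
      proof (cases "t \<in> U")
        case True
        from ev[OF True] show ?thesis by eventually_elim (simp add: True)
      qed simp
      then show "(\<lambda>n. ?m n t) \<longlonglongrightarrow> 0" by (rule tendsto_eventually)
    qed
    show "AE t in lborel. norm (?m n t) \<le> ?i t" for n
      by (rule AE_I2) (auto simp: indicator_def)
  qed (use i in auto)
  then have lim: "(\<lambda>n. norm c * (2 * (LINT t|lborel. ?m n t))) \<longlonglongrightarrow> norm c * (2 * 0)"
    by (intro tendsto_intros) simp
  have "(LINT t|lborel. norm (?i (t - X n) *\<^sub>R c - ?i t *\<^sub>R c)) = norm c * (2 * (LINT t|lborel. ?m n t))" for n
  proof -
    have "(LINT t|lborel. norm (?i (t - X n) *\<^sub>R c - ?i t *\<^sub>R c)) =
        (LINT t|lborel. norm c * (2 * ?m n t + (?i (t - X n) - ?i t)))"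
    proof (rule Bochner_Integration.integral_cong)
      fix t
      have "norm (?i (t - X n) *\<^sub>R c - ?i t *\<^sub>R c) = norm c * \<bar>?i (t - X n) - ?i t\<bar>"
        by (simp add: scaleR_left_diff_distrib[symmetric] mult.commute)
      then show "norm (?i (t - X n) *\<^sub>R c - ?i t *\<^sub>R c) = norm c * (2 * ?m n t + (?i (t - X n) - ?i t))"
        by (auto simp: max_def abs_if)
    qed simp
    also have "\<dots> = norm c * (2 * (LINT t|lborel. ?m n t) + ((LINT t|lborel. ?i (t - X n)) - (LINT t|lborel. ?i t)))"
      using mint i ix by simp
    also have "(LINT t|lborel. ?i (t - X n)) = (LINT t|lborel. ?i t)"
      by (rule integral_translate) measurable
    finally show ?thesis by simp
  qed
  with lim show "(\<lambda>n. LINT t|lborel. norm (?i (t - X n) *\<^sub>R c - ?i t *\<^sub>R c)) \<longlonglongrightarrow> 0"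
    by simp
qed

text \<open>Induction over integrable functions reduces to indicators of measurable sets, and outer
  regularity reduces these to open sets.\<close>

lemma integrable_L1_shift_continuous:
  fixes f :: "'a::euclidean_space \<Rightarrow> 'b::{banach, second_countable_topology}"
  assumes "integrable lborel f"
  shows "L1_shift_continuous f"
  using assms
proof (induction rule: integrable_induct)
  case (base A c)
  have A: "A \<in> sets borel" using base by simp
  have Afin: "emeasure lborel A < \<infinity>" using base by simp
  show ?case
  proof (rule L1_shift_continuous_approx)
    show "integrable lborel (\<lambda>x. indicator A x *\<^sub>R c)"
      using base by (intro integrable_scaleR_left) (simp add: integrable_indicator_iff)
    fix eps :: real assume e: "0 < eps"
    have "A \<in> sets lebesgue" using A by simp
    \<comment> \<open>Replacing \<open>A\<close> by \<open>U\<close> costs the measure of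
      \<open>U - A\<close> times \<open>norm c\<close>; the denominator \<open>1 + norm c\<close> is
      positive even for \<open>c = 0\<close>.\<close>
    then obtain U where U: "open U" "A \<subseteq> U" "emeasure lebesgue (U - A) < ennreal (eps / (1 + norm c))"
      using sets_lebesgue_outer_open[of A "eps / (1 + norm c)"] e
      by (metis add_pos_nonneg divide_pos_pos norm_ge_zero zero_less_one)
    have Ub[measurable]: "U \<in> sets borel" "A \<in> sets borel" using U A by auto
    have UA: "emeasure lborel (U - A) < ennreal (eps / (1 + norm c))"
      using U(3) by simp
    have "emeasure lborel U \<le> emeasure lborel A + emeasure lborel (U - A)"
    proof -
      have "emeasure lborel U \<le> emeasure lborel (A \<union> (U - A))"
        by (intro emeasure_mono) auto
      also have "\<dots> \<le> emeasure lborel A + emeasure lborel (U - A)"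
        by (intro emeasure_subadditive) auto
      finally show ?thesis .
    qed
    also have "\<dots> < \<infinity>" using Afin less_trans[OF UA ennreal_less_top] by simp
    finally have Ufin: "emeasure lborel U < \<infinity>" .
    have Am: "measure lborel (U - A) < eps / (1 + norm c)"
    proof -
      have "emeasure lborel (U - A) = ennreal (measure lborel (U - A))"
        using less_trans[OF UA ennreal_less_top] by (intro emeasure_eq_ennreal_measure) simp
      with UA show ?thesis by (simp add: ennreal_less_iff)
    qed
    have "(LINT t|lborel. norm (indicator A t *\<^sub>R c - indicator U t *\<^sub>R c)) =
        (LINT t|lborel. indicator (U - A) t * norm c)"
      by (rule Bochner_Integration.integral_cong) (use U in \<open>auto simp: indicator_def\<close>)
    also have "\<dots> = measure lborel (U - A) * norm c"
      by simp
    also have "\<dots> \<le> measure lborel (U - A) * (1 + norm c)"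
      by (intro mult_left_mono) auto
    also have "\<dots> < eps"
      using Am by (simp add: pos_less_divide_eq add_pos_nonneg)
    finally have "(LINT t|lborel. norm (indicator A t *\<^sub>R c - indicator U t *\<^sub>R c)) < eps" .
    then show "\<exists>g. integrable lborel g \<and> L1_shift_continuous g \<and>
       (LINT t|lborel. norm (indicator A t *\<^sub>R c - g t)) < eps"
      using Ufin U by (intro exI[of _ "\<lambda>t. indicator U t *\<^sub>R c"] conjI L1_shift_continuous_open
          integrable_scaleR_left) (auto simp: integrable_indicator_iff)
  qed
next
  case (add f g)
  note [measurable] = borel_measurable_integrable[OF add.hyps(1)] borel_measurable_integrable[OF add.hyps(2)]
  show ?case
    unfolding L1_shift_continuous_def
  proof (intro allI impI)
    fix X :: "nat \<Rightarrow> 'a" assume X: "X \<longlonglongrightarrow> 0"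
    have fx: "integrable lborel (\<lambda>t. f (t - x))" and gx: "integrable lborel (\<lambda>t. g (t - x))" for x
      using add by (subst integrable_translate; simp)+
    let ?l = "\<lambda>n. LINT t|lborel. norm (f (t - X n) + g (t - X n) - (f t + g t))"
    let ?r = "\<lambda>n. (LINT t|lborel. norm (f (t - X n) - f t)) + (LINT t|lborel. norm (g (t - X n) - g t))"
    have lim: "(\<lambda>n. ?r n) \<longlonglongrightarrow> 0 + 0"
      using add X unfolding L1_shift_continuous_def by (intro tendsto_add) auto
    show "?l \<longlonglongrightarrow> 0"
    proof (rule tendsto_sandwich[OF _ _ tendsto_const])
      show "\<forall>\<^sub>F n in sequentially. ?l n \<le> ?r n"
      proof (rule always_eventually, rule allI)
        fix n
        have "?l n
          \<le> (LINT t|lborel. norm (f (t - X n) - f t) + norm (g (t - X n) - g t))"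
          by (rule integral_mono)
             (use add fx gx in \<open>auto simp: add_diff_add intro: norm_triangle_ineq\<close>)
        also have "\<dots> = ?r n"
          using add fx gx by (intro Bochner_Integration.integral_add) auto
        finally show "?l n \<le> ?r n" .
      qed
    qed (use lim in auto)
  qed
next
  case (lim f s)
  show ?case
  proof (rule L1_shift_continuous_approx[OF lim.hyps(4)])
    fix eps :: real assume e: "0 < eps"
    note [measurable] = borel_measurable_integrable[OF lim.hyps(4)] borel_measurable_integrable[OF lim.hyps(1)]
    \<comment> \<open>The simple functions satisfy \<open>norm (s i t) \<le> 2 * norm (f t)\<close>,
      whence the majorant with factor 3.\<close>
    have "(\<lambda>i. LINT t|lborel. norm (f t - s i t)) \<longlonglongrightarrow> (LINT t|(lborel::'a measure). (0::real))"
    proof (rule integral_dominated_convergence[where w="\<lambda>t. 3 * norm (f t)"])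
      show "AE t in lborel. (\<lambda>i. norm (f t - s i t)) \<longlonglongrightarrow> 0"
      proof (rule AE_I2)
        fix t
        have "(\<lambda>i. norm (f t - s i t)) \<longlonglongrightarrow> norm (f t - f t)"
          using lim.hyps(2)[of t] by (intro tendsto_intros) auto
        then show "(\<lambda>i. norm (f t - s i t)) \<longlonglongrightarrow> 0" by simp
      qed
      show "AE t in lborel. norm (norm (f t - s i t)) \<le> 3 * norm (f t)" for i
      proof (rule AE_I2)
        fix t
        show "norm (norm (f t - s i t)) \<le> 3 * norm (f t)"
          using lim.hyps(3)[of t i] norm_triangle_ineq4[of "f t" "s i t"] by simp
      qed
    qed (use lim.hyps(4) in auto)
    then have "(\<lambda>i. LINT t|lborel. norm (f t - s i t)) \<longlonglongrightarrow> 0" by simp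
    from order_tendstoD(2)[OF this e] obtain i where "(LINT t|lborel. norm (f t - s i t)) < eps"
      by (auto simp: eventually_sequentially)
    with lim show "\<exists>g. integrable lborel g \<and> L1_shift_continuous g \<and> (LINT t|lborel. norm (f t - g t)) < eps"
      by blast
  qed
qed

text \<open>The map \<open>r \<mapsto> r\<bar>r\<bar>\<close> turns continuity of translations in \<open>L\<^sup>1\<close> into continuity in \<open>L\<^sup>2\<close>.\<close>

lemma square_diff_le:
  fixes a b :: real
  shows "(a - b)\<^sup>2 \<le> 2 * \<bar>a * \<bar>a\<bar> - b * \<bar>b\<bar>\<bar>"
proof -
  have same: "(a - b)\<^sup>2 \<le> 2 * \<bar>a * a - b * b\<bar>" if "0 \<le> a" "0 \<le> b" for a b :: real
  proof -
    have "(a - b)\<^sup>2 = \<bar>a - b\<bar> * \<bar>a - b\<bar>" by (simp add: power2_eq_square)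
    also have "\<dots> \<le> \<bar>a - b\<bar> * (2 * \<bar>a + b\<bar>)" using that by (intro mult_left_mono) auto
    also have "\<dots> = 2 * \<bar>a * a - b * b\<bar>"
      by (simp add: abs_mult[symmetric] algebra_simps)
    finally show ?thesis .
  qed
  have opp: "(a + b)\<^sup>2 \<le> 2 * (a * a + b * b)" for a b :: real
    using sum_squares_ge_zero[of "a - b" 0] by (simp add: power2_eq_square algebra_simps)
  consider "0 \<le> a" "0 \<le> b" | "a \<le> 0" "b \<le> 0" | "0 \<le> a" "b \<le> 0" | "a \<le> 0" "0 \<le> b" by linarith
  then show ?thesis
  proof cases
    case 2
    have "a * \<bar>a\<bar> - b * \<bar>b\<bar> = b * b - a * a" using 2 by simp
    then show ?thesis using same[of "-b" "-a"] 2 by simp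
  next
    case 3
    then have "a * \<bar>a\<bar> - b * \<bar>b\<bar> = a * a + b * b" by simp
    then show ?thesis using opp[of a "-b"] by simp
  next
    case 4
    then have "a * \<bar>a\<bar> - b * \<bar>b\<bar> = - (a * a + b * b)" by simp
    then show ?thesis using opp[of a "-b"] by simp
  qed (use same[of a b] in simp)
qed

lemma L2_shift_continuous:
  assumes f: "square_integrable f" and X: "X \<longlonglongrightarrow> 0"
  shows "(\<lambda>n. LINT t|lborel. (cmod (f (t - X n) - f t))\<^sup>2) \<longlonglongrightarrow> 0"
proof -
  have [measurable]: "f \<in> borel_measurable borel"
    using square_integrable_measurable[OF f] by simp
  \<comment> \<open>\<open>square_diff_le\<close> concerns real numbers, so real and imaginary parts
    are treated separately; both \<open>h\<close> and \<open>k\<close> are dominated by the squared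
    modulus of \<open>f\<close>.\<close>
  define h k where "h t = Re (f t) * \<bar>Re (f t)\<bar>" and "k t = Im (f t) * \<bar>Im (f t)\<bar>" for t
  have [measurable]: "h \<in> borel_measurable borel" "k \<in> borel_measurable borel"
    unfolding h_def k_def by measurable
  have f2: "integrable lborel (\<lambda>x. (norm (f x))\<^sup>2)" using f by (simp add: square_integrable_def)
  have h: "integrable lborel h"
    by (rule Bochner_Integration.integrable_bound[OF f2])
       (auto simp: h_def abs_mult power2_eq_square simp del: abs_mult_self_eq
         intro!: mult_mono abs_Re_le_cmod)
  have k: "integrable lborel k"
    by (rule Bochner_Integration.integrable_bound[OF f2])
       (auto simp: k_def abs_mult power2_eq_square simp del: abs_mult_self_eq
         intro!: mult_mono abs_Im_le_cmod)
  have hx: "integrable lborel (\<lambda>t. h (t - x))" and kx: "integrable lborel (\<lambda>t. k (t - x))" for x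
    using h k by (simp_all add: integrable_translate)
  let ?l = "\<lambda>n. LINT t|lborel. (cmod (f (t - X n) - f t))\<^sup>2"
  let ?r = "\<lambda>n. 2 * (LINT t|lborel. norm (h (t - X n) - h t)) + 2 * (LINT t|lborel. norm (k (t - X n) - k t))"
  have "?r
      \<longlonglongrightarrow> 2 * 0 + 2 * 0"
    using integrable_L1_shift_continuous[OF h] integrable_L1_shift_continuous[OF k] X
    unfolding L1_shift_continuous_def by (intro tendsto_intros) auto
  then have lim: "?r
      \<longlonglongrightarrow> 0" by simp
  show ?thesis
  proof (rule tendsto_sandwich[OF _ _ tendsto_const lim])
    show "\<forall>\<^sub>F n in sequentially. ?l n \<le> ?r n"
    proof (rule always_eventually, rule allI)
      fix n
      have "?l n
          \<le> (LINT t|lborel. 2 * norm (h (t - X n) - h t) + 2 * norm (k (t - X n) - k t))"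
      proof (rule integral_mono)
        show "integrable lborel (\<lambda>t. (cmod (f (t - X n) - f t))\<^sup>2)"
          using square_integrable_diff[OF square_integrable_translate[OF f] f]
          by (simp add: square_integrable_def)
        fix t
        show "(cmod (f (t - X n) - f t))\<^sup>2 \<le> 2 * norm (h (t - X n) - h t) + 2 * norm (k (t - X n) - k t)"
          using square_diff_le[of "Re (f (t - X n))" "Re (f t)"]
            square_diff_le[of "Im (f (t - X n))" "Im (f t)"]
          by (simp add: cmod_power2 h_def k_def)
      qed (use h k hx kx in auto)
      also have "\<dots> = ?r n"
        using h k hx kx by (subst Bochner_Integration.integral_add) auto
      finally show "?l n \<le> ?r n" .
    qed
  qed (auto intro!: always_eventually)
qed

section \<open>Time-frequency shifts and convolutions\<close>

definition character :: "'a::euclidean_space \<Rightarrow> 'a \<Rightarrow> complex" where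
  "character \<omega> t = exp (2 * complex_of_real pi * \<i> * complex_of_real (\<omega> \<bullet> t))"

lemma cmod_character [simp]: "cmod (character \<omega> t) = 1"
  by (simp add: character_def)

lemma character_add: "character \<omega> (s + t) = character \<omega> s * character \<omega> t"
  "character (\<omega> + \<nu>) t = character \<omega> t * character \<nu> t"
  by (simp_all add: character_def inner_add_right inner_add_left distrib_left exp_add)

lemma character_diff: "character \<omega> (s - t) = character \<omega> s * character \<omega> (- t)"
  using character_add(1)[of \<omega> s "- t"] by simp

lemma character_zero [simp]: "character 0 t = 1" "character \<omega> 0 = 1"
  by (simp_all add: character_def)

lemma character_measurable [measurable]: "character \<omega> \<in> borel_measurable borel"
  unfolding character_def by (intro borel_measurable_continuous_onI continuous_intros)

lemma square_integrable_tf: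
  assumes f: "square_integrable f"
  shows "square_integrable (\<lambda>t. character \<omega> t * f (t - x))"
proof -
  note [measurable] = square_integrable_measurable[OF f]
  show ?thesis
    using square_integrable_translate[OF f, of x]
    by (auto simp: square_integrable_def norm_mult)
qed

lemma tf_shift_L2_of:
  assumes "square_integrable f"
  shows "tf_shift (x, \<omega>) (L2_of f) = L2_of (\<lambda>t. character \<omega> t * f (t - x))"
  using assms by (simp add: L2_of_def tf_shift.abs_eq L2_rel_refl character_def)

lemma tf_shift_add: "tf_shift z (\<phi> + \<psi>) = tf_shift z \<phi> + tf_shift z \<psi>"
proof -
  obtain x \<omega> where z: "z = (x, \<omega>)" by (cases z)
  obtain f where f: "square_integrable f" "\<phi> = L2_of f" by (rule L2_cases)
  obtain g where g: "square_integrable g" "\<psi> = L2_of g" by (rule L2_cases)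
  show ?thesis
    using f g square_integrable_tf[OF f(1)] square_integrable_tf[OF g(1)]
    by (simp add: z tf_shift_L2_of L2_of_add square_integrable_add distrib_left)
qed

lemma tf_shift_scaleC: "tf_shift z (c *\<^sub>C \<phi>) = c *\<^sub>C tf_shift z \<phi>"
proof -
  obtain x \<omega> where z: "z = (x, \<omega>)" by (cases z)
  obtain f where f: "square_integrable f" "\<phi> = L2_of f" by (rule L2_cases)
  show ?thesis
    using f square_integrable_tf[OF f(1)]
    by (simp add: z tf_shift_L2_of L2_of_scaleC square_integrable_mult mult.left_commute)
qed

lemma cinner_tf_shift: "cinner (tf_shift z \<phi>) (tf_shift z \<psi>) = cinner \<phi> \<psi>"
proof -
  obtain x \<omega> where z: "z = (x, \<omega>)" by (cases z)
  obtain f where f: "square_integrable f" "\<phi> = L2_of f" by (rule L2_cases)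
  obtain g where g: "square_integrable g" "\<psi> = L2_of g" by (rule L2_cases)
  have [measurable]: "f \<in> borel_measurable borel" "g \<in> borel_measurable borel"
    using square_integrable_measurable[OF f(1)] square_integrable_measurable[OF g(1)] by simp_all
  have [measurable]: "(\<lambda>t. cnj (g t)) \<in> borel_measurable borel"
    by (rule measurable_compose[of g _ borel]) (auto intro!: borel_measurable_continuous_onI continuous_intros)
  have "character \<omega> t * cnj (character \<omega> t) = 1" for t
    by (simp add: complex_norm_square[symmetric])
  then have "character \<omega> t * f (t - x) * cnj (character \<omega> t * g (t - x)) = f (t - x) * cnj (g (t - x))" for t
    by (simp add: algebra_simps)
  then have "cinner (tf_shift z \<phi>) (tf_shift z \<psi>) = (LINT t|lborel. f (t - x) * cnj (g (t - x)))"
    by (simp only: z f g tf_shift_L2_of cinner_L2_of square_integrable_tf)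
  also have "\<dots> = (LINT t|lborel. f t * cnj (g t))"
    by (rule integral_translate) measurable
  finally show ?thesis by (simp add: f g cinner_L2_of)
qed

lemma norm_tf_shift [simp]: "norm (tf_shift z \<phi>) = norm \<phi>"
proof -
  have "complex_of_real ((norm (tf_shift z \<phi>))\<^sup>2) = complex_of_real ((norm \<phi>)\<^sup>2)"
    by (simp only: cinner_self[symmetric] cinner_tf_shift)
  then show ?thesis by (simp only: of_real_eq_iff) simp
qed

lemma tf_shift_zero: "tf_shift 0 \<phi> = \<phi>"
proof -
  obtain f where f: "square_integrable f" "\<phi> = L2_of f" by (rule L2_cases)
  show ?thesis by (simp add: zero_prod_def f tf_shift_L2_of)
qed

text \<open>The shifts form only a projective representation: moving the modulation by
  \<open>snd w\<close> through the translation by \<open>fst z\<close> leaves a unimodular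
  factor.\<close>

lemma tf_shift_tf_shift:
  "tf_shift z (tf_shift w \<phi>) = character (snd w) (- fst z) *\<^sub>C tf_shift (z + w) \<phi>"
proof -
  obtain x \<omega> where z: "z = (x, \<omega>)" by (cases z)
  obtain y \<nu> where w: "w = (y, \<nu>)" by (cases w)
  obtain f where f: "square_integrable f" "\<phi> = L2_of f" by (rule L2_cases)
  have "(\<lambda>t. character \<omega> t * (character \<nu> (t - x) * f (t - x - y))) =
      (\<lambda>t. character \<nu> (- x) * (character (\<omega> + \<nu>) t * f (t - (x + y))))"
    by (rule ext) (simp add: character_add character_diff diff_diff_eq)
  then show ?thesis
    by (simp add: z w f tf_shift_L2_of square_integrable_tf L2_of_scaleC)
qed

lemma bounded_clinear_tf_shift: "bounded_clinear (tf_shift z)"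
  by (rule bounded_clinearI[of _ 1]) (simp_all add: tf_shift_add tf_shift_scaleC)

lemma tf_shift_surj: "\<exists>\<phi>. tf_shift z \<phi> = \<psi>"
proof
  let ?c = "character (snd (- z)) (- fst z)"
  have c: "?c \<noteq> 0" using cmod_character[of "snd (- z)" "- fst z"] by (metis norm_zero zero_neq_one)
  then show "tf_shift z ((1 / ?c) *\<^sub>C tf_shift (- z) \<psi>) = \<psi>"
    by (simp add: tf_shift_scaleC tf_shift_tf_shift tf_shift_zero)
qed

lemma cadjoint_eqI:
  assumes "\<And>\<phi> \<psi>. cinner (A \<phi>) \<psi> = cinner \<phi> (B \<psi>)" shows "cadjoint A = B"
  unfolding cadjoint_def
proof (rule the_equality)
  fix B' assume B': "\<forall>\<phi> \<psi>. cinner (A \<phi>) \<psi> = cinner \<phi> (B' \<psi>)"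
  show "B' = B"
  proof (rule ext, rule cinner_eqI)
    fix \<psi> \<phi>
    have "cinner \<phi> (B' \<psi>) = cinner \<phi> (B \<psi>)" using B' assms by metis
    then show "cinner (B' \<psi>) \<phi> = cinner (B \<psi>) \<phi>"
      by (metis cinner_commute)
  qed
qed (use assms in blast)

text \<open>A surjective isometry is unitary: any right inverse \<open>B\<close> satisfies the
  adjoint relation. This evaluates the definite description in \<open>cadjoint\<close> without a
  formula for the inverse and its phase.\<close>

lemma tf_adjoint:
  shows tf_shift_cadjoint: "tf_shift z (cadjoint (tf_shift z) \<psi>) = \<psi>"
    and cinner_tf_shift_left: "cinner (tf_shift z \<phi>) \<psi> = cinner \<phi> (cadjoint (tf_shift z) \<psi>)"
proof -
  have "\<forall>\<psi>. \<exists>\<phi>. tf_shift z \<phi> = \<psi>" using tf_shift_surj by blast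
  then obtain B where B: "\<And>\<psi>. tf_shift z (B \<psi>) = \<psi>" using choice[of "\<lambda>\<psi> \<phi>. tf_shift z \<phi> = \<psi>"] by blast
  have cB: "cinner (tf_shift z \<phi>) \<psi> = cinner \<phi> (B \<psi>)" for \<phi> \<psi>
    using cinner_tf_shift[of z \<phi> "B \<psi>"] by (simp add: B)
  then have "cadjoint (tf_shift z) = B" by (rule cadjoint_eqI)
  then show "tf_shift z (cadjoint (tf_shift z) \<psi>) = \<psi>"
    "cinner (tf_shift z \<phi>) \<psi> = cinner \<phi> (cadjoint (tf_shift z) \<psi>)"
    by (simp_all add: B cB)
qed

abbreviation tf_adj :: "'a::euclidean_space \<times> 'a \<Rightarrow> 'a L2 \<Rightarrow> 'a L2" where
  "tf_adj z \<equiv> cadjoint (tf_shift z)"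

lemma tf_shift_inj: "tf_shift z \<phi> = tf_shift z \<psi> \<Longrightarrow> \<phi> = \<psi>"
  using bounded_clinearD(4)[OF bounded_clinear_tf_shift, of z \<phi> \<psi>] norm_tf_shift[of z "\<phi> - \<psi>"]
  by simp

lemma cinner_tf_adj: "cinner (tf_adj z \<phi>) (tf_adj z \<psi>) = cinner \<phi> \<psi>"
  using cinner_tf_shift[of z "tf_adj z \<phi>" "tf_adj z \<psi>"] by (simp add: tf_shift_cadjoint)

lemma norm_tf_adj [simp]: "norm (tf_adj z \<phi>) = norm \<phi>"
  using norm_tf_shift[of z "tf_adj z \<phi>"] by (simp add: tf_shift_cadjoint)

lemma bounded_clinear_tf_adj: "bounded_clinear (tf_adj z)"
  by (rule bounded_clinearI[of _ 1]; (rule tf_shift_inj[of z])?)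
     (simp_all add: tf_shift_cadjoint tf_shift_add tf_shift_scaleC)

lemma orthonormal_tf_adj: "orthonormal e \<Longrightarrow> orthonormal (\<lambda>n. tf_adj z (e n))"
  by (simp add: orthonormal_def cinner_tf_adj)

lemma tf_adj_zero: "tf_adj 0 \<phi> = \<phi>"
  using tf_shift_cadjoint[of 0 \<phi>] by (simp add: tf_shift_zero)

lemma tf_adj_add: "\<exists>c. cmod c = 1 \<and> (\<forall>\<phi>. tf_adj w (tf_adj z \<phi>) = c *\<^sub>C tf_adj (z + w) \<phi>)"
proof -
  let ?c = "character (snd w) (- fst z)"
  have c: "?c \<noteq> 0" using cmod_character[of "snd w" "- fst z"] by (metis norm_zero zero_neq_one)
  have "tf_adj w (tf_adj z \<phi>) = (1 / ?c) *\<^sub>C tf_adj (z + w) \<phi>" for \<phi>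
  proof (rule tf_shift_inj[of w], rule tf_shift_inj[of z])
    have "tf_shift z (tf_shift w ((1 / ?c) *\<^sub>C tf_adj (z + w) \<phi>)) = \<phi>"
      using c by (simp add: tf_shift_scaleC tf_shift_tf_shift tf_shift_cadjoint)
    then show "tf_shift z (tf_shift w (tf_adj w (tf_adj z \<phi>))) = tf_shift z (tf_shift w ((1 / ?c) *\<^sub>C tf_adj (z + w) \<phi>))"
      by (simp add: tf_shift_cadjoint)
  qed
  moreover have "cmod (1 / ?c) = 1" by (simp add: norm_divide)
  ultimately show ?thesis by blast
qed

lemma tendsto_modulation:
  assumes f: "square_integrable f" and X: "X \<longlonglongrightarrow> \<omega>"
  shows "(\<lambda>n. LINT t|lborel. (cmod (character (X n) t * f t - character \<omega> t * f t))\<^sup>2) \<longlonglongrightarrow> 0"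
proof -
  let ?d = "\<lambda>n t. (cmod (character (X n) t * f t - character \<omega> t * f t))\<^sup>2"
  note [measurable] = square_integrable_measurable[OF f]
  have "(\<lambda>n. LINT t|lborel. ?d n t)
      \<longlonglongrightarrow> (LINT t|(lborel::'a measure). (0::real))"
  proof (rule integral_dominated_convergence[where w="\<lambda>t. 4 * (cmod (f t))\<^sup>2"])
    show "AE t in lborel. (\<lambda>n. ?d n t) \<longlonglongrightarrow> 0"
    proof (rule AE_I2)
      fix t
      have "(\<lambda>n. ?d n t)
          \<longlonglongrightarrow> (cmod (character \<omega> t * f t - character \<omega> t * f t))\<^sup>2"
        unfolding character_def by (intro tendsto_intros X)
      then show "(\<lambda>n. ?d n t) \<longlonglongrightarrow> 0" by simp
    qed
    show "AE t in lborel. norm (?d n t) \<le> 4 * (cmod (f t))\<^sup>2" for n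
    proof (rule AE_I2)
      fix t
      have "cmod (character (X n) t * f t - character \<omega> t * f t) \<le> cmod (f t) + cmod (f t)"
        by (rule order_trans[OF norm_triangle_ineq4]) (simp add: norm_mult)
      then have "?d n t \<le> (2 * cmod (f t))\<^sup>2"
        by (intro power_mono) auto
      then show "norm (?d n t) \<le> 4 * (cmod (f t))\<^sup>2"
        by simp
    qed
    show "integrable lborel (\<lambda>t. 4 * (cmod (f t))\<^sup>2)" using f by (simp add: square_integrable_def)
  qed measurable
  then show ?thesis by simp
qed

lemma L2_of_tendsto:
  assumes "\<And>n. square_integrable (f n)" "square_integrable g"
    "(\<lambda>n. LINT t|lborel. (cmod (f n t - g t))\<^sup>2) \<longlonglongrightarrow> 0"
  shows "(\<lambda>n. L2_of (f n)) \<longlonglongrightarrow> L2_of g"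
proof -
  have "(\<lambda>n. (norm (L2_of (f n) - L2_of g))\<^sup>2) \<longlonglongrightarrow> 0"
    using assms by (simp add: L2_of_diff norm_L2_of_sq square_integrable_diff)
  then have "(\<lambda>n. norm (L2_of (f n) - L2_of g)) \<longlonglongrightarrow> 0" by (simp add: power_tendsto_0_iff)
  then show ?thesis by (rule LIM_zero_cancel[OF tendsto_norm_zero_cancel])
qed

text \<open>A shift is a translation followed by a modulation. The error of the translation passes
  through the modulation isometrically, so continuity of modulations is needed only at the fixed
  vector \<open>\<phi>'\<close>.\<close>

lemma tf_shift_strongly_continuous:
  assumes X: "X \<longlonglongrightarrow> z"
  shows "(\<lambda>n. tf_shift (X n) \<phi>) \<longlonglongrightarrow> tf_shift z \<phi>"
proof -
  obtain f where f: "square_integrable f" "\<phi> = L2_of f" by (rule L2_cases)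
  obtain x \<omega> where z: "z = (x, \<omega>)" by (cases z)
  define Y W where "Y n = fst (X n)" and "W n = snd (X n)" for n
  have X_eq: "X n = (Y n, W n)" for n by (simp add: Y_def W_def)
  have Y: "Y \<longlonglongrightarrow> x" and W: "W \<longlonglongrightarrow> \<omega>"
    using tendsto_fst[OF X] tendsto_snd[OF X] by (simp_all add: z Y_def[abs_def] W_def[abs_def])
  have fx: "square_integrable (\<lambda>t. f (t - x))" for x by (rule square_integrable_translate[OF f(1)])
  define \<phi>' where "\<phi>' = L2_of (\<lambda>t. f (t - x))"
  have tr: "(\<lambda>n. L2_of (\<lambda>t. f (t - Y n))) \<longlonglongrightarrow> \<phi>'"
    unfolding \<phi>'_def
  proof (rule L2_of_tendsto[OF fx fx])
    have 0: "(\<lambda>n. Y n - x) \<longlonglongrightarrow> 0" using Y by (rule LIM_zero)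
    have "(\<lambda>n. LINT t|lborel. (cmod (f (t - (Y n - x) - x) - f (t - x)))\<^sup>2) \<longlonglongrightarrow> 0"
      using L2_shift_continuous[OF fx 0] .
    then show "(\<lambda>n. LINT t|lborel. (cmod (f (t - Y n) - f (t - x)))\<^sup>2) \<longlonglongrightarrow> 0"
      by simp
  qed
  have modu: "(\<lambda>n. tf_shift (0, W n) \<phi>') \<longlonglongrightarrow> tf_shift (0, \<omega>) \<phi>'"
    unfolding \<phi>'_def tf_shift_L2_of[OF fx] diff_zero
    by (rule L2_of_tendsto)
       (use square_integrable_tf[OF fx, of _ 0] tendsto_modulation[OF fx W] in auto)
  have split: "tf_shift (y, \<nu>) \<phi> = tf_shift (0, \<nu>) (L2_of (\<lambda>t. f (t - y)))" for y \<nu>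
    by (simp add: f tf_shift_L2_of fx)
  have "(\<lambda>n. norm (tf_shift (0, W n) (L2_of (\<lambda>t. f (t - Y n)) - \<phi>'))) \<longlonglongrightarrow> 0"
    using LIM_zero[OF tr] by (simp add: tendsto_norm_zero)
  then have "(\<lambda>n. tf_shift (0, W n) (L2_of (\<lambda>t. f (t - Y n)) - \<phi>')) \<longlonglongrightarrow> 0"
    by (rule tendsto_norm_zero_cancel)
  from tendsto_add[OF this modu]
  show ?thesis
    by (simp add: X_eq z split bounded_clinearD[OF bounded_clinear_tf_shift] \<phi>'_def[symmetric])
qed

text \<open>Strong continuity is not inherited by adjoints in general, but here the shifts are
  unitary: applying \<open>tf_shift (X n)\<close> to the difference reduces it to the shifts at the
  fixed vector \<open>tf_adj z \<phi>\<close>.\<close>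

lemma tf_adj_strongly_continuous:
  assumes X: "X \<longlonglongrightarrow> z"
  shows "(\<lambda>n. tf_adj (X n) \<phi>) \<longlonglongrightarrow> tf_adj z \<phi>"
proof -
  have "norm (tf_adj (X n) \<phi> - tf_adj z \<phi>) = norm (tf_shift (X n) (tf_adj z \<phi>) - tf_shift z (tf_adj z \<phi>))" for n
  proof -
    have "norm (tf_adj (X n) \<phi> - tf_adj z \<phi>) = norm (tf_shift (X n) (tf_adj (X n) \<phi> - tf_adj z \<phi>))"
      by simp
    also have "\<dots> = norm (\<phi> - tf_shift (X n) (tf_adj z \<phi>))"
      by (simp only: bounded_clinearD(4)[OF bounded_clinear_tf_shift] tf_shift_cadjoint)
    finally show ?thesis
      using norm_minus_commute[of \<phi> "tf_shift (X n) (tf_adj z \<phi>)"] by (simp only: tf_shift_cadjoint)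
  qed
  moreover have "(\<lambda>n. norm (tf_shift (X n) (tf_adj z \<phi>) - tf_shift z (tf_adj z \<phi>))) \<longlonglongrightarrow> 0"
    using LIM_zero[OF tf_shift_strongly_continuous[OF X]] by (rule tendsto_norm_zero)
  ultimately have "(\<lambda>n. norm (tf_adj (X n) \<phi> - tf_adj z \<phi>)) \<longlonglongrightarrow> 0"
    by (simp only:)
  then show ?thesis by (rule LIM_zero_cancel[OF tendsto_norm_zero_cancel])
qed

lemma continuous_on_tf_adj [continuous_intros]: "continuous_on S (\<lambda>z. tf_adj z \<phi>)"
  by (rule continuous_on_subset[OF _ subset_UNIV])
     (auto simp: continuous_on_sequentially o_def intro: tf_adj_strongly_continuous)

section \<open>Coefficient functions of operators and convolution with an operator\<close>

definition tf_coeff ::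
    "('a::euclidean_space L2 \<Rightarrow> 'a L2) \<Rightarrow> 'a L2 \<Rightarrow> 'a L2 \<Rightarrow> 'a \<times> 'a \<Rightarrow> complex" where
  "tf_coeff A \<psi> \<phi> z = cinner (A (tf_adj z \<psi>)) (tf_adj z \<phi>)"

lemma cinner_op_translate: "cinner (op_translate z A \<psi>) \<phi> = tf_coeff A \<psi> \<phi> z"
  by (simp add: op_translate_def tf_coeff_def cinner_tf_shift_left)

text \<open>The phase of composed shifts enters once linearly and once conjugated, and
  \<open>c * cnj c = 1\<close>. So conjugation by shifts is a genuine action of the additive group,
  which makes operator convolution associative.\<close>

lemma tf_coeff_translate:
  assumes "bounded_clinear A"
  shows "tf_coeff A (tf_adj z \<psi>) (tf_adj z \<phi>) w = tf_coeff A \<psi> \<phi> (z + w)"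
proof -
  obtain c where c: "cmod c = 1" "\<And>\<phi>. tf_adj w (tf_adj z \<phi>) = c *\<^sub>C tf_adj (z + w) \<phi>"
    using tf_adj_add by blast
  have "c * cnj c = 1" using c(1) by (simp add: complex_norm_square[symmetric])
  then show ?thesis
    by (simp add: tf_coeff_def c bounded_clinearD(2)[OF assms]) (metis mult.assoc mult.commute mult_1)
qed

lemma continuous_tf_coeff:
  assumes "bounded_clinear A"
  shows "continuous_on S (tf_coeff A \<psi> \<phi>)"
  unfolding tf_coeff_def
  by (intro cinner.continuous_on bounded_linear.continuous_on[OF bounded_clinearD(1)[OF assms]] continuous_on_tf_adj)

lemma tf_coeff_measurable:
  "bounded_clinear A \<Longrightarrow> tf_coeff A \<psi> \<phi> \<in> borel_measurable borel"
  by (rule borel_measurable_continuous_onI[OF continuous_tf_coeff])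

lemma cmod_tf_coeff_le:
  assumes "\<And>x. norm (A x) \<le> K * norm x"
  shows "cmod (tf_coeff A \<psi> \<phi> z) \<le> K * norm \<psi> * norm \<phi>"
proof -
  have "cmod (tf_coeff A \<psi> \<phi> z) \<le> norm (A (tf_adj z \<psi>)) * norm (tf_adj z \<phi>)"
    unfolding tf_coeff_def by (rule norm_cinner_le)
  also have "\<dots> \<le> (K * norm (tf_adj z \<psi>)) * norm (tf_adj z \<phi>)"
    by (intro mult_right_mono assms) simp
  finally show ?thesis by simp
qed

lemma integrable_mult_bounded:
  fixes f F :: "'b::euclidean_space \<Rightarrow> complex"
  assumes f: "integrable lborel f" and [measurable]: "F \<in> borel_measurable borel" and b: "\<And>z. cmod (F z) \<le> B"
  shows "integrable lborel (\<lambda>z. f z * F z)" "cmod (LINT z|lborel. f z * F z) \<le> (LINT z|lborel. cmod (f z)) * B"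
proof -
  note [measurable] = borel_measurable_integrable[OF f]
  have fB: "integrable lborel (\<lambda>z. cmod (f z) * B)" using f by simp
  have le: "cmod (f z * F z) \<le> cmod (f z) * B" for z
    by (simp add: norm_mult mult_left_mono b)
  show i: "integrable lborel (\<lambda>z. f z * F z)"
    by (rule Bochner_Integration.integrable_bound[OF fB])
       (auto intro!: order_trans[OF le] simp: )
  have "cmod (LINT z|lborel. f z * F z) \<le> (LINT z|lborel. cmod (f z * F z))"
    by (rule integral_norm_bound)
  also have "\<dots> \<le> (LINT z|lborel. cmod (f z) * B)"
    by (rule integral_mono) (use i fB le in auto)
  finally show "cmod (LINT z|lborel. f z * F z) \<le> (LINT z|lborel. cmod (f z)) * B" by simp
qed

lemma integrable_tf_coeff:
  assumes "bounded_clinear A" "integrable lborel f"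
  shows "integrable lborel (\<lambda>z. f z * tf_coeff A \<psi> \<phi> z)"
proof -
  obtain K where K: "0 \<le> K" "\<And>x. norm (A x) \<le> K * norm x"
    using bounded_clinear_bound[OF assms(1)] by blast
  show ?thesis
    by (rule integrable_mult_bounded(1)[OF assms(2) tf_coeff_measurable[OF assms(1)] cmod_tf_coeff_le[OF K(2)]])
qed

text \<open>The integral is a bounded conjugate linear functional of \<open>\<phi>\<close>, so Riesz
  supplies the vector described by \<open>weak_integral\<close>. From here on
  \<open>f \<star> A\<close> is handled through these scalar integrals.\<close>

lemma cinner_op_convolution:
  assumes A: "bounded_clinear A" and f: "integrable lborel f"
  shows "cinner ((f \<star> A) \<psi>) \<phi> = (LINT z|lborel. f z * tf_coeff A \<psi> \<phi> z)"
proof -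
  obtain K where K: "0 \<le> K" "\<And>x. norm (A x) \<le> K * norm x"
    using bounded_clinear_bound[OF A] by blast
  define l where "l \<phi> = (LINT z|lborel. f z * tf_coeff A \<psi> \<phi> z)" for \<phi>
  note int = integrable_tf_coeff[OF A f]
  have "\<exists>v. \<forall>\<phi>. l \<phi> = cinner v \<phi>"
  proof (rule complex_Riesz)
    show "l (x + y) = l x + l y" for x y
      using int[of \<psi> x] int[of \<psi> y]
      by (simp add: l_def tf_coeff_def bounded_clinearD[OF bounded_clinear_tf_adj] cinner_add_right distrib_left)
    show "l (c *\<^sub>C x) = cnj c * l x" for c x
      by (simp add: l_def tf_coeff_def bounded_clinearD(2)[OF bounded_clinear_tf_adj] mult.left_commute)
    show "cmod (l x) \<le> ((LINT z|lborel. cmod (f z)) * (K * norm \<psi>)) * norm x" for x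
      using integrable_mult_bounded(2)[OF f tf_coeff_measurable[OF A] cmod_tf_coeff_le[OF K(2)]]
      by (simp add: l_def mult.assoc)
  qed
  then obtain v where v: "\<And>\<phi>. l \<phi> = cinner v \<phi>" by blast
  have eq: "cinner (f z *\<^sub>C op_translate z A \<psi>) \<phi> = f z * tf_coeff A \<psi> \<phi> z" for z \<phi>
    by (simp add: cinner_op_translate)
  have "(f \<star> A) \<psi> = v"
    unfolding op_convolution_def weak_integral_def eq
  proof (rule the_equality)
    show "\<forall>\<phi>. has_bochner_integral lborel (\<lambda>z. f z * tf_coeff A \<psi> \<phi> z) (cinner v \<phi>)"
      using int by (simp add: has_bochner_integral_iff v[symmetric] l_def)
    fix v' assume "\<forall>\<phi>. has_bochner_integral lborel (\<lambda>z. f z * tf_coeff A \<psi> \<phi> z) (cinner v' \<phi>)"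
    then show "v' = v"
      by (intro cinner_eqI) (simp add: has_bochner_integral_iff v[symmetric] l_def)
  qed
  then show ?thesis using v by (simp add: l_def)
qed

lemma norm_op_convolution_le:
  assumes A: "bounded_clinear A" and f: "integrable lborel f" and K: "0 \<le> K" "\<And>x. norm (A x) \<le> K * norm x"
  shows "norm ((f \<star> A) \<psi>) \<le> (LINT z|lborel. cmod (f z)) * K * norm \<psi>"
proof (rule norm_le_cinner)
  show "cmod (cinner ((f \<star> A) \<psi>) \<phi>) \<le> (LINT z|lborel. cmod (f z)) * K * norm \<psi> * norm \<phi>" for \<phi>
    using integrable_mult_bounded(2)[OF f tf_coeff_measurable[OF A] cmod_tf_coeff_le[OF K(2)]]
    by (simp add: cinner_op_convolution[OF A f] mult.assoc)
qed (use K in simp)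

lemma bounded_clinear_conv:
  assumes A: "bounded_clinear A" and f: "integrable lborel f"
  shows "bounded_clinear (f \<star> A)"
proof -
  obtain K where K: "0 \<le> K" "\<And>x. norm (A x) \<le> K * norm x"
    using bounded_clinear_bound[OF A] by blast
  note int = integrable_tf_coeff[OF A f]
  show ?thesis
  proof (rule bounded_clinearI)
    show "(f \<star> A) (x + y) = (f \<star> A) x + (f \<star> A) y" for x y
      using int[of x] int[of y]
      by (intro cinner_eqI) (simp add: cinner_op_convolution[OF A f] cinner_add_left tf_coeff_def
          bounded_clinearD[OF bounded_clinear_tf_adj] bounded_clinearD[OF A] distrib_left)
    show "(f \<star> A) (c *\<^sub>C x) = c *\<^sub>C (f \<star> A) x" for c x
      by (intro cinner_eqI) (simp add: cinner_op_convolution[OF A f] tf_coeff_def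
          bounded_clinearD[OF bounded_clinear_tf_adj] bounded_clinearD[OF A] mult.left_commute)
    show "norm ((f \<star> A) x) \<le> ((LINT z|lborel. cmod (f z)) * K) * norm x" for x
      using norm_op_convolution_le[OF A f K] by simp
  qed
qed

section \<open>Convolution of integrable functions\<close>

definition L1_convolution :: "('b::euclidean_space \<Rightarrow> complex) \<Rightarrow> ('b \<Rightarrow> complex) \<Rightarrow> 'b \<Rightarrow> complex" where
  "L1_convolution k f z = (LINT w|lborel. k w * f (z - w))"

lemma integrable_lborel_pair:
  fixes G :: "'b::euclidean_space \<times> 'b \<Rightarrow> complex"
  assumes "G \<in> borel_measurable (borel \<Otimes>\<^sub>M borel)"
    and a: "\<And>x. integrable lborel (\<lambda>y. G (x, y))"
    and b: "integrable lborel (\<lambda>x. LINT y|lborel. cmod (G (x, y)))"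
  shows "integrable (lborel \<Otimes>\<^sub>M lborel) G"
  using assms by (intro lborel_pair.Fubini_integrable) (auto simp: lborel_prod borel_prod)

context
  fixes k f :: "'b::euclidean_space \<Rightarrow> complex"
  assumes k: "integrable lborel k" and f: "integrable lborel f"
begin

private lemma meas [measurable]: "k \<in> borel_measurable borel" "f \<in> borel_measurable borel"
  using borel_measurable_integrable[OF k] borel_measurable_integrable[OF f] by simp_all

text \<open>The bounded factor \<open>F\<close> is carried along because convolutions get tested
  against coefficient functions, which are bounded but need not be integrable; \<open>F = 1\<close>
  gives the bare kernel.\<close>

lemma integrable_convolution_kernel:
  assumes [measurable]: "F \<in> borel_measurable borel" and F: "\<And>z. cmod (F z) \<le> B"
  shows "integrable (lborel \<Otimes>\<^sub>M lborel) (\<lambda>(w, z). k w * f (z - w) * F z)"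
proof (rule integrable_lborel_pair)
  have fw: "integrable lborel (\<lambda>z. f (z - w))" for w using f by (simp add: integrable_translate)
  have int: "integrable lborel (\<lambda>z. f (z - w) * F z)" for w
    by (rule integrable_mult_bounded(1)[OF fw assms(1) F])
  show "integrable lborel (\<lambda>z. case (w, z) of (w, z) \<Rightarrow> k w * f (z - w) * F z)" for w
    using int[of w] by (simp add: mult.assoc)
  have le: "(LINT z|lborel. cmod (f (z - w) * F z)) \<le> (LINT z|lborel. cmod (f z)) * B" for w
  proof -
    have "(LINT z|lborel. cmod (f (z - w) * F z)) \<le> (LINT z|lborel. cmod (f (z - w)) * B)"
      by (rule integral_mono)
         (use integrable_norm[OF int[of w]] fw F in \<open>auto simp: norm_mult mult_left_mono\<close>)
    also have "\<dots> = (LINT z|lborel. cmod (f (z - w))) * B" by simp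
    also have "(LINT z|lborel. cmod (f (z - w))) = (LINT z|lborel. cmod (f z))"
      by (rule integral_translate) measurable
    finally show ?thesis .
  qed
  have kB: "integrable lborel (\<lambda>w. cmod (k w) * ((LINT z|lborel. cmod (f z)) * B))"
    using k by simp
  show "integrable lborel (\<lambda>w. LINT z|lborel. cmod (case (w, z) of (w, z) \<Rightarrow> k w * f (z - w) * F z))"
  proof (rule Bochner_Integration.integrable_bound[OF kB])
    show "AE w in lborel. norm (LINT z|lborel. cmod (case (w, z) of (w, z) \<Rightarrow> k w * f (z - w) * F z))
        \<le> norm (cmod (k w) * ((LINT z|lborel. cmod (f z)) * B))"
    proof (rule AE_I2)
      fix w
      have "(LINT z|lborel. cmod (k w * f (z - w) * F z)) = cmod (k w) * (LINT z|lborel. cmod (f (z - w) * F z))"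
        by (simp add: norm_mult mult.assoc)
      also have "\<dots> \<le> cmod (k w) * ((LINT z|lborel. cmod (f z)) * B)"
        by (rule mult_left_mono[OF le]) simp
      finally show "norm (LINT z|lborel. cmod (case (w, z) of (w, z) \<Rightarrow> k w * f (z - w) * F z))
        \<le> norm (cmod (k w) * ((LINT z|lborel. cmod (f z)) * B))"
        by (simp add: abs_of_nonneg)
    qed
  qed measurable
qed measurable

lemma integrable_L1_convolution: "integrable lborel (L1_convolution k f)"
proof -
  have "integrable (lborel \<Otimes>\<^sub>M lborel) (\<lambda>(w, z). k w * f (z - w))"
    using integrable_convolution_kernel[of "\<lambda>_. 1" 1] by simp
  then show ?thesis
    unfolding L1_convolution_def by (rule lborel_pair.integrable_snd)
qed

text \<open>Associativity of convolution in tested form: Fubini, the substitution of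
  \<open>z + w\<close> for \<open>z\<close> at fixed \<open>w\<close>, and Fubini again.\<close>

lemma integral_L1_convolution:
  assumes [measurable]: "F \<in> borel_measurable borel" and F: "\<And>z. cmod (F z) \<le> B"
  shows "(LINT z|lborel. L1_convolution k f z * F z) = (LINT z|lborel. f z * (LINT w|lborel. k w * F (z + w)))"
proof -
  note ker = integrable_convolution_kernel[OF assms]
  have shift: "(LINT z|lborel. k w * f (z - w) * F z) = (LINT z|lborel. k w * f z * F (z + w))" for w
    using integral_translate[of "\<lambda>z. k w * f z * F (z + w)" w] by simp
  have intz: "integrable (lborel \<Otimes>\<^sub>M lborel) (\<lambda>(w, z). k w * f z * F (z + w))"
  proof (rule integrable_lborel_pair)
    have m: "(\<lambda>z. F (z + w)) \<in> borel_measurable borel" for w by measurable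
    have int: "integrable lborel (\<lambda>z. f z * F (z + w))" for w
      by (rule integrable_mult_bounded(1)[OF f m F])
    then show "integrable lborel (\<lambda>z. case (w, z) of (w, z) \<Rightarrow> k w * f z * F (z + w))" for w
      by (simp add: mult.assoc)
    \<comment> \<open>For fixed \<open>w\<close> the moduli of the shifted and the unshifted kernel
      have the same integral over \<open>z\<close>, so integrability of the former is inherited from
      \<open>ker\<close>.\<close>
    have "integrable (lborel \<Otimes>\<^sub>M lborel) (\<lambda>(w, z). cmod (k w * f (z - w) * F z))"
      using integrable_norm[OF ker] by (simp add: case_prod_beta')
    then have "integrable lborel (\<lambda>w. LINT z|lborel. cmod (k w * f (z - w) * F z))"
      by (rule lborel_pair.integrable_fst)
    also have "(\<lambda>w. LINT z|lborel. cmod (k w * f (z - w) * F z)) =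
        (\<lambda>w. LINT z|lborel. cmod (k w * f z * F (z + w)))"
    proof
      fix w
      show "(LINT z|lborel. cmod (k w * f (z - w) * F z)) = (LINT z|lborel. cmod (k w * f z * F (z + w)))"
        using integral_translate[of "\<lambda>z. cmod (k w * f z * F (z + w))" w] by simp
    qed
    finally show "integrable lborel (\<lambda>w. LINT z|lborel. cmod (case (w, z) of (w, z) \<Rightarrow> k w * f z * F (z + w)))"
      by simp
  qed measurable
  have "(LINT z|lborel. L1_convolution k f z * F z) = (LINT z|lborel. LINT w|lborel. k w * f (z - w) * F z)"
    by (simp add: L1_convolution_def)
  also have "\<dots> = (LINT w|lborel. LINT z|lborel. k w * f (z - w) * F z)"
    by (rule lborel_pair.Fubini_integral[OF ker])
  also have "\<dots> = (LINT w|lborel. LINT z|lborel. k w * f z * F (z + w))"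
    by (simp only: shift)
  also have "\<dots> = (LINT z|lborel. LINT w|lborel. k w * f z * F (z + w))"
    by (rule lborel_pair.Fubini_integral[OF intz, symmetric])
  also have "\<dots> = (LINT z|lborel. f z * (LINT w|lborel. k w * F (z + w)))"
    by (simp add: mult.commute[of "k _" "f _"] mult.assoc)
  finally show ?thesis .
qed

text \<open>As \<open>k\<close> has integral 1, \<open>f z\<close> is itself the integral of
  \<open>k w * f z\<close>, and the difference is an average of translation errors. Fubini brings
  the L1 norm of these errors inside.\<close>

lemma norm_L1_convolution_diff_le:
  assumes k1: "(LINT w|lborel. k w) = 1"
    and small: "\<And>w. k w \<noteq> 0 \<Longrightarrow> (LINT z|lborel. cmod (f (z - w) - f z)) \<le> eps"
  shows "(LINT z|lborel. cmod (L1_convolution k f z - f z)) \<le> (LINT w|lborel. cmod (k w)) * eps"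
proof -
  have ker: "integrable (lborel \<Otimes>\<^sub>M lborel) (\<lambda>(w, z). k w * f (z - w))"
    using integrable_convolution_kernel[of "\<lambda>_. 1" 1] by simp
  have kf: "integrable (lborel \<Otimes>\<^sub>M lborel) (\<lambda>(w, z). k w * f z)"
  proof (rule integrable_lborel_pair)
    show "integrable lborel (\<lambda>w. LINT z|lborel. cmod (case (w, z) of (w, z) \<Rightarrow> k w * f z))"
      using k f by (simp add: norm_mult)
    show "integrable lborel (\<lambda>z. case (w, z) of (w, z) \<Rightarrow> k w * f z)" for w
      using f by simp
  qed measurable
  have d: "integrable (lborel \<Otimes>\<^sub>M lborel) (\<lambda>(w, z). k w * (f (z - w) - f z))"
    using Bochner_Integration.integrable_diff[OF ker kf] by (simp add: case_prod_beta' right_diff_distrib)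
  then have dn: "integrable (lborel \<Otimes>\<^sub>M lborel) (\<lambda>(w, z). cmod (k w * (f (z - w) - f z)))"
    using integrable_norm by (fastforce simp: case_prod_beta')
  have AEk: "AE z in lborel. integrable lborel (\<lambda>w. k w * f (z - w))"
    using lborel_pair.AE_integrable_snd[OF ker] by simp
  have "(LINT z|lborel. cmod (L1_convolution k f z - f z)) \<le>
      (LINT z|lborel. LINT w|lborel. cmod (k w * (f (z - w) - f z)))"
  proof (rule integral_mono_AE)
    show "integrable lborel (\<lambda>z. cmod (L1_convolution k f z - f z))"
      using integrable_L1_convolution f by simp
    show "integrable lborel (\<lambda>z. LINT w|lborel. cmod (k w * (f (z - w) - f z)))"
      by (rule lborel_pair.integrable_snd[OF dn])
    show "AE z in lborel. cmod (L1_convolution k f z - f z) \<le> (LINT w|lborel. cmod (k w * (f (z - w) - f z)))"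
      using AEk
    proof eventually_elim
      case (elim z)
      have "L1_convolution k f z - f z = (LINT w|lborel. k w * f (z - w)) - (LINT w|lborel. k w * f z)"
        using k1 by (simp add: L1_convolution_def)
      also have "\<dots> = (LINT w|lborel. k w * f (z - w) - k w * f z)"
        using elim k by (intro Bochner_Integration.integral_diff[symmetric]) auto
      finally show ?case
        using integral_norm_bound[of lborel "\<lambda>w. k w * f (z - w) - k w * f z"]
        by (simp add: right_diff_distrib)
    qed
  qed
  also have "\<dots> = (LINT w|lborel. LINT z|lborel. cmod (k w * (f (z - w) - f z)))"
    by (rule lborel_pair.Fubini_integral[OF dn])
  also have "\<dots> \<le> (LINT w|lborel. cmod (k w) * eps)"
  proof (rule integral_mono)
    show "integrable lborel (\<lambda>w. LINT z|lborel. cmod (k w * (f (z - w) - f z)))"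
      by (rule lborel_pair.integrable_fst[OF dn])
    show "(LINT z|lborel. cmod (k w * (f (z - w) - f z))) \<le> cmod (k w) * eps" for w
      using small[of w] by (cases "k w = 0") (auto simp: norm_mult mult_left_mono)
  qed (use k in simp)
  finally show ?thesis by simp
qed

end

text \<open>By \<open>tf_coeff_translate\<close>, the coefficient functions of
  \<open>k \<star> A\<close> are averages of translates of those of \<open>A\<close>; this turns the
  claim into \<open>integral_L1_convolution\<close>.\<close>

lemma L1_convolution_op_convolution:
  assumes k: "integrable lborel k" and f: "integrable lborel f" and A: "bounded_clinear A"
  shows "L1_convolution k f \<star> A = f \<star> (k \<star> A)"
proof (rule ext, rule cinner_eqI)
  fix \<psi> \<phi>
  obtain K where K: "0 \<le> K" "\<And>x. norm (A x) \<le> K * norm x"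
    using bounded_clinear_bound[OF A] by blast
  have "tf_coeff (k \<star> A) \<psi> \<phi> z = (LINT w|lborel. k w * tf_coeff A \<psi> \<phi> (z + w))" for z
    unfolding tf_coeff_def[of "k \<star> A"]
    by (simp add: cinner_op_convolution[OF A k] tf_coeff_translate[OF A])
  then show "cinner ((L1_convolution k f \<star> A) \<psi>) \<phi> = cinner ((f \<star> (k \<star> A)) \<psi>) \<phi>"
    using integral_L1_convolution[OF k f tf_coeff_measurable[OF A] cmod_tf_coeff_le[OF K(2)]]
    by (simp add: cinner_op_convolution A k f integrable_L1_convolution bounded_clinear_conv)
qed

section \<open>Dual description of the Schatten norms\<close>

text \<open>The graph of the convex function \<open>s powr p\<close> lies above its tangent at
  \<open>m\<close>. Used in place of Hoelder's inequality, it avoids the conjugate exponent and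
  covers \<open>p = 1\<close>.\<close>

lemma powr_tangent:
  fixes s m p :: real
  assumes p: "1 \<le> p" and s: "0 \<le> s" and m: "0 \<le> m"
  shows "p * (m powr (p - 1) * s) \<le> s powr p + (p - 1) * m powr p"
proof (cases "m = 0 \<or> p = 1")
  \<comment> \<open>The cases outside Young's inequality: for \<open>p = 1\<close> the conjugate
    exponent is infinite, and for \<open>m = 0\<close> the left side vanishes as
    \<open>0 powr _ = 0\<close>.\<close>
  case True
  then show ?thesis using s m p by (cases "m = 0") auto
next
  case False
  with p m have p: "1 < p" and m: "0 < m" by auto
  define q where "q = p / (p - 1)"
  have q: "1 < q" "1 / p + 1 / q = 1" using p by (auto simp: q_def field_simps)
  have "s * m powr (p - 1) \<le> s powr p / p + (m powr (p - 1)) powr q / q"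
    using Youngs_inequality[OF p q s] by simp
  also have "(m powr (p - 1)) powr q = m powr p"
    using p by (simp add: powr_powr q_def)
  also have "m powr p / q = (p - 1) * m powr p / p" using p by (simp add: q_def)
  finally have "p * (s * m powr (p - 1)) \<le> p * (s powr p / p + (p - 1) * m powr p / p)"
    using p by (intro mult_left_mono) auto
  then show ?thesis using p by (simp add: distrib_left mult.commute)
qed

text \<open>Jensen's inequality, from the tangent at the weighted mean \<open>m\<close>. Weights of
  total mass below 1 are allowed, since missing mass amounts to the value 0.\<close>

lemma powr_sum_le:
  fixes w s :: "'i \<Rightarrow> real"
  assumes p: "1 \<le> p" and w: "\<And>i. i \<in> F \<Longrightarrow> 0 \<le> w i" "sum w F \<le> 1"
    and s: "\<And>i. i \<in> F \<Longrightarrow> 0 \<le> s i"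
  shows "(\<Sum>i\<in>F. w i * s i) powr p \<le> (\<Sum>i\<in>F. w i * s i powr p)"
proof -
  define m where "m = (\<Sum>i\<in>F. w i * s i)"
  have m: "0 \<le> m" unfolding m_def using w s by (intro sum_nonneg) auto
  have "(\<Sum>i\<in>F. w i * (p * (m powr (p - 1) * s i))) \<le> (\<Sum>i\<in>F. w i * (s i powr p + (p - 1) * m powr p))"
    by (intro sum_mono mult_left_mono powr_tangent p s w m)
  also have "(\<Sum>i\<in>F. w i * (p * (m powr (p - 1) * s i))) = (\<Sum>i\<in>F. p * m powr (p - 1) * (w i * s i))"
    by (intro sum.cong) (simp_all add: mult_ac)
  also have "\<dots> = p * m powr (p - 1) * m"
    by (simp only: sum_distrib_left[symmetric] m_def[symmetric])
  also have "p * m powr (p - 1) * m = p * m powr p"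
    using m by (cases "m = 0") (simp_all add: powr_mult_base mult_ac)
  also have "(\<Sum>i\<in>F. w i * (s i powr p + (p - 1) * m powr p)) =
      (\<Sum>i\<in>F. w i * s i powr p) + sum w F * ((p - 1) * m powr p)"
    by (simp add: distrib_left sum.distrib sum_distrib_right)
  also have "sum w F * ((p - 1) * m powr p) \<le> 1 * ((p - 1) * m powr p)"
    using p w by (intro mult_right_mono) auto
  finally show ?thesis by (simp add: m_def left_diff_distrib)
qed

text \<open>The unit ball of the dual of \<open>\<ell>\<^sup>p\<close>, without naming the conjugate exponent, which is infinite for \<open>p = 1\<close>.\<close>

definition dual_weights :: "real \<Rightarrow> nat \<Rightarrow> (nat \<Rightarrow> real) \<Rightarrow> bool" where
  "dual_weights p N b \<longleftrightarrow> (\<forall>n. 0 \<le> b n) \<and>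
     (\<forall>x. (\<forall>n. 0 \<le> x n) \<longrightarrow> (\<Sum>n<N. b n * x n) powr p \<le> (\<Sum>n<N. x n powr p))"

lemma powr_le_imp_le_powr:
  fixes a c p :: real
  assumes "a powr p \<le> c" "0 < p" "0 \<le> a" shows "a \<le> c powr (1 / p)"
proof -
  have "(a powr p) powr (1 / p) \<le> c powr (1 / p)"
    using assms by (intro powr_mono2) auto
  then show ?thesis using assms by (simp add: powr_powr)
qed

lemma dual_weights_sum_le:
  assumes "dual_weights p N b" "1 \<le> p" "\<And>n. 0 \<le> x n" "(\<Sum>n<N. x n powr p) \<le> C"
  shows "(\<Sum>n<N. b n * x n) \<le> C powr (1 / p)"
proof (rule powr_le_imp_le_powr)
  have "(\<Sum>n<N. b n * x n) powr p \<le> (\<Sum>n<N. x n powr p)"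
    using assms(1,3) unfolding dual_weights_def by blast
  then show "(\<Sum>n<N. b n * x n) powr p \<le> C" using assms(4) by linarith
  show "0 \<le> (\<Sum>n<N. b n * x n)" using assms by (intro sum_nonneg) (auto simp: dual_weights_def)
qed (use assms in simp)

lemma dual_weights_le_1:
  assumes b: "dual_weights p N b" and p: "1 \<le> p" and n: "n < N"
  shows "b n \<le> 1"
proof -
  have "(\<Sum>k<N. b k * (if k = n then 1 else 0)) \<le> 1 powr (1 / p)"
  proof (rule dual_weights_sum_le[OF b p])
    have "(if k = n then 1 else 0) powr p = (if k = n then 1 else 0 :: real)" for k by simp
    then show "(\<Sum>k<N. (if k = n then 1 else 0) powr p) \<le> (1::real)" using n by simp
  qed auto
  then show ?thesis using n by (simp add: if_distrib[of "\<lambda>x. _ * x"] cong: if_cong)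
qed

lemma dual_weights_1: "dual_weights p 1 (\<lambda>_. 1)"
  by (simp add: dual_weights_def)

text \<open>The equality case of Hoelder's inequality: the weights are proportional to
  \<open>s n powr (p - 1)\<close>, normalized in the dual norm. For \<open>p = 1\<close> they are 1
  on the support of \<open>s\<close> and 0 elsewhere.\<close>

lemma dual_weights_extremal:
  assumes p: "1 \<le> p" and s: "\<And>n. 0 \<le> s n" and C: "C = (\<Sum>n<N. s n powr p)" "0 < C"
  defines "b \<equiv> \<lambda>n. s n powr (p - 1) / C powr (1 - 1 / p)"
  shows "dual_weights p N b" "(\<Sum>n<N. b n * s n) = C powr (1 / p)"
proof -
  have eq: "s n powr (p - 1) * s n = s n powr p" for n
    using s[of n] by (cases "s n = 0") (simp_all add: powr_mult_base mult.commute)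
  have Cp: "C powr (1 - 1 / p) * C powr (1 / p) = C"
    using C(2) by (simp flip: powr_add)
  have "(\<Sum>n<N. b n * s n) = (\<Sum>n<N. s n powr (p - 1) * s n) / C powr (1 - 1 / p)"
    by (simp add: b_def sum_divide_distrib)
  also have "\<dots> = C / C powr (1 - 1 / p)" by (simp only: eq C(1))
  also have "\<dots> = C powr (1 / p)" using Cp C(2) by (simp add: field_simps)
  finally show "(\<Sum>n<N. b n * s n) = C powr (1 / p)" .
  show "dual_weights p N b"
    unfolding dual_weights_def
  proof (intro conjI allI impI)
    show "0 \<le> b n" for n by (simp add: b_def)
    fix x :: "nat \<Rightarrow> real" assume x: "\<forall>n. 0 \<le> x n"
    define X where "X = (\<Sum>n<N. x n powr p)"
    have X: "0 \<le> X" unfolding X_def by (intro sum_nonneg) simp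
    show "(\<Sum>n<N. b n * x n) powr p \<le> (\<Sum>n<N. x n powr p)"
    proof (cases "X = 0")
      case True
      then have "\<forall>n\<in>{..<N}. x n powr p = 0"
        unfolding X_def by (subst (asm) sum_nonneg_eq_0_iff) auto
      then have "(\<Sum>n<N. b n * x n) = 0" by (intro sum.neutral) auto
      then show ?thesis by (simp add: sum_nonneg)
    next
      case False
      with X have X0: "0 < X" by simp
      \<comment> \<open>The scaling that gives \<open>t * x\<close> the same p-th power sum
        \<open>C\<close> as \<open>s\<close>; the summed tangent inequalities are then sharp
        enough.\<close>
      define t where "t = (C / X) powr (1 / p)"
      have t: "0 < t" using C(2) X0 by (simp add: t_def)
      have tp: "t powr p = C / X" using C(2) X0 p by (simp add: t_def powr_powr)
      have "(\<Sum>n<N. p * (s n powr (p - 1) * (t * x n))) \<le>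
          (\<Sum>n<N. (t * x n) powr p + (p - 1) * s n powr p)"
        using t x by (intro sum_mono powr_tangent p s) auto
      also have "\<dots> = t powr p * X + (p - 1) * C"
        using t x by (simp add: powr_mult sum.distrib sum_distrib_left[symmetric] X_def C(1))
      also have "\<dots> = p * C" using X0 by (simp add: tp left_diff_distrib)
      also have "(\<Sum>n<N. p * (s n powr (p - 1) * (t * x n))) = p * (t * (\<Sum>n<N. s n powr (p - 1) * x n))"
        by (simp add: sum_distrib_left mult_ac)
      finally have "t * (\<Sum>n<N. s n powr (p - 1) * x n) \<le> C" using p by simp
      then have "t * (C powr (1 - 1 / p) * (\<Sum>n<N. b n * x n)) \<le> C"
        using C(2) by (simp add: b_def sum_distrib_left)
      then have "(\<Sum>n<N. b n * x n) \<le> C / (t * C powr (1 - 1 / p))"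
        using t C(2) by (simp add: field_simps)
      also have "\<dots> = C powr (1 / p) / t"
        using Cp C(2) t by (simp add: field_simps)
      finally have le: "(\<Sum>n<N. b n * x n) \<le> C powr (1 / p) / t" .
      have "(\<Sum>n<N. b n * x n) powr p \<le> (C powr (1 / p) / t) powr p"
        using le p x by (intro powr_mono2) (auto simp: b_def intro!: sum_nonneg)
      also have "\<dots> = C / t powr p" using t C(2) p by (simp add: powr_divide powr_powr)
      also have "\<dots> = X" using C(2) X0 by (simp add: tp)
      finally show ?thesis by (simp add: X_def)
    qed
  qed
qed

section \<open>Upper bounds for the Schatten norm\<close>

abbreviation weighted_trace :: "nat \<Rightarrow> (nat \<Rightarrow> real) \<Rightarrow> (nat \<Rightarrow> 'a::euclidean_space L2) \<Rightarrow> (nat \<Rightarrow> 'a L2) \<Rightarrow>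
    ('a L2 \<Rightarrow> 'a L2) \<Rightarrow> complex" where
  "weighted_trace N b e g A \<equiv> (\<Sum>n<N. of_real (b n) * cinner (A (e n)) (g n))"

text \<open>Recording upper bounds \<open>M\<close> instead of a supremum needs no side condition of
  boundedness. Only finite sums occur, so every functional is continuous for pointwise convergence
  of operators.\<close>

definition schatten_le :: "real \<Rightarrow> real \<Rightarrow> ('a::euclidean_space L2 \<Rightarrow> 'a L2) \<Rightarrow> bool" where
  "schatten_le p M A \<longleftrightarrow> (\<forall>e g N b. orthonormal e \<longrightarrow> orthonormal g \<longrightarrow> dual_weights p N b \<longrightarrow>
     cmod (weighted_trace N b e g A) \<le> M)"

lemma schatten_leI:
  assumes "\<And>e g N b. orthonormal e \<Longrightarrow> orthonormal g \<Longrightarrow> dual_weights p N b \<Longrightarrow>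
     cmod (weighted_trace N b e g A) \<le> M"
  shows "schatten_le p M A"
  using assms unfolding schatten_le_def by blast

lemma schatten_leD:
  "schatten_le p M A \<Longrightarrow> orthonormal e \<Longrightarrow> orthonormal g \<Longrightarrow> dual_weights p N b \<Longrightarrow>
     cmod (weighted_trace N b e g A) \<le> M"
  unfolding schatten_le_def by blast

lemma schatten_le_mono: "schatten_le p M A \<Longrightarrow> M \<le> M' \<Longrightarrow> schatten_le p M' A"
  unfolding schatten_le_def by (meson order_trans)

lemma schatten_le_zero: "schatten_le p 0 (\<lambda>\<psi>. 0)"
  by (rule schatten_leI) (simp add: cinner.zero_left)

lemma schatten_le_add:
  assumes "schatten_le p M A" "schatten_le p M' B"
  shows "schatten_le p (M + M') (\<lambda>\<psi>. A \<psi> + B \<psi>)"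
proof (rule schatten_leI)
  fix e g :: "nat \<Rightarrow> 'a L2" and N b
  assume eg: "orthonormal e" "orthonormal g" "dual_weights p N b"
  have "(\<Sum>n<N. of_real (b n) * cinner (A (e n) + B (e n)) (g n)) =
      (weighted_trace N b e g A) + (weighted_trace N b e g B)"
    by (simp add: cinner_add_left distrib_left sum.distrib)
  then show "cmod (\<Sum>n<N. of_real (b n) * cinner (A (e n) + B (e n)) (g n)) \<le> M + M'"
    using schatten_leD[OF assms(1) eg] schatten_leD[OF assms(2) eg]
    by (simp add: norm_triangle_le)
qed

lemma schatten_le_scaleC:
  assumes "schatten_le p M A"
  shows "schatten_le p (cmod c * M) (\<lambda>\<psi>. c *\<^sub>C A \<psi>)"
proof (rule schatten_leI)
  fix e g :: "nat \<Rightarrow> 'a L2" and N b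
  assume eg: "orthonormal e" "orthonormal g" "dual_weights p N b"
  have "(\<Sum>n<N. of_real (b n) * cinner (c *\<^sub>C A (e n)) (g n)) =
      c * (weighted_trace N b e g A)"
    by (simp add: sum_distrib_left mult.left_commute)
  then show "cmod (\<Sum>n<N. of_real (b n) * cinner (c *\<^sub>C A (e n)) (g n)) \<le> cmod c * M"
    using schatten_leD[OF assms(1) eg] by (simp add: norm_mult mult_left_mono)
qed

lemma schatten_le_diff:
  assumes "schatten_le p M A" "schatten_le p M' B"
  shows "schatten_le p (M + M') (\<lambda>\<psi>. A \<psi> - B \<psi>)"
  using schatten_le_add[OF assms(1) schatten_le_scaleC[OF assms(2), of "-1"]]
  by (simp add: scaleC.minus_left)

lemma schatten_le_sum:
  assumes "\<And>i. i \<in> I \<Longrightarrow> schatten_le p (M i) (A i)"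
  shows "schatten_le p (\<Sum>i\<in>I. M i) (\<lambda>\<psi>. \<Sum>i\<in>I. A i \<psi>)"
  using assms
  by (induction I rule: infinite_finite_induct)
     (auto intro: schatten_le_add schatten_le_zero)

text \<open>Lower semicontinuity under pointwise convergence; for a series it turns bounds on finite
  blocks into bounds on the tail.\<close>

lemma schatten_le_limit:
  assumes "\<And>\<psi>. (\<lambda>m. A m \<psi>) \<longlonglongrightarrow> B \<psi>" "\<forall>\<^sub>F m in sequentially. schatten_le p M (A m)"
  shows "schatten_le p M B"
proof (rule schatten_leI)
  fix e g :: "nat \<Rightarrow> 'a L2" and N b
  assume eg: "orthonormal e" "orthonormal g" "dual_weights p N b"
  have "(\<lambda>m. cmod (weighted_trace N b e g (A m))) \<longlonglongrightarrow>
      cmod (weighted_trace N b e g B)"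
    by (intro tendsto_intros cinner.tendsto assms(1))
  then show "cmod (weighted_trace N b e g B) \<le> M"
    by (rule tendsto_upperbound)
       (use assms(2) in \<open>auto elim!: eventually_mono intro: schatten_leD[OF _ eg]\<close>)
qed

text \<open>The empty sum \<open>N = 0\<close> gives the bound. In the absence of orthonormal
  sequences \<open>schatten_le\<close> would hold vacuously for every \<open>M\<close>, hence the
  assumption on \<open>u\<close>.\<close>

lemma schatten_le_nonneg:
  fixes A :: "'a::euclidean_space L2 \<Rightarrow> 'a L2" and u :: "nat \<Rightarrow> 'a L2"
  assumes "schatten_le p M A" "orthonormal u" shows "0 \<le> M"
  using schatten_leD[OF assms(1,2,2), of 0 "\<lambda>_. 0"] by (simp add: dual_weights_def)

text \<open>The Schatten norm dominates the operator norm: one weight 1 at index 0 suffices, as any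
  two unit vectors start orthonormal sequences.\<close>

lemma schatten_le_norm:
  fixes A :: "'a::euclidean_space L2 \<Rightarrow> 'a L2" and u :: "nat \<Rightarrow> 'a L2"
  assumes A: "schatten_le p M A" "bounded_clinear A" and u: "orthonormal u"
  shows "norm (A \<psi>) \<le> M * norm \<psi>"
proof (rule norm_le_cinner)
  have M: "0 \<le> M" using schatten_le_nonneg[OF A(1) u] .
  then show "0 \<le> M * norm \<psi>" by simp
  fix \<phi>
  have unit: "cmod (cinner (A v) w) \<le> M" if vw: "norm v = 1" "norm w = 1" for v w
  proof -
    obtain e where e: "orthonormal e" "e 0 = v" using orthonormal_start[OF u vw(1)] by blast
    obtain g where g: "orthonormal g" "g 0 = w" using orthonormal_start[OF u vw(2)] by blast
    show ?thesis using schatten_leD[OF A(1) e(1) g(1) dual_weights_1] e g by simp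
  qed
  show "cmod (cinner (A \<psi>) \<phi>) \<le> M * norm \<psi> * norm \<phi>"
  proof (cases "\<psi> = 0 \<or> \<phi> = 0")
    case True
    then show ?thesis using M by (auto simp: cinner.zero_left cinner.zero_right bounded_clinearD(5)[OF A(2)])
  next
    case False
    then have nz: "norm \<psi> \<noteq> 0" "norm \<phi> \<noteq> 0" by auto
    have "cmod (cinner (A (sgn \<psi>)) (sgn \<phi>)) \<le> M"
      using False by (intro unit) (auto simp: norm_sgn)
    also have "cinner (A (sgn \<psi>)) (sgn \<phi>) = complex_of_real (inverse (norm \<psi>) * inverse (norm \<phi>)) * cinner (A \<psi>) \<phi>"
      by (simp add: sgn_div_norm scaleC_of_real[symmetric] bounded_clinearD(2)[OF A(2)] mult_ac)
    finally have "cmod (cinner (A \<psi>) \<phi>) / (norm \<psi> * norm \<phi>) \<le> M"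
      by (simp add: norm_mult norm_inverse divide_inverse mult_ac)
    then show ?thesis using nz by (simp add: field_simps)
  qed
qed

definition svd_sum :: "(nat \<Rightarrow> real) \<Rightarrow> (nat \<Rightarrow> 'a::euclidean_space L2) \<Rightarrow> (nat \<Rightarrow> 'a L2) \<Rightarrow> nat set \<Rightarrow> 'a L2 \<Rightarrow> 'a L2" where
  "svd_sum s e g F \<psi> = (\<Sum>k\<in>F. (of_real (s k) * cinner \<psi> (e k)) *\<^sub>C g k)"

lemma sum_mult_orthonormal_le_1:
  assumes "orthonormal_on I e" "orthonormal_on I g" "finite I" "norm x \<le> 1" "norm y \<le> 1"
  shows "(\<Sum>n\<in>I. cmod (cinner x (e n)) * cmod (cinner y (g n))) \<le> 1"
proof -
  have "(\<Sum>n\<in>I. cmod (cinner x (e n)) * cmod (cinner y (g n))) \<le>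
      (\<Sum>n\<in>I. ((cmod (cinner x (e n)))\<^sup>2 + (cmod (cinner y (g n)))\<^sup>2) / 2)"
  proof (rule sum_mono)
    fix n
    show "cmod (cinner x (e n)) * cmod (cinner y (g n)) \<le> ((cmod (cinner x (e n)))\<^sup>2 + (cmod (cinner y (g n)))\<^sup>2) / 2"
      using sum_squares_bound[of "cmod (cinner x (e n))" "cmod (cinner y (g n))"] by simp
  qed
  also have "\<dots> = ((\<Sum>n\<in>I. (cmod (cinner x (e n)))\<^sup>2) + (\<Sum>n\<in>I. (cmod (cinner y (g n)))\<^sup>2)) / 2"
    by (simp add: sum.distrib sum_divide_distrib[symmetric])
  also have "\<dots> \<le> ((norm x)\<^sup>2 + (norm y)\<^sup>2) / 2"
    using Bessel[OF assms(1,3), of x] Bessel[OF assms(2,3), of y] by simp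
  also have "\<dots> \<le> 1"
    using power_le_one[OF norm_ge_zero assms(4), of 2] power_le_one[OF norm_ge_zero assms(5), of 2] by simp
  finally show ?thesis .
qed

lemma cmod_cinner_commute: "cmod (cinner x y) = cmod (cinner y x)"
  using cinner_commute[of x y] by simp

text \<open>The matrix \<open>w\<close> has row and column sums at most 1 by Bessel's inequality.
  The row sums permit Jensen's inequality, after which the column sums bound the total by the p-th
  power sum of \<open>s\<close>.\<close>

lemma schatten_le_svd_sum:
  assumes p: "1 \<le> p" and s: "\<And>k. 0 \<le> s k" and e': "orthonormal e'" and g': "orthonormal g'"
    and F: "finite F" and C: "(\<Sum>k\<in>F. s k powr p) \<le> C"
  shows "schatten_le p (C powr (1 / p)) (svd_sum s e' g' F)"
proof (rule schatten_leI)
  fix e g :: "nat \<Rightarrow> 'a L2" and N b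
  assume e: "orthonormal e" and g: "orthonormal g" and b: "dual_weights p N b"
  have b0: "0 \<le> b n" for n using b by (simp add: dual_weights_def)
  define w where "w n k = cmod (cinner (e n) (e' k)) * cmod (cinner (g n) (g' k))" for n k
  define x where "x n = (\<Sum>k\<in>F. w n k * s k)" for n
  have w0: "0 \<le> w n k" for n k by (simp add: w_def)
  have x0: "0 \<le> x n" for n unfolding x_def using w0 s by (intro sum_nonneg) auto
  have row: "(\<Sum>k\<in>F. w n k) \<le> 1" for n
    unfolding w_def
    by (rule sum_mult_orthonormal_le_1[OF orthonormal_imp_on[OF e'] orthonormal_imp_on[OF g'] F])
       (simp_all add: norm_orthonormal e g)
  have col: "(\<Sum>n<N. w n k) \<le> 1" for k
    unfolding w_def cmod_cinner_commute[of "e _"] cmod_cinner_commute[of "g _"]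
    by (rule sum_mult_orthonormal_le_1[OF orthonormal_imp_on[OF e] orthonormal_imp_on[OF g]])
       (simp_all add: norm_orthonormal e' g')
  have "cmod (weighted_trace N b e g (svd_sum s e' g' F)) \<le> (\<Sum>n<N. b n * x n)"
  proof (rule sum_norm_le)
    fix n
    have "cmod (cinner (svd_sum s e' g' F (e n)) (g n)) \<le> x n"
      unfolding svd_sum_def x_def cinner.sum_left
    proof (rule sum_norm_le)
      fix k
      show "cmod (cinner ((of_real (s k) * cinner (e n) (e' k)) *\<^sub>C g' k) (g n)) \<le> w n k * s k"
        using s[of k] by (simp add: norm_mult w_def cmod_cinner_commute[of "g' k"])
    qed
    then show "cmod (of_real (b n) * cinner (svd_sum s e' g' F (e n)) (g n)) \<le> b n * x n"
      using b0[of n] by (simp add: norm_mult mult_left_mono)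
  qed
  also have "\<dots> \<le> C powr (1 / p)"
  proof (rule dual_weights_sum_le[OF b p x0])
    have "(\<Sum>n<N. x n powr p) \<le> (\<Sum>n<N. \<Sum>k\<in>F. w n k * s k powr p)"
      unfolding x_def by (intro sum_mono powr_sum_le p w0 row s)
    also have "\<dots> = (\<Sum>k\<in>F. (\<Sum>n<N. w n k) * s k powr p)"
      by (subst sum.swap) (simp add: sum_distrib_right)
    also have "\<dots> \<le> (\<Sum>k\<in>F. 1 * s k powr p)"
      by (intro sum_mono mult_right_mono col) simp
    finally show "(\<Sum>n<N. x n powr p) \<le> C" using C by simp
  qed
  finally show "cmod (weighted_trace N b e g (svd_sum s e' g' F)) \<le> C powr (1 / p)" .
qed

text \<open>The weights are at most 1, so Cauchy-Schwarz and Bessel suffice. Unlike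
  \<open>schatten_le_svd_sum\<close> this needs no unit vectors, which suits differences such as
  \<open>tf_shift z x - x\<close>.\<close>

lemma schatten_le_rank_one:
  assumes p: "1 \<le> p"
  shows "schatten_le p (norm x * norm y) (\<lambda>\<psi>. cinner \<psi> x *\<^sub>C y)"
proof (rule schatten_leI)
  fix e g :: "nat \<Rightarrow> 'a L2" and N b
  assume e: "orthonormal e" and g: "orthonormal g" and b: "dual_weights p N b"
  have b0: "0 \<le> b n" for n using b by (simp add: dual_weights_def)
  have L2: "L2_set (\<lambda>n. cmod (cinner v (h n))) {..<N} \<le> norm v" if "orthonormal h" for v :: "'a L2" and h
  proof -
    have "L2_set (\<lambda>n. cmod (cinner v (h n))) {..<N} \<le> sqrt ((norm v)\<^sup>2)"
      unfolding L2_set_def using Bessel[OF orthonormal_imp_on[OF that]] by (intro real_sqrt_le_mono) auto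
    then show ?thesis by simp
  qed
  have "cmod (\<Sum>n<N. of_real (b n) * cinner (cinner (e n) x *\<^sub>C y) (g n)) \<le>
      (\<Sum>n<N. \<bar>cmod (cinner x (e n))\<bar> * \<bar>cmod (cinner y (g n))\<bar>)"
  proof (rule sum_norm_le)
    fix n assume "n \<in> {..<N}"
    then have "b n \<le> 1" using dual_weights_le_1[OF b p] by simp
    then have "b n * (cmod (cinner x (e n)) * cmod (cinner y (g n))) \<le> 1 * (cmod (cinner x (e n)) * cmod (cinner y (g n)))"
      by (intro mult_right_mono) auto
    then show "cmod (of_real (b n) * cinner (cinner (e n) x *\<^sub>C y) (g n)) \<le>
        \<bar>cmod (cinner x (e n))\<bar> * \<bar>cmod (cinner y (g n))\<bar>"
      using b0[of n] by (simp add: norm_mult cmod_cinner_commute[of "e n"])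
  qed
  also have "\<dots> \<le> L2_set (\<lambda>n. cmod (cinner x (e n))) {..<N} * L2_set (\<lambda>n. cmod (cinner y (g n))) {..<N}"
    by (rule L2_set_mult_ineq)
  also have "\<dots> \<le> norm x * norm y"
    by (intro mult_mono L2 e g) (auto simp: L2_set_nonneg)
  finally show "cmod (\<Sum>n<N. of_real (b n) * cinner (cinner (e n) x *\<^sub>C y) (g n)) \<le> norm x * norm y" .
qed

text \<open>Unitary invariance: conjugation moves the shift onto the two orthonormal systems, which
  stay orthonormal.\<close>

lemma schatten_le_op_translate:
  assumes "schatten_le p M A" shows "schatten_le p M (op_translate z A)"
proof (rule schatten_leI)
  fix e g :: "nat \<Rightarrow> 'a L2" and N b
  assume "orthonormal e" "orthonormal g" "dual_weights p N b"
  then show "cmod (weighted_trace N b e g (op_translate z A)) \<le> M"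
    using schatten_leD[OF assms orthonormal_tf_adj[of e z] orthonormal_tf_adj[of g z]]
    by (simp add: cinner_op_translate tf_coeff_def)
qed

lemma schatten_le_op_convolution:
  assumes M: "schatten_le p M A" and A: "bounded_clinear A" and f: "integrable lborel f"
  shows "schatten_le p ((LINT z|lborel. cmod (f z)) * M) (f \<star> A)"
proof (rule schatten_leI)
  fix e g :: "nat \<Rightarrow> 'a L2" and N b
  assume eg: "orthonormal e" "orthonormal g" "dual_weights p N b"
  define F where "F z = (\<Sum>n<N. of_real (b n) * tf_coeff A (e n) (g n) z)" for z
  note [measurable] = tf_coeff_measurable[OF A]
  have F: "cmod (F z) \<le> M" for z
    using schatten_leD[OF schatten_le_op_translate[OF M, of z] eg]
    by (simp add: F_def cinner_op_translate)
  have "(weighted_trace N b e g (f \<star> A)) =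
      (\<Sum>n<N. LINT z|lborel. of_real (b n) * (f z * tf_coeff A (e n) (g n) z))"
    by (simp add: cinner_op_convolution[OF A f])
  also have "\<dots> = (LINT z|lborel. (\<Sum>n<N. of_real (b n) * (f z * tf_coeff A (e n) (g n) z)))"
    by (rule Bochner_Integration.integral_sum[symmetric]) (intro integrable_mult_right impI integrable_tf_coeff A f)
  also have "\<dots> = (LINT z|lborel. f z * F z)"
    by (simp add: F_def sum_distrib_left mult.left_commute)
  finally show "cmod (weighted_trace N b e g (f \<star> A)) \<le> (LINT z|lborel. cmod (f z)) * M"
    using integrable_mult_bounded(2)[OF f _ F] by (simp add: F_def)
qed

text \<open>As \<open>k\<close> has integral 1, \<open>(k \<star> A) - A\<close> is the
  \<open>k\<close>-average of the differences of translates; a weighted trace turns this into a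
  scalar integral over the support of \<open>k\<close>.\<close>

lemma schatten_le_approximate_identity:
  assumes A: "bounded_clinear A" and k: "integrable lborel k" "(LINT z|lborel. k z) = 1"
    and eps: "0 \<le> eps" "\<And>z. k z \<noteq> 0 \<Longrightarrow> schatten_le p eps (\<lambda>\<psi>. op_translate z A \<psi> - A \<psi>)"
  shows "schatten_le p ((LINT z|lborel. cmod (k z)) * eps) (\<lambda>\<psi>. (k \<star> A) \<psi> - A \<psi>)"
proof (rule schatten_leI)
  fix e g :: "nat \<Rightarrow> 'a L2" and N b
  assume eg: "orthonormal e" "orthonormal g" "dual_weights p N b"
  let ?t = "\<lambda>n z. tf_coeff A (e n) (g n) z - cinner (A (e n)) (g n)"
  let ?W = "\<Sum>n<N. of_real (b n) * cinner ((k \<star> A) (e n) - A (e n)) (g n)"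
  define F where "F z = (\<Sum>n<N. of_real (b n) * ?t n z)" for z
  note [measurable] = tf_coeff_measurable[OF A] borel_measurable_integrable[OF k(1)]
  have int: "integrable lborel (\<lambda>z. k z * ?t n z)" for n
    using integrable_tf_coeff[OF A k(1)] k(1) by (simp add: right_diff_distrib)
  have "integrable lborel (\<lambda>z. \<Sum>n<N. of_real (b n) * (k z * ?t n z))"
    by (intro Bochner_Integration.integrable_sum integrable_mult_right impI int)
  then have intF: "integrable lborel (\<lambda>z. k z * F z)"
    by (simp add: F_def sum_distrib_left mult.left_commute)
  have "cinner ((k \<star> A) (e n) - A (e n)) (g n) =
      (LINT z|lborel. k z * ?t n z)" for n
    using integrable_tf_coeff[OF A k(1)] k
    by (simp add: cinner.diff_left cinner_op_convolution[OF A k(1)] right_diff_distrib)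
  then have "?W =
      (\<Sum>n<N. LINT z|lborel. of_real (b n) * (k z * ?t n z))"
    by simp
  also have "\<dots> = (LINT z|lborel. (\<Sum>n<N. of_real (b n) * (k z * ?t n z)))"
    by (rule Bochner_Integration.integral_sum[symmetric]) (intro integrable_mult_right impI int)
  also have "\<dots> = (LINT z|lborel. k z * F z)"
    by (simp add: F_def sum_distrib_left mult.left_commute)
  finally have "cmod ?W \<le> (LINT z|lborel. cmod (k z * F z))"
    using integral_norm_bound[of lborel "\<lambda>z. k z * F z"] by simp
  also have "\<dots> \<le> (LINT z|lborel. cmod (k z) * eps)"
  proof (rule integral_mono)
    fix z
    have "cmod (F z) \<le> eps" if "k z \<noteq> 0"
      using schatten_leD[OF eps(2)[OF that] eg]
      by (simp add: F_def cinner_op_translate cinner.diff_left)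
    then show "cmod (k z * F z) \<le> cmod (k z) * eps"
      by (cases "k z = 0") (auto simp: norm_mult mult_left_mono)
  qed (use intF k in auto)
  finally show "cmod ?W \<le> (LINT z|lborel. cmod (k z)) * eps"
    by simp
qed

section \<open>Compactness tested on orthonormal sequences\<close>

definition orthonormally_null :: "('a::euclidean_space L2 \<Rightarrow> 'a L2) \<Rightarrow> bool" where
  "orthonormally_null A \<longleftrightarrow> (\<forall>e. orthonormal e \<longrightarrow> (\<lambda>n. A (e n)) \<longlonglongrightarrow> 0)"

lemma orthonormally_null_add:
  assumes "orthonormally_null A" "orthonormally_null B"
  shows "orthonormally_null (\<lambda>\<psi>. A \<psi> + B \<psi>)"
  using assms unfolding orthonormally_null_def by (auto intro: tendsto_add_zero)

lemma orthonormally_null_scaleC: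
  assumes "orthonormally_null A"
  shows "orthonormally_null (\<lambda>\<psi>. c *\<^sub>C A \<psi>)"
  using assms unfolding orthonormally_null_def
  by (auto intro: scaleC.tendsto_right_zero)

lemma orthonormally_null_svd_sum: "finite F \<Longrightarrow> orthonormally_null (svd_sum s e' g' F)"
  unfolding orthonormally_null_def svd_sum_def
proof (intro allI impI)
  fix e :: "nat \<Rightarrow> 'a L2" assume e: "orthonormal e"
  have "(\<lambda>n. cnj (cinner (e' k) (e n))) \<longlonglongrightarrow> cnj 0" for k
    by (intro tendsto_cnj orthonormal_weakly_null[OF e])
  then have "(\<lambda>n. cinner (e n) (e' k)) \<longlonglongrightarrow> 0" for k
    by (simp flip: cinner_commute)
  then have "(\<lambda>n. (of_real (s k) * cinner (e n) (e' k)) *\<^sub>C g' k) \<longlonglongrightarrow> 0" for k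
    by (intro scaleC.tendsto_left_zero tendsto_mult_right_zero)
  then show "(\<lambda>n. \<Sum>k\<in>F. (of_real (s k) * cinner (e n) (e' k)) *\<^sub>C g' k) \<longlonglongrightarrow> 0"
    by (intro tendsto_null_sum)
qed

lemma orthonormally_null_approx:
  assumes ap: "\<And>eps. 0 < eps \<Longrightarrow> \<exists>B. orthonormally_null B \<and> (\<forall>x. norm (A x - B x) \<le> eps * norm x)"
  shows "orthonormally_null A"
  unfolding orthonormally_null_def
proof (intro allI impI, rule LIMSEQ_I)
  fix e :: "nat \<Rightarrow> 'a L2" and r :: real assume e: "orthonormal e" and r: "0 < r"
  obtain B where B: "orthonormally_null B" "\<And>x. norm (A x - B x) \<le> r / 2 * norm x"
    using ap[of "r / 2"] r by auto
  from B(1) e have "(\<lambda>n. B (e n)) \<longlonglongrightarrow> 0" unfolding orthonormally_null_def by blast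
  from LIMSEQ_D[OF this, of "r / 2"] r obtain N where N: "\<And>n. n \<ge> N \<Longrightarrow> norm (B (e n)) < r / 2"
    by auto
  show "\<exists>N. \<forall>n\<ge>N. norm (A (e n) - 0) < r"
  proof (intro exI[of _ N] allI impI)
    fix n assume n: "n \<ge> N"
    have "norm (A (e n)) \<le> norm (A (e n) - B (e n)) + norm (B (e n))"
      using norm_triangle_ineq[of "A (e n) - B (e n)" "B (e n)"] by simp
    then show "norm (A (e n) - 0) < r"
      using B(2)[of "e n"] N[OF n] by (simp add: norm_orthonormal[OF e])
  qed
qed

text \<open>Testing \<open>(f \<star> A) (e n)\<close> against itself writes its squared norm as an
  integral of coefficients. The test vectors \<open>v n\<close> vary, but they are bounded, and
  \<open>A (tf_adj z (e n))\<close> tends to 0 in norm for every \<open>z\<close> because shifted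
  sequences remain orthonormal.\<close>

lemma orthonormally_null_op_convolution:
  assumes O: "orthonormally_null A" and A: "bounded_clinear A" and f: "integrable lborel f"
  shows "orthonormally_null (f \<star> A)"
  unfolding orthonormally_null_def
proof (intro allI impI)
  fix e :: "nat \<Rightarrow> 'a L2" assume e: "orthonormal e"
  obtain K where K: "0 \<le> K" "\<And>x. norm (A x) \<le> K * norm x"
    using bounded_clinear_bound[OF A] by blast
  define L where "L = (LINT z|lborel. cmod (f z)) * K"
  define v where "v n = (f \<star> A) (e n)" for n
  have v: "norm (v n) \<le> L" for n
    using norm_op_convolution_le[OF A f K, of "e n"] by (simp add: v_def L_def norm_orthonormal[OF e])
  note [measurable] = tf_coeff_measurable[OF A] borel_measurable_integrable[OF f]
  have "(\<lambda>n. LINT z|lborel. f z * tf_coeff A (e n) (v n) z) \<longlonglongrightarrow> (LINT z|(lborel :: ('a \<times> 'a) measure). (0::complex))"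
  proof (rule integral_dominated_convergence[where w="\<lambda>z. cmod (f z) * (K * L)"])
    show "AE z in lborel. (\<lambda>n. f z * tf_coeff A (e n) (v n) z) \<longlonglongrightarrow> 0"
    proof (rule AE_I2)
      fix z
      have "(\<lambda>n. A (tf_adj z (e n))) \<longlonglongrightarrow> 0"
        using O orthonormal_tf_adj[OF e, of z] unfolding orthonormally_null_def by blast
      then have "(\<lambda>n. norm (A (tf_adj z (e n))) * L) \<longlonglongrightarrow> 0"
        by (intro tendsto_mult_left_zero tendsto_norm_zero)
      then have "(\<lambda>n. tf_coeff A (e n) (v n) z) \<longlonglongrightarrow> 0"
      proof (rule Lim_null_comparison[rotated])
        show "\<forall>\<^sub>F n in sequentially. norm (tf_coeff A (e n) (v n) z) \<le> norm (A (tf_adj z (e n))) * L"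
        proof (rule always_eventually, rule allI)
          fix n
          have "cmod (tf_coeff A (e n) (v n) z) \<le> norm (A (tf_adj z (e n))) * norm (tf_adj z (v n))"
            unfolding tf_coeff_def by (rule norm_cinner_le)
          also have "\<dots> \<le> norm (A (tf_adj z (e n))) * L"
            using v by (intro mult_left_mono) auto
          finally show "norm (tf_coeff A (e n) (v n) z) \<le> norm (A (tf_adj z (e n))) * L" .
        qed
      qed
      then show "(\<lambda>n. f z * tf_coeff A (e n) (v n) z) \<longlonglongrightarrow> 0"
        by (rule tendsto_mult_right_zero)
    qed
    show "AE z in lborel. norm (f z * tf_coeff A (e n) (v n) z) \<le> cmod (f z) * (K * L)" for n
    proof (rule AE_I2)
      fix z
      have "cmod (tf_coeff A (e n) (v n) z) \<le> K * norm (e n) * norm (v n)"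
        by (rule cmod_tf_coeff_le[OF K(2)])
      also have "\<dots> \<le> K * L"
        using v[of n] K(1) by (simp add: norm_orthonormal[OF e] mult_left_mono)
      finally show "norm (f z * tf_coeff A (e n) (v n) z) \<le> cmod (f z) * (K * L)"
        by (simp add: norm_mult mult_left_mono)
    qed
  qed (use f in auto)
  then have "(\<lambda>n. cinner (v n) (v n)) \<longlonglongrightarrow> 0"
    unfolding v_def by (simp add: cinner_op_convolution[OF A f])
  then have "(\<lambda>n. cmod (cinner (v n) (v n))) \<longlonglongrightarrow> 0" by (rule tendsto_norm_zero)
  then have "(\<lambda>n. (norm (v n))\<^sup>2) \<longlonglongrightarrow> 0" by (simp add: cinner_self norm_power)
  then show "(\<lambda>n. (f \<star> A) (e n)) \<longlonglongrightarrow> 0"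
    by (simp add: power_tendsto_0_iff tendsto_norm_zero_iff v_def)
qed

section \<open>The working form of the Schatten class and its completeness\<close>

definition schatten :: "real \<Rightarrow> ('a::euclidean_space L2 \<Rightarrow> 'a L2) \<Rightarrow> bool" where
  "schatten p A \<longleftrightarrow> bounded_clinear A \<and> orthonormally_null A \<and> (\<exists>M. schatten_le p M A)"

lemma bounded_clinear_combine:
  assumes A: "bounded_clinear A" and B: "bounded_clinear B"
  shows "bounded_clinear (\<lambda>\<psi>. A \<psi> + c *\<^sub>C B \<psi>)"
proof -
  obtain K where K: "0 \<le> K" "\<And>x. norm (A x) \<le> K * norm x" using bounded_clinear_bound[OF A] by blast
  obtain L where L: "0 \<le> L" "\<And>x. norm (B x) \<le> L * norm x" using bounded_clinear_bound[OF B] by blast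
  show ?thesis
  proof (rule bounded_clinearI)
    show "norm (A x + c *\<^sub>C B x) \<le> (K + cmod c * L) * norm x" for x
      using K(2)[of x] mult_left_mono[OF L(2)[of x], of "cmod c"]
      by (intro order_trans[OF norm_triangle_ineq]) (simp add: distrib_right)
  qed (simp_all add: bounded_clinearD[OF A] bounded_clinearD[OF B] scaleC_add_right mult.commute)
qed

lemma bounded_clinear_zero: "bounded_clinear (\<lambda>\<psi>. 0)"
  by (rule bounded_clinearI[of _ 0]) (simp_all add: scaleC.zero_right)

lemma schatten_zero: "schatten p (\<lambda>\<psi>. 0)"
  unfolding schatten_def using bounded_clinear_zero schatten_le_zero
  by (auto simp: orthonormally_null_def)

lemma schatten_combine:
  assumes "schatten p A" "schatten p B"
  shows "schatten p (\<lambda>\<psi>. A \<psi> + c *\<^sub>C B \<psi>)"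
proof -
  obtain M N where "schatten_le p M A" "schatten_le p N B"
    using assms by (auto simp: schatten_def)
  then have "schatten_le p (M + cmod c * N) (\<lambda>\<psi>. A \<psi> + c *\<^sub>C B \<psi>)"
    by (intro schatten_le_add schatten_le_scaleC)
  then show ?thesis
    using assms unfolding schatten_def
    by (auto intro!: bounded_clinear_combine orthonormally_null_add orthonormally_null_scaleC)
qed

lemma schatten_op_convolution:
  "schatten p A \<Longrightarrow> integrable lborel f \<Longrightarrow> schatten p (f \<star> A)"
  using bounded_clinear_conv[of A f] orthonormally_null_op_convolution[of A f]
    schatten_le_op_convolution[of p _ A f]
  unfolding schatten_def by blast

text \<open>Schatten bounds control operator norms, so the series converges at every vector. Tails
  are pointwise limits of finite blocks, which bounds them in the Schatten norm; their smallness in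
  operator norm passes \<open>orthonormally_null\<close> to the sum.\<close>

lemma schatten_series:
  fixes A :: "nat \<Rightarrow> 'a::euclidean_space L2 \<Rightarrow> 'a L2" and u :: "nat \<Rightarrow> 'a L2"
  assumes A: "\<And>n. schatten p (A n)" "\<And>n. schatten_le p (M n) (A n)" and M: "summable M"
    and u: "orthonormal u"
  shows "\<exists>B. schatten p B \<and> (\<forall>\<psi>. (\<lambda>n. A n \<psi>) sums B \<psi>) \<and>
     (\<forall>N. schatten_le p (\<Sum>n. M (n + N)) (\<lambda>\<psi>. B \<psi> - (\<Sum>n<N. A n \<psi>)))"
proof -
  have cl: "bounded_clinear (A n)" for n using A(1) by (simp add: schatten_def)
  have nA: "norm (A n x) \<le> M n * norm x" for n x
    by (rule schatten_le_norm[OF A(2) cl u])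
  have M0: "0 \<le> M n" for n by (rule schatten_le_nonneg[OF A(2) u])
  define B where "B \<psi> = (\<Sum>n. A n \<psi>)" for \<psi>
  have sn: "summable (\<lambda>n. norm (A n \<psi>))" for \<psi>
  proof (rule summable_comparison_test)
    show "summable (\<lambda>n. M n * norm \<psi>)" by (rule summable_mult2[OF M])
    show "\<exists>N. \<forall>n\<ge>N. norm (norm (A n \<psi>)) \<le> M n * norm \<psi>"
      using nA by (intro exI[of _ 0] allI impI) (simp only: real_norm_def abs_norm_cancel)
  qed
  then have sums: "(\<lambda>n. A n \<psi>) sums B \<psi>" for \<psi>
    unfolding B_def by (rule summable_sums[OF summable_norm_cancel])
  have lin: "B (x + y) = B x + B y" for x y
  proof (rule sums_unique2[OF sums])
    show "(\<lambda>n. A n (x + y)) sums (B x + B y)"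
      using sums_add[OF sums[of x] sums[of y]] by (simp only: bounded_clinearD(3)[OF cl])
  qed
  have sc: "B (c *\<^sub>C x) = c *\<^sub>C B x" for c x
  proof (rule sums_unique2[OF sums])
    show "(\<lambda>n. A n (c *\<^sub>C x)) sums (c *\<^sub>C B x)"
      using bounded_linear.sums[OF scaleC.bounded_linear_right sums[of x], of c]
      by (simp only: bounded_clinearD(2)[OF cl])
  qed
  have "norm (B x) \<le> suminf M * norm x" for x
  proof -
    have "norm (B x) \<le> (\<Sum>n. norm (A n x))" unfolding B_def by (rule summable_norm[OF sn])
    also have "\<dots> \<le> (\<Sum>n. M n * norm x)"
      by (intro suminf_le sn summable_mult2[OF M] nA)
    also have "\<dots> = suminf M * norm x" using suminf_mult2[OF M, of "norm x"] by simp
    finally show ?thesis .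
  qed
  with lin sc have clB: "bounded_clinear B" by (rule bounded_clinearI)
  have clS: "bounded_clinear (\<lambda>\<psi>. \<Sum>n<N. A n \<psi>) \<and> orthonormally_null (\<lambda>\<psi>. \<Sum>n<N. A n \<psi>)" for N
  proof (induction N)
    case 0
    have "schatten p (\<lambda>\<psi> :: 'a L2. 0 :: 'a L2)" by (rule schatten_zero)
    then show ?case by (simp add: schatten_def)
  next
    case (Suc N)
    then have "bounded_clinear (\<lambda>\<psi>. (\<Sum>n<N. A n \<psi>) + 1 *\<^sub>C A N \<psi>)"
      "orthonormally_null (\<lambda>\<psi>. (\<Sum>n<N. A n \<psi>) + A N \<psi>)"
      using A(1)[of N] cl[of N]
      by (intro bounded_clinear_combine orthonormally_null_add; simp add: schatten_def)+
    then show ?case by simp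
  qed
  have tail: "schatten_le p (\<Sum>n. M (n + N)) (\<lambda>\<psi>. B \<psi> - (\<Sum>n<N. A n \<psi>))" for N
  proof (rule schatten_le_limit)
    show "(\<lambda>m. \<Sum>n<m. A (n + N) \<psi>) \<longlonglongrightarrow> B \<psi> - (\<Sum>n<N. A n \<psi>)" for \<psi>
      using sums_split_initial_segment[OF sums[of \<psi>], of N] by (simp add: sums_def)
    have MN: "summable (\<lambda>n. M (n + N))" using M by (rule summable_ignore_initial_segment)
    show "\<forall>\<^sub>F m in sequentially. schatten_le p (\<Sum>n. M (n + N)) (\<lambda>\<psi>. \<Sum>n<m. A (n + N) \<psi>)"
    proof (rule always_eventually, rule allI)
      fix m
      have "schatten_le p (\<Sum>n<m. M (n + N)) (\<lambda>\<psi>. \<Sum>n<m. A (n + N) \<psi>)"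
        by (rule schatten_le_sum) (rule A(2))
      moreover have "(\<Sum>n<m. M (n + N)) \<le> (\<Sum>n. M (n + N))"
        by (rule sum_le_suminf[OF MN]) (use M0 in auto)
      ultimately show "schatten_le p (\<Sum>n. M (n + N)) (\<lambda>\<psi>. \<Sum>n<m. A (n + N) \<psi>)"
        by (rule schatten_le_mono)
    qed
  qed
  have "orthonormally_null B"
  proof (rule orthonormally_null_approx)
    fix eps :: real assume "0 < eps"
    with suminf_exist_split[OF _ M] obtain N where N: "norm (\<Sum>n. M (n + N)) < eps"
      by blast
    have clD: "bounded_clinear (\<lambda>\<psi>. B \<psi> - (\<Sum>n<N. A n \<psi>))"
      using bounded_clinear_combine[OF clB, of "\<lambda>\<psi>. \<Sum>n<N. A n \<psi>" "-1"] clS[of N]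
      by (simp add: scaleC.minus_left)
    have "norm (B x - (\<Sum>n<N. A n x)) \<le> eps * norm x" for x
    proof -
      have "norm (B x - (\<Sum>n<N. A n x)) \<le> (\<Sum>n. M (n + N)) * norm x"
        by (rule schatten_le_norm[OF tail clD u])
      also have "\<dots> \<le> eps * norm x" using N by (intro mult_right_mono) auto
      finally show ?thesis .
    qed
    then show "\<exists>S. orthonormally_null S \<and> (\<forall>x. norm (B x - S x) \<le> eps * norm x)"
      using clS[of N] by (intro exI[of _ "\<lambda>\<psi>. \<Sum>n<N. A n \<psi>"]) simp
  qed
  moreover have "schatten_le p (\<Sum>n. M n) B" using tail[of 0] by simp
  ultimately have "schatten p B" using clB unfolding schatten_def by blast
  with sums tail show ?thesis by (intro exI[of _ B]) simp
qed

section \<open>Singular value decomposition\<close>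

text \<open>Otherwise successive choice of unit vectors yields an orthonormal sequence on which
  \<open>A\<close> stays above \<open>eps\<close>, contrary to
  \<open>orthonormally_null\<close>.\<close>

lemma small_on_orthogonal_complement:
  assumes A: "bounded_clinear A" "orthonormally_null A" and eps: "0 < eps"
  shows "\<exists>N e. orthonormal_on {..<N} e \<and> (\<forall>x. (\<forall>k<N. cinner x (e k) = 0) \<longrightarrow> norm (A x) \<le> eps * norm x)"
proof (rule ccontr)
  assume neg: "\<not> ?thesis"
  define P where "P f n x \<longleftrightarrow> norm x = 1 \<and> (\<forall>k<n. cinner x (f k) = 0) \<and> eps < norm (A x)"
    for f :: "nat \<Rightarrow> 'a L2" and n x
  have "\<exists>f. \<forall>n. P f n (f n)"
  proof (rule dependent_wellorder_choice)
    show "P f n x = P g n x" if "\<And>k. k < n \<Longrightarrow> f k = g k" for x f g n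
      using that by (simp add: P_def)
    fix n f assume IH: "\<And>k. k < n \<Longrightarrow> P f k (f k)"
    have "orthonormal_on {..<n} f"
      unfolding orthonormal_on_def
    proof (intro ballI)
      fix i j assume "i \<in> {..<n}" "j \<in> {..<n}"
      then show "cinner (f i) (f j) = (if i = j then 1 else 0)"
        using IH[of i] IH[of j] cinner_commute[of "f i" "f j"]
        by (cases i j rule: linorder_cases) (auto simp: P_def norm_eq_1_cinner)
    qed
    with neg obtain x where x: "\<forall>k<n. cinner x (f k) = 0" "eps * norm x < norm (A x)"
      by (meson not_le)
    then have x0: "x \<noteq> 0" by (auto simp: bounded_clinearD(5)[OF A(1)])
    define c where "c = complex_of_real (inverse (norm x))"
    have c: "cmod c = inverse (norm x)" by (simp add: c_def norm_inverse del: of_real_inverse)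
    have "P f n (c *\<^sub>C x)"
      using x x0 eps unfolding P_def
      by (auto simp: bounded_clinearD(2)[OF A(1)] c field_simps)
    then show "\<exists>x. P f n x" by blast
  qed
  then obtain f where f: "\<And>n. P f n (f n)" by blast
  have "orthonormal f" using f by (intro orthonormalI) (auto simp: P_def)
  with A(2) have "(\<lambda>n. A (f n)) \<longlonglongrightarrow> 0"
    unfolding orthonormally_null_def by blast
  then have "(\<lambda>n. norm (A (f n))) \<longlonglongrightarrow> 0" by (rule tendsto_norm_zero)
  then have "\<forall>\<^sub>F n in sequentially. norm (A (f n)) < eps" using eps by (rule order_tendstoD)
  then obtain n where "norm (A (f n)) < eps" by (auto simp: eventually_sequentially)
  with f[of n] show False by (simp add: P_def)
qed

lemma compact_combinations:
  fixes v :: "nat \<Rightarrow> 'a::euclidean_space L2"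
  shows "compact {\<Sum>k<N. c k *\<^sub>C v k | c. \<forall>k<N. cmod (c k) \<le> 1}"
proof (induction N)
  case 0
  then show ?case by simp
next
  case (Suc N)
  let ?K = "\<lambda>N. {\<Sum>k<N. c k *\<^sub>C v k | c. \<forall>k<N. cmod (c k) \<le> 1}"
  have "?K (Suc N) = (\<lambda>(y, c). y + c *\<^sub>C v N) ` (?K N \<times> cball 0 1)"
  proof (intro set_eqI iffI)
    fix x assume "x \<in> ?K (Suc N)"
    then obtain c where "x = (\<Sum>k<N. c k *\<^sub>C v k) + c N *\<^sub>C v N" "\<forall>k<Suc N. cmod (c k) \<le> 1" by auto
    then show "x \<in> (\<lambda>(y, c). y + c *\<^sub>C v N) ` (?K N \<times> cball 0 1)"
      by (intro image_eqI[of _ _ "(\<Sum>k<N. c k *\<^sub>C v k, c N)"]) auto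
  next
    fix x assume "x \<in> (\<lambda>(y, c). y + c *\<^sub>C v N) ` (?K N \<times> cball 0 1)"
    then obtain c d where c: "x = (\<Sum>k<N. c k *\<^sub>C v k) + d *\<^sub>C v N" "\<forall>k<N. cmod (c k) \<le> 1" "cmod d \<le> 1"
      by auto
    then show "x \<in> ?K (Suc N)"
      by (intro CollectI exI[of _ "c(N := d)"]) (auto simp: less_Suc_eq)
  qed
  moreover have "compact ((\<lambda>(y, c). y + c *\<^sub>C v N) ` (?K N \<times> cball 0 1))"
    unfolding case_prod_beta'
    by (intro compact_continuous_image compact_Times Suc compact_cball continuous_intros
        scaleC.continuous_on)
  ultimately show ?case by simp
qed

text \<open>Total boundedness: on the span of finitely many \<open>e k\<close> the image of the ball
  lies in a compact set of combinations, and on the orthogonal complement \<open>A\<close> is small.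
  Three errors of \<open>eps / 4\<close> arise: closure, complement and finite net.\<close>

lemma compact_operatorI:
  assumes A: "bounded_clinear A" "orthonormally_null A"
  shows "compact_operator A"
  unfolding compact_operator_def
proof
  show "compact (closure (A ` cball 0 1))"
    unfolding compact_eq_totally_bounded
  proof (intro conjI allI impI)
    show "complete (closure (A ` cball 0 1))" by (simp add: complete_eq_closed)
    fix eps :: real assume eps: "0 < eps"
    obtain N e where e: "orthonormal_on {..<N} e"
      and small: "\<And>x. (\<forall>k<N. cinner x (e k) = 0) \<Longrightarrow> norm (A x) \<le> eps / 4 * norm x"
      using small_on_orthogonal_complement[OF A, of "eps / 4"] eps by auto
    let ?K = "{\<Sum>k<N. c k *\<^sub>C A (e k) | c. \<forall>k<N. cmod (c k) \<le> 1}"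
    obtain k where k: "finite k" "?K \<subseteq> (\<Union>x\<in>k. ball x (eps / 4))"
      using compact_combinations[where N=N and v="\<lambda>k. A (e k)"] eps unfolding compact_eq_totally_bounded
      by (meson divide_pos_pos zero_less_numeral)
    have "closure (A ` cball 0 1) \<subseteq> (\<Union>x\<in>k. ball x eps)"
    proof
      fix y assume "y \<in> closure (A ` cball 0 1)"
      then obtain x where x: "norm x \<le> 1" "dist (A x) y < eps / 4"
        using eps unfolding closure_approachable by (auto dest!: spec[of _ "eps / 4"])
      define P where "P = ortho_proj {..<N} e x"
      have "A P \<in> ?K"
      proof (intro CollectI exI conjI allI impI)
        show "A P = (\<Sum>k<N. cinner x (e k) *\<^sub>C A (e k))"
          by (simp add: P_def ortho_proj_def bounded_clinearD[OF A(1)])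
        fix k assume "k < N"
        then have "norm (e k) = 1" using e by (simp add: orthonormal_on_def norm_eq_1_cinner)
        then show "cmod (cinner x (e k)) \<le> 1" using norm_cinner_le[of x "e k"] x(1) by simp
      qed
      then obtain z where z: "z \<in> k" "dist z (A P) < eps / 4" using k(2) by auto
      have "norm (A (x - P)) \<le> eps / 4 * norm (x - P)"
        using cinner_ortho_proj[OF e] by (intro small) (auto simp: P_def)
      also have "\<dots> \<le> eps / 4 * 1"
        using norm_diff_ortho_proj_le[OF e, of x] x(1) eps by (intro mult_left_mono) (auto simp: P_def)
      finally have "dist (A P) (A x) \<le> eps / 4"
        by (simp add: bounded_clinearD(4)[OF A(1)] dist_norm norm_minus_commute)
      then have "dist z y < eps"
        using dist_triangle[of z y "A P"] dist_triangle[of "A P" y "A x"] z(2) x(2) eps by linarith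
      with z(1) show "y \<in> (\<Union>x\<in>k. ball x eps)" by auto
    qed
    with k(1) show "\<exists>k. finite k \<and> closure (A ` cball 0 1) \<subseteq> (\<Union>x\<in>k. ball x eps)" by blast
  qed
qed (rule A)

text \<open>By the parallelogram law, a maximizing sequence is Cauchy as soon as its image converges.\<close>

lemma norm_attained:
  fixes A :: "'a::euclidean_space L2 \<Rightarrow> 'a L2" and u :: "nat \<Rightarrow> 'a L2"
  assumes A: "compact_operator A" and F: "finite F" and u: "orthonormal u"
  shows "\<exists>v. norm v = 1 \<and> (\<forall>f\<in>F. cinner v f = 0) \<and>
     (\<forall>x. (\<forall>f\<in>F. cinner x f = 0) \<longrightarrow> norm (A x) \<le> norm (A v) * norm x)"
proof -
  have cl: "bounded_clinear A" and cpt: "compact (closure (A ` cball 0 1))"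
    using A by (auto simp: compact_operator_def)
  interpret A: bounded_linear A by (rule bounded_clinearD(1)[OF cl])
  obtain K where K: "\<And>x. norm (A x) \<le> K * norm x" using bounded_clinear_bound[OF cl] by blast
  define V where "V = {x. \<forall>f\<in>F. cinner x f = 0}"
  define U where "U = {x \<in> V. norm x = 1}"
  obtain v0 where v0: "v0 \<in> U"
    using unit_vector_orthogonal_finite[OF u F] by (auto simp: U_def V_def)
  define \<sigma> where "\<sigma> = (SUP x\<in>U. norm (A x))"
  have bdd: "bdd_above ((\<lambda>x. norm (A x)) ` U)"
  proof (rule bdd_aboveI)
    fix r assume "r \<in> (\<lambda>x. norm (A x)) ` U"
    then obtain x where "r = norm (A x)" "norm x = 1" by (auto simp: U_def)
    with K[of x] show "r \<le> K" by simp
  qed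
  have le: "norm (A x) \<le> \<sigma> * norm x" if "x \<in> V" for x
  proof (cases "x = 0")
    case False
    define c where "c = complex_of_real (inverse (norm x))"
    have c: "cmod c = inverse (norm x)" by (simp add: c_def norm_inverse del: of_real_inverse)
    have "c *\<^sub>C x \<in> U"
      using that False by (simp add: U_def V_def c)
    then have "norm (A (c *\<^sub>C x)) \<le> \<sigma>"
      unfolding \<sigma>_def by (rule cSUP_upper[OF _ bdd])
    then show ?thesis using False
      by (simp add: bounded_clinearD(2)[OF cl] c field_simps)
  qed (simp add: A.zero)
  have \<sigma>0: "0 \<le> \<sigma>" using order_trans[OF norm_ge_zero le[of v0]] v0 by (simp add: U_def)
  show ?thesis
  proof (cases "\<sigma> = 0")
    \<comment> \<open>Every unit vector of \<open>V\<close> attains the supremum 0; in the other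
      case \<open>\<sigma>\<close> serves as a divisor.\<close>
    case True
    then show ?thesis using v0 le by (intro exI[of _ v0]) (auto simp: U_def V_def)
  next
    case False
    with \<sigma>0 have \<sigma>: "0 < \<sigma>" by simp
    have "\<exists>x\<in>U. \<sigma> - 1 / real (Suc n) < norm (A x)" for n
    proof -
      have "\<sigma> - 1 / real (Suc n) < \<sigma>" by simp
      then show ?thesis
        using less_cSUP_iff[OF _ bdd, of "\<sigma> - 1 / real (Suc n)"] v0 unfolding \<sigma>_def by auto
    qed
    then obtain x where x: "\<And>n. x n \<in> U" "\<And>n. \<sigma> - 1 / real (Suc n) < norm (A (x n))" by metis
    have "A (x n) \<in> closure (A ` cball 0 1)" for n
      using x(1)[of n] by (intro closure_subset[THEN subsetD]) (auto simp: U_def)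
    then obtain y r where r: "strict_mono r" "((\<lambda>n. A (x n)) \<circ> r) \<longlonglongrightarrow> y"
      using cpt unfolding compact_eq_seq_compact_metric seq_compact_def by meson
    define w where "w n = x (r n)" for n
    have w: "w n \<in> V" "norm (w n) = 1" for n using x(1)[of "r n"] by (auto simp: w_def U_def)
    have Aw: "(\<lambda>n. A (w n)) \<longlonglongrightarrow> y" using r(2) by (simp add: o_def w_def)
    have "(\<lambda>n. norm (A (w n))) \<longlonglongrightarrow> \<sigma>"
    proof (rule tendsto_sandwich[OF _ _ _ tendsto_const])
      have "(\<lambda>n. \<sigma> - 1 / real (Suc n)) \<longlonglongrightarrow> \<sigma> - 0"
        by (intro tendsto_intros LIMSEQ_inverse_real_of_nat[unfolded inverse_eq_divide])
      then show "(\<lambda>n. \<sigma> - 1 / real (Suc (r n))) \<longlonglongrightarrow> \<sigma>"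
        using LIMSEQ_subseq_LIMSEQ[OF _ r(1), of "\<lambda>n. \<sigma> - 1 / real (Suc n)" \<sigma>] by (simp add: o_def)
      show "\<forall>\<^sub>F n in sequentially. \<sigma> - 1 / real (Suc (r n)) \<le> norm (A (w n))"
        using x(2) by (intro always_eventually allI) (simp add: w_def less_imp_le)
      show "\<forall>\<^sub>F n in sequentially. norm (A (w n)) \<le> \<sigma>"
        using le[OF w(1)] w(2) by (intro always_eventually allI) (metis mult.right_neutral)
    qed
    note Awn = this
    \<comment> \<open>Parallelogram law for unit vectors: the squared distance is 4 minus
      \<open>(norm (w m + w n))\<^sup>2\<close>, and that term is bounded below through
      \<open>A\<close> and \<open>\<sigma>\<close>. The images are nearly equal and nearly maximal,
      and the resulting defect splits into one part for \<open>m\<close> and one for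
      \<open>n\<close>.\<close>
    let ?e = "\<lambda>i. 2 - 2 * (norm (A (w i)))\<^sup>2 / \<sigma>\<^sup>2 + 2 * (norm (A (w i) - y))\<^sup>2 / \<sigma>\<^sup>2"
    have "Cauchy w"
    proof (rule parallelogram_Cauchy)
      fix m n
      define d where "d i = (norm (A (w i) - y))\<^sup>2" for i
      have par: "(norm (a - b))\<^sup>2 = 2 * (norm a)\<^sup>2 + 2 * (norm b)\<^sup>2 - (norm (a + b))\<^sup>2" for a b :: "'a L2"
        unfolding power2_norm_eq_inner
        by (simp add: inner_add_left inner_add_right inner_diff_left inner_diff_right inner_commute)
      have "w m + w n \<in> V" using w(1)[of m] w(1)[of n] by (simp add: V_def cinner_add_left)
      then have "(norm (A (w m + w n)))\<^sup>2 \<le> (\<sigma> * norm (w m + w n))\<^sup>2"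
        by (intro power_mono le) auto
      then have 1: "(norm (A (w m) + A (w n)))\<^sup>2 \<le> \<sigma>\<^sup>2 * (norm (w m + w n))\<^sup>2"
        by (simp add: A.add power_mult_distrib)
      have "(norm (A (w m) - A (w n)))\<^sup>2 \<le> 2 * d m + 2 * d n"
        using par[of "A (w m) - y" "A (w n) - y"] zero_le_power2[of "norm ((A (w m) - y) + (A (w n) - y))"]
        by (simp add: d_def)
      then have "2 * (norm (A (w m)))\<^sup>2 + 2 * (norm (A (w n)))\<^sup>2 - (2 * d m + 2 * d n) \<le> \<sigma>\<^sup>2 * (norm (w m + w n))\<^sup>2"
        using 1 par[of "A (w m)" "A (w n)"] by linarith
      then have "(2 * (norm (A (w m)))\<^sup>2 + 2 * (norm (A (w n)))\<^sup>2 - (2 * d m + 2 * d n)) / \<sigma>\<^sup>2 \<le> (norm (w m + w n))\<^sup>2"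
        using \<sigma> by (simp add: divide_le_eq mult.commute)
      then show "(norm (w m - w n))\<^sup>2 \<le> ?e m + ?e n"
        using par[of "w m" "w n"] w(2) by (simp add: d_def add_divide_distrib diff_divide_distrib)
    next
      have "?e
          \<longlonglongrightarrow> 2 - 2 * \<sigma>\<^sup>2 / \<sigma>\<^sup>2 + 2 * (norm (y - y))\<^sup>2 / \<sigma>\<^sup>2"
        by (intro tendsto_intros Awn Aw) (use \<sigma> in auto)
      then show "?e \<longlonglongrightarrow> 0"
        using \<sigma> by simp
    qed
    then obtain v where v: "w \<longlonglongrightarrow> v" by (auto simp: convergent_eq_Cauchy[symmetric])
    have "(\<lambda>n. norm (w n)) \<longlonglongrightarrow> norm v" by (intro tendsto_intros v)
    then have nv: "norm v = 1" by (simp add: w(2) LIMSEQ_const_iff)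
    have "cinner v f = 0" if "f \<in> F" for f
    proof -
      have "(\<lambda>n. cinner (w n) f) \<longlonglongrightarrow> cinner v f" by (intro cinner.tendsto v tendsto_const)
      moreover have "cinner (w n) f = 0" for n using w(1)[of n] that by (simp add: V_def)
      ultimately show ?thesis by (simp add: LIMSEQ_const_iff)
    qed
    moreover have "norm (A v) = \<sigma>"
      using LIMSEQ_unique[OF tendsto_norm[OF A.tendsto[OF v]] Awn] .
    ultimately show ?thesis
      using nv le by (intro exI[of _ v]) (auto simp: V_def)
  qed
qed

text \<open>First-order condition at a maximizer: perturbing \<open>v\<close> orthogonally changes
  its norm to second order only, whereas a nonzero \<open>cinner (A x) (A v)\<close> would let the
  norm of the image grow to first order.\<close>

lemma maximizer_orthogonal:
  assumes A: "bounded_clinear A" and v: "norm v = 1" and xv: "cinner x v = 0"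
    and max: "\<And>c. norm (A (v + c *\<^sub>C x)) \<le> norm (A v) * norm (v + c *\<^sub>C x)"
  shows "cinner (A x) (A v) = 0"
proof (rule ccontr)
  assume ne: "cinner (A x) (A v) \<noteq> 0"
  \<comment> \<open>This factor makes the inner product of \<open>A y\<close> and \<open>A v\<close>
    real and positive, so that real multiples of \<open>y\<close> suffice as perturbations.\<close>
  define d where "d = cnj (cinner (A x) (A v))"
  define y where "y = d *\<^sub>C x"
  define D where "D = (cmod d)\<^sup>2"
  have D: "0 < D" using ne by (simp add: D_def d_def)
  have "cinner (A y) (A v) = complex_of_real D"
    by (simp add: y_def D_def d_def bounded_clinearD(2)[OF A] complex_norm_square mult.commute
        del: of_real_power)
  then have iy: "inner (A y) (A v) = D" by (simp add: inner_L2_def)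
  have "cinner y v = 0" using xv by (simp add: y_def)
  then have ivy: "inner v y = 0"
    by (subst inner_commute) (simp add: inner_L2_def)
  define K where "K = (norm (A v) * norm y)\<^sup>2"
  have ineq: "2 * t * D \<le> t\<^sup>2 * K" for t
  proof -
    have ty: "v + (complex_of_real t * d) *\<^sub>C x = v + t *\<^sub>R y"
      by (simp add: y_def scaleC_of_real[symmetric])
    have bl: "A (v + t *\<^sub>R y) = A v + t *\<^sub>R A y"
      by (simp add: scaleC_of_real[symmetric] bounded_clinearD[OF A])
    have "(norm (A v + t *\<^sub>R A y))\<^sup>2 \<le> (norm (A v) * norm (v + t *\<^sub>R y))\<^sup>2"
      using max[of "complex_of_real t * d"] unfolding ty bl by (intro power_mono) auto
    also have "(norm (A v) * norm (v + t *\<^sub>R y))\<^sup>2 = (norm (A v))\<^sup>2 + t\<^sup>2 * K"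
    proof -
      have "(norm (v + t *\<^sub>R y))\<^sup>2 = 1 + t\<^sup>2 * (norm y)\<^sup>2"
      proof -
        have "inner v v = 1" using v power2_norm_eq_inner[of v] by simp
        then show ?thesis
          unfolding power2_norm_eq_inner
          using ivy by (simp add: inner_add_left inner_add_right inner_commute power2_eq_square)
      qed
      then show ?thesis by (simp add: power_mult_distrib K_def distrib_left)
    qed
    also have "(norm (A v + t *\<^sub>R A y))\<^sup>2 = (norm (A v))\<^sup>2 + 2 * t * D + t\<^sup>2 * (norm (A y))\<^sup>2"
      unfolding power2_norm_eq_inner
      by (simp add: inner_add_left inner_add_right inner_commute iy[symmetric] power2_eq_square)
    finally have "2 * t * D + t\<^sup>2 * (norm (A y))\<^sup>2 \<le> t\<^sup>2 * K" by simp
    moreover have "0 \<le> t\<^sup>2 * (norm (A y))\<^sup>2" by simp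
    ultimately show ?thesis by linarith
  qed
  have "K \<noteq> 0" using ineq[of 1] D by auto
  then have K: "0 < K" by (simp add: K_def)
  \<comment> \<open>At \<open>t = D / K\<close> the quadratic term is only half the linear one,
    which contradicts \<open>ineq\<close>.\<close>
  have "2 * (D / K) * D \<le> (D / K)\<^sup>2 * K" by (rule ineq)
  then have "2 * D\<^sup>2 / K \<le> D\<^sup>2 / K" using K by (simp add: power2_eq_square)
  then show False using D K by (simp add: divide_le_cancel)
qed

text \<open>Greedy construction: \<open>e n\<close> maximizes the norm of \<open>A x\<close> among
  unit vectors orthogonal to its predecessors. Maximality makes the values decrease and the images
  orthogonal; normalizing the nonzero images gives \<open>g\<close>.\<close>

lemma singular_value_decomposition:
  fixes A :: "'a::euclidean_space L2 \<Rightarrow> 'a L2" and u :: "nat \<Rightarrow> 'a L2"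
  assumes A: "bounded_clinear A" "orthonormally_null A" and u: "orthonormal u"
  obtains s e g where "\<And>n. 0 \<le> s n" "decseq s" "orthonormal e" "orthonormal g"
    "\<And>n. A (e n) = of_real (s n) *\<^sub>C g n"
    "\<And>\<psi>. (\<lambda>n. (of_real (s n) * cinner \<psi> (e n)) *\<^sub>C g n) sums A \<psi>"
proof -
  define P where "P f n x \<longleftrightarrow> norm x = 1 \<and> (\<forall>k<n. cinner x (f k) = 0) \<and>
      (\<forall>y. (\<forall>k<n. cinner y (f k) = 0) \<longrightarrow> norm (A y) \<le> norm (A x) * norm y)"
    for f :: "nat \<Rightarrow> 'a L2" and n x
  have "\<exists>f. \<forall>n. P f n (f n)"
  proof (rule dependent_wellorder_choice)
    show "P f n x = P g n x" if "\<And>k. k < n \<Longrightarrow> f k = g k" for x f g n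
      using that by (simp add: P_def)
    show "\<exists>x. P f n x" for n f
      using norm_attained[OF compact_operatorI[OF A] _ u, of "f ` {..<n}"] by (auto simp: P_def)
  qed
  then obtain e where e: "\<And>n. P e n (e n)" by blast
  have one: "norm (e n) = 1" for n using e[of n] by (simp add: P_def)
  have ortho: "orthonormal e" using e by (intro orthonormalI) (auto simp: P_def)
  define s where "s n = norm (A (e n))" for n
  have max: "norm (A y) \<le> s n * norm y" if "\<forall>k<n. cinner y (e k) = 0" for n y
    using e[of n] that by (simp add: P_def s_def)
  have dec: "decseq s"
    unfolding decseq_Suc_iff
  proof
    fix n
    have "\<forall>k<n. cinner (e (Suc n)) (e k) = 0" by (simp add: orthonormalD[OF ortho])
    from max[OF this] show "s (Suc n) \<le> s n" by (simp add: s_def one)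
  qed
  have Ae: "cinner (A (e m)) (A (e n)) = 0" if "n < m" for m n
  proof (rule maximizer_orthogonal[OF A(1) one])
    show "cinner (e m) (e n) = 0" using that by (simp add: orthonormalD[OF ortho])
    fix c
    have "\<forall>k<n. cinner (e n + c *\<^sub>C e m) (e k) = 0"
      using that by (simp add: cinner_add_left orthonormalD[OF ortho])
    from max[OF this] show "norm (A (e n + c *\<^sub>C e m)) \<le> norm (A (e n)) * norm (e n + c *\<^sub>C e m)"
      by (simp add: s_def)
  qed
  define g0 where "g0 n = complex_of_real (inverse (s n)) *\<^sub>C A (e n)" for n
  have g0: "orthonormal_on {n. 0 < s n} g0"
    unfolding orthonormal_on_def
  proof (intro ballI)
    fix m n assume "m \<in> {n. 0 < s n}" "n \<in> {n. 0 < s n}"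
    moreover have "cinner (A (e m)) (A (e n)) = 0" if "m \<noteq> n"
      using Ae[of n m] Ae[of m n] cinner_commute[of "A (e m)" "A (e n)"] that by (cases "m < n") auto
    moreover have "norm (g0 n) = 1" if "0 < s n"
      using that by (simp add: g0_def s_def[symmetric] norm_inverse)
    then have "cinner (g0 n) (g0 n) = 1" if "0 < s n"
      using that by (simp add: norm_eq_1_cinner)
    ultimately show "cinner (g0 m) (g0 n) = (if m = n then 1 else 0)"
      by (auto simp: g0_def)
  qed
  \<comment> \<open>the \<open>g n\<close> with \<open>s n = 0\<close> are arbitrary\<close>
  have "\<exists>g. orthonormal g \<and> (\<forall>n. 0 < s n \<longrightarrow> g n = g0 n)"
  proof (cases "\<forall>n. 0 < s n")
    case True
    then show ?thesis using g0 by (intro exI[of _ g0]) (simp add: orthonormal_on_UNIV)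
  next
    case False
    \<comment> \<open>As \<open>s\<close> decreases, its positive values occupy an initial segment,
      so \<open>orthonormal_extend\<close> can supply the remaining \<open>g n\<close>.\<close>
    define N where "N = (LEAST n. \<not> 0 < s n)"
    have N: "\<not> 0 < s N" using False unfolding N_def by (metis LeastI)
    have eq: "{n. 0 < s n} = {..<N}"
    proof (intro set_eqI iffI)
      fix n assume "n \<in> {n. 0 < s n}"
      then show "n \<in> {..<N}" using N decseqD[OF dec, of N n] by (cases "n < N") auto
    next
      fix n assume "n \<in> {..<N}"
      then show "n \<in> {n. 0 < s n}" using not_less_Least[of n "\<lambda>n. \<not> 0 < s n"] by (auto simp: N_def)
    qed
    obtain g where "orthonormal g" "\<forall>n<N. g n = g0 n"
      using orthonormal_extend[OF u, of N g0] g0 unfolding eq by blast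
    moreover have "n < N" if "0 < s n" for n using that eq by blast
    ultimately show ?thesis by blast
  qed
  then obtain g where g: "orthonormal g" "\<And>n. 0 < s n \<Longrightarrow> g n = g0 n" by blast
  have s0: "0 \<le> s n" for n by (simp add: s_def)
  have Aeg: "A (e n) = of_real (s n) *\<^sub>C g n" for n
  proof (cases "s n = 0")
    case True
    then show ?thesis by (simp add: s_def scaleC.zero_left)
  next
    case False
    then have "0 < s n" using s0[of n] by simp
    then show ?thesis using False by (simp add: g(2) g0_def flip: of_real_mult)
  qed
  have slim: "s \<longlonglongrightarrow> 0"
    using A(2) ortho unfolding orthonormally_null_def s_def by (auto intro: tendsto_norm_zero)
  \<comment> \<open>After \<open>m\<close> terms the remainder is \<open>A\<close> applied to a
    vector orthogonal to \<open>e 0\<close>, ..., \<open>e (m - 1)\<close>, where \<open>A\<close>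
    has norm at most \<open>s m\<close>; and \<open>s m\<close> tends to 0.\<close>
  have "(\<lambda>n. (of_real (s n) * cinner \<psi> (e n)) *\<^sub>C g n) sums A \<psi>" for \<psi>
    unfolding sums_def
  proof (rule LIM_zero_cancel, rule tendsto_norm_zero_cancel, rule tendsto_sandwich[OF _ _ tendsto_const])
    let ?S = "\<lambda>m. \<Sum>n<m. (of_real (s n) * cinner \<psi> (e n)) *\<^sub>C g n"
    show "(\<lambda>m. s m * norm \<psi>) \<longlonglongrightarrow> 0" by (rule tendsto_mult_left_zero[OF slim])
    show "\<forall>\<^sub>F m in sequentially. norm (?S m - A \<psi>) \<le> s m * norm \<psi>"
    proof (rule always_eventually, rule allI)
      fix m
      have on: "orthonormal_on {..<m} e" by (rule orthonormal_imp_on[OF ortho])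
      have "A (ortho_proj {..<m} e \<psi>) = ?S m"
        by (simp add: ortho_proj_def bounded_clinearD[OF A(1)] Aeg mult.commute)
      then have "norm (?S m - A \<psi>) =
          norm (A (\<psi> - ortho_proj {..<m} e \<psi>))"
        by (simp add: bounded_clinearD(4)[OF A(1)] norm_minus_commute)
      also have "\<dots> \<le> s m * norm (\<psi> - ortho_proj {..<m} e \<psi>)"
        by (rule max) (use cinner_ortho_proj[OF on] in auto)
      also have "\<dots> \<le> s m * norm \<psi>"
        by (intro mult_left_mono norm_diff_ortho_proj_le on s0) simp
      finally show "norm (?S m - A \<psi>) \<le> s m * norm \<psi>" .
    qed
  qed simp
  then show thesis by (rule that[OF s0 dec ortho g(1) Aeg])
qed

text \<open>Evaluating the functional on the singular systems of \<open>A\<close> with extremal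
  weights returns the p-norm of the first \<open>N\<close> singular values, so \<open>M\<close>
  bounds it uniformly in \<open>N\<close>.\<close>

lemma schatten_imp_schatten_class:
  fixes A :: "'a::euclidean_space L2 \<Rightarrow> 'a L2" and u :: "nat \<Rightarrow> 'a L2"
  assumes p: "1 \<le> p" and A: "schatten p A" and u: "orthonormal u"
  shows "A \<in> schatten_class p"
proof -
  from A obtain M where cl: "bounded_clinear A" "orthonormally_null A" and M: "schatten_le p M A"
    by (auto simp: schatten_def)
  obtain s e g where s: "\<And>n. 0 \<le> s n" "decseq s" and e: "orthonormal e" and g: "orthonormal g"
    and Ae: "\<And>n. A (e n) = of_real (s n) *\<^sub>C g n"
    and sums: "\<And>\<psi>. (\<lambda>n. (of_real (s n) * cinner \<psi> (e n)) *\<^sub>C g n) sums A \<psi>"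
    using singular_value_decomposition[OF cl u] by blast
  have "(\<Sum>n<N. s n powr p) \<le> M powr p" for N
  proof (cases "(\<Sum>n<N. s n powr p) = 0")
    case False
    define C where "C = (\<Sum>n<N. s n powr p)"
    have C: "0 < C" using False sum_nonneg[of "{..<N}" "\<lambda>n. s n powr p"] by (simp add: C_def less_le)
    define b where "b n = s n powr (p - 1) / C powr (1 - 1 / p)" for n
    have b: "dual_weights p N b" "(\<Sum>n<N. b n * s n) = C powr (1 / p)"
      using dual_weights_extremal[OF p s(1) C_def C] by (simp_all add: b_def[abs_def])
    have "(weighted_trace N b e g A) = complex_of_real (C powr (1 / p))"
      unfolding b(2)[symmetric] by (simp add: Ae orthonormalD[OF g])
    then have "C powr (1 / p) \<le> M"
      using schatten_leD[OF M e g b(1)] by simp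
    then have "(C powr (1 / p)) powr p \<le> M powr p" using p by (intro powr_mono2) auto
    then show ?thesis using C p by (simp add: powr_powr C_def)
  qed simp
  then have "summable (\<lambda>n. s n powr p)"
    by (intro summableI_nonneg_bounded[of _ "M powr p"]) auto
  then show ?thesis
    unfolding schatten_class_def singular_values_def
    using compact_operatorI[OF cl] s e g sums by blast
qed

section \<open>From singular values to dual bounds, and continuity of translates\<close>

lemma tf_shift_tendsto_0: "((\<lambda>z. tf_shift z x) \<longlongrightarrow> x) (nhds 0)"
proof -
  have "continuous_on UNIV (\<lambda>z. tf_shift z x)"
    by (auto simp: continuous_on_sequentially o_def intro: tf_shift_strongly_continuous)
  then have "isCont (\<lambda>z. tf_shift z x) 0" 
    using continuous_on_eq_continuous_at[OF open_UNIV] by blast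
  then show ?thesis
    by (simp add: continuous_at tendsto_nhds_iff tf_shift_zero)
qed

text \<open>All three claims come from one singular value expansion and its truncations. The
  remainder \<open>R N\<close> is bounded by the p-norm of the tail of \<open>s\<close>, which tends
  to 0 by summability; this reduces compactness and continuity of translates to finite rank.\<close>

lemma
  fixes A :: "'a::euclidean_space L2 \<Rightarrow> 'a L2"
  assumes p: "1 \<le> p" and A: "A \<in> schatten_class p"
  shows schatten_class_imp_schatten: "schatten p A"
    and ex_orthonormal: "\<exists>u :: nat \<Rightarrow> 'a L2. orthonormal u"
    and op_translate_continuous: "\<And>eps. 0 < eps \<Longrightarrow> \<forall>\<^sub>F z in nhds 0. schatten_le p eps (\<lambda>\<psi>. op_translate z A \<psi> - A \<psi>)"
proof -
  from A have cl: "bounded_clinear A" by (simp add: schatten_class_def compact_operator_def)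
  from A obtain s where "singular_values A s" and sp: "summable (\<lambda>n. s n powr p)"
    by (auto simp: schatten_class_def)
  then obtain e g where s: "\<And>n. 0 \<le> s n" and e: "orthonormal e" and g: "orthonormal g"
    and sums: "\<And>\<psi>. (\<lambda>n. (of_real (s n) * cinner \<psi> (e n)) *\<^sub>C g n) sums A \<psi>"
    by (auto simp: singular_values_def)
  define R where "R N \<psi> = A \<psi> - svd_sum s e g {..<N} \<psi>" for N \<psi>
  have tail: "schatten_le p ((\<Sum>n. s (n + N) powr p) powr (1 / p)) (R N)" for N
  proof (rule schatten_le_limit)
    show "(\<lambda>m. svd_sum s e g {N..<N + m} \<psi>) \<longlonglongrightarrow> R N \<psi>" for \<psi>
    proof -
      let ?f = "\<lambda>n. (of_real (s n) * cinner \<psi> (e n)) *\<^sub>C g n"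
      have "(\<lambda>m. \<Sum>n<m. ?f (n + N)) \<longlonglongrightarrow> A \<psi> - (\<Sum>n<N. ?f n)"
        using sums_split_initial_segment[OF sums[of \<psi>], of N] by (simp add: sums_def)
      moreover have "(\<Sum>n<m. ?f (n + N)) = (\<Sum>n\<in>{N..<N + m}. ?f n)" for m
        using sum.shift_bounds_nat_ivl[of ?f 0 N m] by (simp add: atLeast0LessThan add.commute)
      ultimately show ?thesis by (simp add: R_def svd_sum_def)
    qed
    have "summable (\<lambda>n. s (n + N) powr p)" using sp by (rule summable_ignore_initial_segment)
    then have "(\<Sum>n<m. s (n + N) powr p) \<le> (\<Sum>n. s (n + N) powr p)" for m
      by (rule sum_le_suminf) auto
    moreover have "(\<Sum>n<m. s (n + N) powr p) = (\<Sum>n\<in>{N..<N + m}. s n powr p)" for m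
      using sum.shift_bounds_nat_ivl[of "\<lambda>n. s n powr p" 0 N m] by (simp add: atLeast0LessThan add.commute)
    ultimately show "\<forall>\<^sub>F m in sequentially.
        schatten_le p ((\<Sum>n. s (n + N) powr p) powr (1 / p)) (svd_sum s e g {N..<N + m})"
      by (intro always_eventually allI schatten_le_svd_sum p s e g) simp_all
  qed
  have tail_small: "\<exists>N. schatten_le p eps (R N)" if "0 < eps" for eps
  proof -
    have "0 < eps powr p" using that by simp
    with suminf_exist_split[OF _ sp] obtain N where "norm (\<Sum>n. s (n + N) powr p) < eps powr p" by blast
    then have "(\<Sum>n. s (n + N) powr p) powr (1 / p) \<le> (eps powr p) powr (1 / p)"
      using p sp by (intro powr_mono2) (auto intro!: suminf_nonneg summable_ignore_initial_segment)
    also have "\<dots> = eps" using p that by (simp add: powr_powr)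
    finally show ?thesis using schatten_le_mono[OF tail] by blast
  qed
  have clS: "bounded_clinear (svd_sum s e g {..<N})" for N
  proof (induction N)
    case 0
    then show ?case using bounded_clinear_zero by (simp add: svd_sum_def[abs_def])
  next
    case (Suc N)
    have "bounded_clinear (\<lambda>\<psi>. cinner \<psi> (e N) *\<^sub>C g N)"
      using norm_cinner_le[of _ "e N"]
      by (intro bounded_clinearI[of _ 1])
        (simp_all add: cinner_add_left scaleC_add_left norm_orthonormal e g)
    from bounded_clinear_combine[OF Suc this, of "complex_of_real (s N)"]
    show ?case by (simp add: svd_sum_def[abs_def])
  qed
  have clR: "bounded_clinear (R N)" for N
    using bounded_clinear_combine[OF cl clS[of N], of "-1"]
    by (simp add: R_def[abs_def] scaleC.minus_left)
  have "orthonormally_null A"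
  proof (rule orthonormally_null_approx)
    fix eps :: real assume "0 < eps"
    then obtain N where N: "schatten_le p eps (R N)" using tail_small by blast
    show "\<exists>B. orthonormally_null B \<and> (\<forall>x. norm (A x - B x) \<le> eps * norm x)"
      using schatten_le_norm[OF N clR e] orthonormally_null_svd_sum[of "{..<N}" s e g]
      by (intro exI[of _ "svd_sum s e g {..<N}"]) (simp add: R_def)
  qed
  moreover have "schatten_le p ((\<Sum>n. s (n + 0) powr p) powr (1 / p)) A"
    using tail[of 0] by (simp add: R_def[abs_def] svd_sum_def)
  ultimately show "schatten p A" using cl unfolding schatten_def by blast
  show "\<exists>u :: nat \<Rightarrow> 'a L2. orthonormal u" using e by blast
  fix eps :: real assume eps: "0 < eps"
  \<comment> \<open>The remainder is counted twice, translated and untranslated; this leaves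
    \<open>eps / 2\<close> for the finite rank part.\<close>
  obtain N where N: "schatten_le p (eps / 4) (R N)" using tail_small[of "eps / 4"] eps by auto
  define h where "h z = (\<Sum>k<N. s k * (norm (tf_shift z (e k)) * norm (tf_shift z (g k) - g k) +
      norm (tf_shift z (e k) - e k) * norm (g k)))" for z
  have "(h \<longlongrightarrow> (\<Sum>k<N. s k * (norm (e k) * norm (g k - g k) + norm (e k - e k) * norm (g k)))) (nhds 0)"
    unfolding h_def by (intro tendsto_intros tf_shift_tendsto_0)
  then have "(h \<longlongrightarrow> 0) (nhds 0)" by simp
  then have "\<forall>\<^sub>F z in nhds 0. h z < eps / 2" using eps by (intro order_tendstoD) auto
  then show "\<forall>\<^sub>F z in nhds 0. schatten_le p eps (\<lambda>\<psi>. op_translate z A \<psi> - A \<psi>)"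
  proof eventually_elim
    case (elim z)
    \<comment> \<open>Translating a rank one operator shifts both its vectors. Changing one vector
      at a time writes the difference as two rank one operators, each with a small factor.\<close>
    let ?D = "\<lambda>\<psi>. \<Sum>k<N. of_real (s k) *\<^sub>C
        (cinner \<psi> (tf_shift z (e k)) *\<^sub>C (tf_shift z (g k) - g k) +
         cinner \<psi> (tf_shift z (e k) - e k) *\<^sub>C g k)"
    have "schatten_le p (\<Sum>k<N. cmod (complex_of_real (s k)) * (norm (tf_shift z (e k)) * norm (tf_shift z (g k) - g k) +
      norm (tf_shift z (e k) - e k) * norm (g k))) ?D"
      by (intro schatten_le_sum schatten_le_scaleC schatten_le_add schatten_le_rank_one p)
    then have D: "schatten_le p (eps / 2) ?D"
      by (rule schatten_le_mono) (use elim s in \<open>simp add: h_def\<close>)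
    have tr: "op_translate z (svd_sum s e g {..<N}) \<psi> =
        (\<Sum>k<N. (of_real (s k) * cinner \<psi> (tf_shift z (e k))) *\<^sub>C tf_shift z (g k))" for \<psi>
    proof -
      have "cinner (tf_adj z \<psi>) x = cinner \<psi> (tf_shift z x)" for x
        using cinner_tf_shift[of z "tf_adj z \<psi>" x] by (simp add: tf_shift_cadjoint)
      then show ?thesis
        by (simp add: op_translate_def svd_sum_def bounded_clinearD[OF bounded_clinear_tf_shift])
    qed
    have "op_translate z A \<psi> - A \<psi> = ?D \<psi> + (op_translate z (R N) \<psi> - R N \<psi>)" for \<psi>
    proof -
      have "op_translate z (R N) \<psi> = op_translate z A \<psi> - op_translate z (svd_sum s e g {..<N}) \<psi>"
        by (simp add: op_translate_def R_def bounded_clinearD[OF bounded_clinear_tf_shift])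
      then have "op_translate z A \<psi> - A \<psi> = (op_translate z (R N) \<psi> - R N \<psi>) +
          (op_translate z (svd_sum s e g {..<N}) \<psi> - svd_sum s e g {..<N} \<psi>)"
        by (simp add: R_def)
      also have "op_translate z (svd_sum s e g {..<N}) \<psi> - svd_sum s e g {..<N} \<psi> = ?D \<psi>"
        unfolding tr svd_sum_def sum_subtractf[symmetric]
        by (intro sum.cong refl)
           (simp add: cinner.diff_right scaleC_add_right scaleC.diff_right scaleC.diff_left right_diff_distrib)
      finally show ?thesis by simp
    qed
    moreover have "schatten_le p (eps / 2 + (eps / 4 + eps / 4)) (\<lambda>\<psi>. ?D \<psi> + (op_translate z (R N) \<psi> - R N \<psi>))"
      by (intro schatten_le_add[OF D] schatten_le_diff schatten_le_op_translate N)
    ultimately show ?case by simp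
  qed
qed

section \<open>Factorization\<close>

lemma op_convolution_combine:
  assumes A: "bounded_clinear A" and B: "bounded_clinear B" and f: "integrable lborel f"
  shows "(f \<star> (\<lambda>\<psi>. A \<psi> + c *\<^sub>C B \<psi>)) \<psi> = (f \<star> A) \<psi> + c *\<^sub>C (f \<star> B) \<psi>"
proof (rule cinner_eqI)
  fix \<phi>
  have "tf_coeff (\<lambda>\<psi>. A \<psi> + c *\<^sub>C B \<psi>) \<psi> \<phi> z = tf_coeff A \<psi> \<phi> z + c * tf_coeff B \<psi> \<phi> z" for z
    by (simp add: tf_coeff_def cinner_add_left)
  then show "cinner ((f \<star> (\<lambda>\<psi>. A \<psi> + c *\<^sub>C B \<psi>)) \<psi>) \<phi> = cinner ((f \<star> A) \<psi> + c *\<^sub>C (f \<star> B) \<psi>) \<phi>"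
    using integrable_tf_coeff[OF A f, of \<psi> \<phi>] integrable_tf_coeff[OF B f, of \<psi> \<phi>]
    by (simp add: cinner_op_convolution[OF bounded_clinear_combine[OF A B] f] cinner_op_convolution[OF A f]
        cinner_op_convolution[OF B f] cinner_add_left distrib_left mult.left_commute[of _ c])
qed

lemma op_convolution_combine_left:
  assumes A: "bounded_clinear A" and f: "integrable lborel f" and g: "integrable lborel g"
  shows "((\<lambda>z. f z + c * g z) \<star> A) \<psi> = (f \<star> A) \<psi> + c *\<^sub>C (g \<star> A) \<psi>"
proof (rule cinner_eqI)
  fix \<phi>
  have fg: "integrable lborel (\<lambda>z. f z + c * g z)" using f g by simp
  show "cinner (((\<lambda>z. f z + c * g z) \<star> A) \<psi>) \<phi> = cinner ((f \<star> A) \<psi> + c *\<^sub>C (g \<star> A) \<psi>) \<phi>"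
    using integrable_tf_coeff[OF A f, of \<psi> \<phi>] integrable_tf_coeff[OF A g, of \<psi> \<phi>]
    by (simp add: cinner_op_convolution[OF A fg] cinner_op_convolution[OF A f]
        cinner_op_convolution[OF A g] cinner_add_left distrib_right mult.assoc)
qed

lemma op_convolution_sum:
  assumes A: "\<And>n. bounded_clinear (A n)" and f: "integrable lborel f"
  shows "bounded_clinear (\<lambda>\<psi>. \<Sum>n<N. A n \<psi>) \<and>
    (\<forall>\<psi>. (f \<star> (\<lambda>\<psi>. \<Sum>n<N. A n \<psi>)) \<psi> = (\<Sum>n<(N::nat). (f \<star> A n) \<psi>))"
proof (induction N)
  case 0
  have "(f \<star> (\<lambda>\<psi>. 0)) \<psi> = 0" for \<psi> :: "'a L2"
    by (rule cinner_eqI)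
       (simp add: cinner_op_convolution[OF bounded_clinear_zero f] tf_coeff_def cinner.zero_left)
  then show ?case by (simp add: bounded_clinear_zero)
next
  case (Suc N)
  then show ?case
    using bounded_clinear_combine[OF conjunct1[OF Suc] A, of 1 N]
      op_convolution_combine[OF conjunct1[OF Suc] A f, of 1 N] by simp
qed

text \<open>Convolution with \<open>f\<close> increases a norm bound at most by the L1 norm of
  \<open>f\<close>, so tail bounds carry over to the convolved series.\<close>

lemma op_convolution_sums:
  fixes A :: "nat \<Rightarrow> 'a::euclidean_space L2 \<Rightarrow> 'a L2" and u :: "nat \<Rightarrow> 'a L2"
  assumes A: "\<And>n. bounded_clinear (A n)" and B: "bounded_clinear B" and f: "integrable lborel f"
    and M: "summable M" "\<And>N. schatten_le p (\<Sum>n. M (n + N)) (\<lambda>\<psi>. B \<psi> - (\<Sum>n<N. A n \<psi>))"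
    and u: "orthonormal u"
  shows "(\<lambda>n. (f \<star> A n) \<psi>) sums (f \<star> B) \<psi>"
  unfolding sums_def
proof (rule LIM_zero_cancel, rule tendsto_norm_zero_cancel, rule tendsto_sandwich[OF _ _ tendsto_const])
  let ?t = "\<lambda>N. \<Sum>n. M (n + N)"
  have "?t \<longlonglongrightarrow> 0" by (rule suminf_exist_split2[OF M(1)])
  then show "(\<lambda>N. (LINT z|lborel. cmod (f z)) * ?t N * norm \<psi>) \<longlonglongrightarrow> 0"
    by (intro tendsto_mult_left_zero tendsto_mult_right_zero)
  show "\<forall>\<^sub>F N in sequentially. norm ((\<Sum>n<N. (f \<star> A n) \<psi>) - (f \<star> B) \<psi>) \<le> (LINT z|lborel. cmod (f z)) * ?t N * norm \<psi>"
  proof (rule always_eventually, rule allI)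
    fix N
    let ?S = "\<lambda>\<psi>. \<Sum>n<N. A n \<psi>"
    have S: "bounded_clinear ?S" "(f \<star> ?S) \<psi> = (\<Sum>n<N. (f \<star> A n) \<psi>)"
      using op_convolution_sum[OF A f, where N=N] by auto
    have eq: "(\<lambda>\<psi>. B \<psi> - ?S \<psi>) = (\<lambda>\<psi>. B \<psi> + (-1) *\<^sub>C ?S \<psi>)"
      by (simp add: scaleC.minus_left)
    have D: "bounded_clinear (\<lambda>\<psi>. B \<psi> - ?S \<psi>)"
      unfolding eq by (rule bounded_clinear_combine[OF B S(1)])
    have "(f \<star> (\<lambda>\<psi>. B \<psi> - ?S \<psi>)) \<psi> = (f \<star> B) \<psi> - (\<Sum>n<N. (f \<star> A n) \<psi>)"
      unfolding eq op_convolution_combine[OF B S(1) f] S(2) by (simp add: scaleC.minus_left)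
    moreover have "norm ((f \<star> (\<lambda>\<psi>. B \<psi> - ?S \<psi>)) \<psi>) \<le> (LINT z|lborel. cmod (f z)) * ?t N * norm \<psi>"
      by (intro norm_op_convolution_le D f schatten_le_nonneg[OF M(2) u]
          schatten_le_norm[OF M(2) D u])
    ultimately show "norm ((\<Sum>n<N. (f \<star> A n) \<psi>) - (f \<star> B) \<psi>) \<le> (LINT z|lborel. cmod (f z)) * ?t N * norm \<psi>"
      by (simp add: norm_minus_commute)
  qed
qed simp

text \<open>Solves for the correction \<open>D = S' - S\<close> instead of \<open>S'\<close>: the
  equation \<open>3/4 S' + 1/4 (k \<star> S') = S\<close> becomes the one stated, with
  \<open>E = S - k \<star> S\<close>. Smallness of \<open>E\<close> thus passes to \<open>D\<close>
  directly, as the powers of 1/3 from exponent 1 on sum to 1/2.\<close>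

lemma Neumann_step:
  fixes E :: "'a::euclidean_space L2 \<Rightarrow> 'a L2" and u :: "nat \<Rightarrow> 'a L2"
  assumes E: "schatten p E" "schatten_le p eps E"
    and k: "integrable lborel k" "(LINT z|lborel. cmod (k z)) = 1" and u: "orthonormal u"
  shows "\<exists>D. schatten p D \<and> schatten_le p (eps / 2) D \<and>
    (\<forall>\<psi>. D \<psi> + (1/3) *\<^sub>C (k \<star> D) \<psi> = (1/3) *\<^sub>C E \<psi>)"
proof -
  \<comment> \<open>\<open>B n\<close> is the n-th Neumann term: \<open>-1/3\<close> times
    convolution with \<open>k\<close>, applied n times to a third of \<open>E\<close>.\<close>
  define B where "B = rec_nat (\<lambda>\<psi>. (1/3) *\<^sub>C E \<psi>) (\<lambda>_ X \<psi>. (- (1/3)) *\<^sub>C (k \<star> X) \<psi>)"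
  have B0: "B 0 = (\<lambda>\<psi>. (1/3) *\<^sub>C E \<psi>)" and BS: "B (Suc n) = (\<lambda>\<psi>. (- (1/3)) *\<^sub>C (k \<star> B n) \<psi>)" for n
    by (simp_all add: B_def)
  have scale: "schatten p (\<lambda>\<psi>. c *\<^sub>C X \<psi>)" if "schatten p X" for c and X :: "'a L2 \<Rightarrow> 'a L2"
    using schatten_combine[OF schatten_zero that, of c] by simp
  have sB: "schatten p (B n)" for n
    by (induction n) (auto simp: B0 BS intro!: scale E schatten_op_convolution k)
  then have clB: "bounded_clinear (B n)" for n by (simp add: schatten_def)
  have nB: "schatten_le p (eps * (1/3) ^ Suc n) (B n)" for n
  proof (induction n)
    case 0
    show ?case using schatten_le_scaleC[OF E(2), of "1/3"] by (simp add: B0 mult.commute)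
  next
    case (Suc n)
    show ?case
      using schatten_le_scaleC[OF schatten_le_op_convolution[OF Suc clB k(1)], of "- (1/3)"]
      by (simp add: BS k(2) mult_ac)
  qed
  have geo: "(\<lambda>n. eps * (1/3) ^ Suc n) sums (eps / 2)"
    using sums_mult[OF geometric_sums[of "1/3::real"], of "eps / 3"] by simp
  obtain D where D: "schatten p D" "\<And>\<psi>. (\<lambda>n. B n \<psi>) sums D \<psi>"
    "\<And>N. schatten_le p (\<Sum>n. eps * (1/3) ^ Suc (n + N)) (\<lambda>\<psi>. D \<psi> - (\<Sum>n<N. B n \<psi>))"
    using schatten_series[OF sB nB sums_summable[OF geo] u] by auto
  have clD: "bounded_clinear D" using D(1) by (simp add: schatten_def)
  have "D \<psi> + (1/3) *\<^sub>C (k \<star> D) \<psi> = (1/3) *\<^sub>C E \<psi>" for \<psi>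
  proof -
    have "(\<lambda>n. (k \<star> B n) \<psi>) sums (k \<star> D) \<psi>"
      by (rule op_convolution_sums[OF clB clD k(1) sums_summable[OF geo] D(3) u])
    from bounded_linear.sums[OF scaleC.bounded_linear_right this, of "- (1/3)"]
    have "(\<lambda>n. B (Suc n) \<psi>) sums ((- (1/3)) *\<^sub>C (k \<star> D) \<psi>)" by (simp add: BS)
    moreover have "(\<lambda>n. B (Suc n) \<psi>) sums (D \<psi> - B 0 \<psi>)"
      using D(2)[of \<psi>] by (subst sums_Suc_iff) simp
    ultimately have "(- (1/3)) *\<^sub>C (k \<star> D) \<psi> = D \<psi> - B 0 \<psi>" by (rule sums_unique2)
    then show ?thesis by (simp add: B0 scaleC.minus_left algebra_simps)
  qed
  moreover have "schatten_le p (eps / 2) D"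
    using D(3)[of 0]
    by (simp only: sums_unique[OF geo, symmetric] add_0_right lessThan_0 sum.empty diff_zero)
  ultimately show ?thesis using D(1) by blast
qed

text \<open>A single kernel must serve the operator and the function at once; the normalized
  indicator of a ball does, with the radius small enough for both continuity statements.\<close>

lemma approximate_identity:
  fixes A :: "'a::euclidean_space L2 \<Rightarrow> 'a L2" and f :: "'a \<times> 'a \<Rightarrow> complex"
  assumes p: "1 \<le> p" and A: "A \<in> schatten_class p" and f: "integrable lborel f" and eps: "0 < eps"
  shows "\<exists>k :: 'a \<times> 'a \<Rightarrow> complex. integrable lborel k \<and> (LINT z|lborel. cmod (k z)) = 1 \<and>
    schatten_le p eps (\<lambda>\<psi>. (k \<star> A) \<psi> - A \<psi>) \<and>
    (LINT z|lborel. cmod (L1_convolution k f z - f z)) \<le> eps"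
proof -
  let ?h = "\<lambda>w. LINT z|lborel. cmod (f (z - w) - f z)"
  have "(?h \<longlongrightarrow> 0) (at 0)"
    unfolding tendsto_at_iff_sequentially
    using integrable_L1_shift_continuous[OF f] by (auto simp: L1_shift_continuous_def o_def)
  then have "(?h \<longlongrightarrow> 0) (nhds 0)" by (simp add: tendsto_nhds_iff)
  then have "\<forall>\<^sub>F w in nhds 0. ?h w < eps" using eps by (rule order_tendstoD)
  with op_translate_continuous[OF p A eps]
  have "\<forall>\<^sub>F z in nhds 0. schatten_le p eps (\<lambda>\<psi>. op_translate z A \<psi> - A \<psi>) \<and> ?h z < eps"
    by (rule eventually_conj)
  then obtain r where r: "0 < r"
    "\<And>z. dist z 0 < r \<Longrightarrow> schatten_le p eps (\<lambda>\<psi>. op_translate z A \<psi> - A \<psi>) \<and> ?h z < eps"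
    unfolding eventually_nhds_metric by blast
  define m where "m = measure lborel (ball (0 :: 'a \<times> 'a) r)"
  have m: "0 < m" using r(1) content_ball_pos[of r "0 :: 'a \<times> 'a"] by (simp add: m_def)
  define kr :: "'a \<times> 'a \<Rightarrow> real" where "kr z = indicator (ball 0 r) z / m" for z
  define k where "k z = complex_of_real (kr z)" for z
  have kr: "integrable lborel kr" "(LINT z|lborel. kr z) = 1"
    using m emeasure_bounded_finite[of "ball (0 :: 'a \<times> 'a) r"]
    by (simp_all add: kr_def[abs_def] m_def integrable_indicator_iff)
  have k: "integrable lborel k" "(LINT z|lborel. k z) = 1"
    using kr by (simp_all add: k_def[abs_def])
  have "0 \<le> kr z" for z using m by (simp add: kr_def)
  then have "cmod (k z) = kr z" for z by (simp add: k_def)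
  then have k1: "(LINT z|lborel. cmod (k z)) = 1" using kr by simp
  have supp: "dist z 0 < r" if "k z \<noteq> 0" for z
    using that by (auto simp: k_def kr_def indicator_def dist_commute split: if_splits)
  have clA: "bounded_clinear A" using A by (simp add: schatten_class_def compact_operator_def)
  have "schatten_le p (1 * eps) (\<lambda>\<psi>. (k \<star> A) \<psi> - A \<psi>)"
    unfolding k1[symmetric]
    by (rule schatten_le_approximate_identity[OF clA k]) (use eps r(2) supp in auto)
  moreover have "(LINT z|lborel. cmod (L1_convolution k f z - f z)) \<le> 1 * eps"
    unfolding k1[symmetric]
    by (rule norm_L1_convolution_diff_le[OF k(1) f k(2)]) (use r(2) supp in \<open>auto intro: less_imp_le\<close>)
  ultimately show ?thesis using k(1) k1 by auto
qed

text \<open>The L1 counterpart of \<open>summable_L2\<close>: the sum of the moduli is integrable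
  and dominates the partial sums.\<close>

lemma L1_series:
  fixes g :: "nat \<Rightarrow> 'b \<Rightarrow> 'c::{banach, second_countable_topology}"
  assumes g: "\<And>n. integrable M (g n)" and sum: "summable (\<lambda>n. LINT x|M. norm (g n x))"
  shows "\<exists>f. integrable M f \<and> (\<lambda>N. LINT x|M. norm (f x - (\<Sum>n<N. g n x))) \<longlonglongrightarrow> 0"
proof -
  note [measurable] = borel_measurable_integrable[OF g]
  have "(\<integral>\<^sup>+x. (\<Sum>n. ennreal (norm (g n x))) \<partial>M) = (\<Sum>n. \<integral>\<^sup>+x. ennreal (norm (g n x)) \<partial>M)"
    by (rule nn_integral_suminf) measurable
  also have "\<dots> = (\<Sum>n. ennreal (LINT x|M. norm (g n x)))"
  proof (rule suminf_cong)
    show "(\<integral>\<^sup>+x. ennreal (norm (g n x)) \<partial>M) = ennreal (LINT x|M. norm (g n x))" for n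
      by (rule nn_integral_eq_integral) (use g in auto)
  qed
  also have "\<dots> \<noteq> \<infinity>"
    unfolding infinity_ennreal_def by (rule ennreal_suminf_neq_top[OF sum]) simp
  finally have fin: "(\<integral>\<^sup>+x. (\<Sum>n. ennreal (norm (g n x))) \<partial>M) \<noteq> \<infinity>" .
  have "AE x in M. (\<Sum>n. ennreal (norm (g n x))) \<noteq> \<infinity>"
    by (rule nn_integral_PInf_AE[OF _ fin]) measurable
  then have AE: "AE x in M. summable (\<lambda>n. norm (g n x))"
  proof eventually_elim
    case (elim x)
    then show ?case by (intro summable_suminf_not_top) simp_all
  qed
  define f where "f x = (\<Sum>n. g n x)" for x
  define w where "w x = (\<Sum>n. norm (g n x))" for x
  have f: "integrable M f"
    unfolding f_def by (rule integrable_suminf[OF g AE sum])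
  have w: "integrable M w"
    unfolding w_def
  proof (rule integrable_suminf)
    show "integrable M (\<lambda>x. norm (g n x))" for n using g by simp
    show "AE x in M. summable (\<lambda>n. norm (norm (g n x)))" using AE by simp
    show "summable (\<lambda>n. LINT x|M. norm (norm (g n x)))" using sum by simp
  qed
  have "(\<lambda>N. LINT x|M. norm (f x - (\<Sum>n<N. g n x))) \<longlonglongrightarrow> (LINT x|M. (0::real))"
  proof (rule integral_dominated_convergence[where w="\<lambda>x. 2 * w x"])
    show "AE x in M. (\<lambda>N. norm (f x - (\<Sum>n<N. g n x))) \<longlonglongrightarrow> 0"
      using AE
    proof eventually_elim
      case (elim x)
      have "(\<lambda>N. norm (f x - (\<Sum>n<N. g n x))) \<longlonglongrightarrow> norm (f x - f x)"
        unfolding f_def by (intro tendsto_intros summable_LIMSEQ summable_norm_cancel[OF elim])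
      then show ?case by simp
    qed
    show "AE x in M. norm (norm (f x - (\<Sum>n<N. g n x))) \<le> 2 * w x" for N
      using AE
    proof eventually_elim
      case (elim x)
      have "norm (f x) \<le> w x" unfolding f_def w_def by (rule summable_norm[OF elim])
      moreover have "norm (\<Sum>n<N. g n x) \<le> (\<Sum>n<N. norm (g n x))" by (rule norm_sum)
      moreover have "(\<Sum>n<N. norm (g n x)) \<le> w x"
        unfolding w_def by (rule sum_le_suminf[OF elim]) auto
      ultimately show ?case
        using norm_triangle_ineq4[of "f x" "\<Sum>n<N. g n x"] by simp
    qed
  qed (use f w in auto)
  with f show ?thesis by auto
qed

text \<open>Substituting \<open>S = 3/4 S' + 1/4 (k \<star> S')\<close> moves \<open>k\<close> onto
  \<open>f\<close> by associativity and onto the remainder \<open>a S\<close>, of which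
  \<open>a / 4\<close> becomes part of the new function. Since \<open>f' - f\<close> equals
  \<open>1/4 (k * f - f) + a / 4 k\<close>, the bound \<open>eps + a\<close> is generous;
  summability over all steps is what counts.\<close>

lemma factorization_step:
  fixes T S :: "'a::euclidean_space L2 \<Rightarrow> 'a L2" and u :: "nat \<Rightarrow> 'a L2" and f :: "'a \<times> 'a \<Rightarrow> complex"
  assumes p: "1 \<le> p" and u: "orthonormal u" and eps: "0 < eps" and a: "0 \<le> a"
    and f: "integrable lborel f" and S: "schatten p S"
    and T: "\<And>\<psi>. T \<psi> = (f \<star> S) \<psi> + of_real a *\<^sub>C S \<psi>"
  shows "\<exists>f' S'. integrable lborel f' \<and> schatten p S' \<and>
    (\<forall>\<psi>. T \<psi> = (f' \<star> S') \<psi> + of_real (3/4 * a) *\<^sub>C S' \<psi>) \<and>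
    (LINT z|lborel. cmod (f' z - f z)) \<le> eps + a \<and> schatten_le p eps (\<lambda>\<psi>. S' \<psi> - S \<psi>)"
proof -
  obtain k :: "'a \<times> 'a \<Rightarrow> complex" where k: "integrable lborel k" "(LINT z|lborel. cmod (k z)) = 1"
    and kS: "schatten_le p eps (\<lambda>\<psi>. (k \<star> S) \<psi> - S \<psi>)"
    and kf: "(LINT z|lborel. cmod (L1_convolution k f z - f z)) \<le> eps"
    using approximate_identity[OF p schatten_imp_schatten_class[OF p S u] f eps] by blast
  define E where "E \<psi> = S \<psi> + (-1) *\<^sub>C (k \<star> S) \<psi>" for \<psi>
  have sE: "schatten p E"
    unfolding E_def[abs_def] by (rule schatten_combine[OF S schatten_op_convolution[OF S k(1)]])
  have nE: "schatten_le p eps E"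
    using schatten_le_scaleC[OF kS, of "-1"]
    by (simp add: E_def[abs_def] scaleC.minus_left)
  obtain D where D: "schatten p D" "schatten_le p (eps / 2) D"
    and DE: "\<And>\<psi>. D \<psi> + (1/3) *\<^sub>C (k \<star> D) \<psi> = (1/3) *\<^sub>C E \<psi>"
    using Neumann_step[OF sE nE k u] by blast
  define S' where "S' \<psi> = S \<psi> + 1 *\<^sub>C D \<psi>" for \<psi>
  have S': "schatten p S'" unfolding S'_def[abs_def] by (rule schatten_combine[OF S D(1)])
  have cl: "bounded_clinear S" "bounded_clinear D" "bounded_clinear S'"
    using S D(1) S' by (simp_all add: schatten_def)
  have clk: "bounded_clinear (k \<star> S')" by (rule bounded_clinear_conv[OF cl(3) k(1)])
  have S_eq: "S \<psi> = (3/4) *\<^sub>C (S' \<psi> + (1/3) *\<^sub>C (k \<star> S') \<psi>)" for \<psi>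
  proof -
    have "(k \<star> S') \<psi> = (k \<star> S) \<psi> + (k \<star> D) \<psi>"
      using op_convolution_combine[OF cl(1,2) k(1), of 1 \<psi>] by (simp add: S'_def[abs_def])
    then have "S' \<psi> + (1/3) *\<^sub>C (k \<star> S') \<psi> = S \<psi> + (1/3) *\<^sub>C (k \<star> S) \<psi> + (D \<psi> + (1/3) *\<^sub>C (k \<star> D) \<psi>)"
      by (simp add: S'_def scaleC_add_right)
    also have "\<dots> = S \<psi> + (1/3) *\<^sub>C S \<psi>"
      by (simp add: DE E_def scaleC_add_right scaleC.minus_left scaleC.diff_right)
    also have "\<dots> = (4/3) *\<^sub>C S \<psi>"
      using scaleC_add_left[of 1 "1/3" "S \<psi>"] by simp
    finally show ?thesis by simp
  qed
  \<comment> \<open>With the factor 3/4 taken out, \<open>F\<close> acts on \<open>S'\<close> as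
    \<open>f\<close> acts on \<open>S' + 1/3 (k \<star> S')\<close>.\<close>
  define F where "F z = f z + (1/3) * L1_convolution k f z" for z
  define f' where "f' z = (3/4) * F z + complex_of_real (a / 4) * k z" for z
  have kfi: "integrable lborel (L1_convolution k f)" by (rule integrable_L1_convolution[OF k(1) f])
  have F: "integrable lborel F" unfolding F_def using f kfi by simp
  have f': "integrable lborel f'" unfolding f'_def using F k(1) by simp
  have "T \<psi> = (f' \<star> S') \<psi> + of_real (3/4 * a) *\<^sub>C S' \<psi>" for \<psi>
  proof -
    have clc: "bounded_clinear (\<lambda>\<psi>. S' \<psi> + (1/3) *\<^sub>C (k \<star> S') \<psi>)"
      by (rule bounded_clinear_combine[OF cl(3) clk])
    have Sf: "S = (\<lambda>\<psi>. 0 + (3/4) *\<^sub>C (S' \<psi> + (1/3) *\<^sub>C (k \<star> S') \<psi>))"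
      using S_eq by (intro ext) simp
    have "(f \<star> S) \<psi> = (f \<star> (\<lambda>\<psi>. 0)) \<psi> + (3/4) *\<^sub>C ((f \<star> S') \<psi> + (1/3) *\<^sub>C (f \<star> (k \<star> S')) \<psi>)"
      by (subst Sf) (simp only: op_convolution_combine[OF bounded_clinear_zero clc f]
          op_convolution_combine[OF cl(3) clk f])
    also have "(f \<star> (\<lambda>\<psi>. 0)) \<psi> = 0"
      using op_convolution_sum[OF bounded_clinear_zero f, where N=0] by simp
    finally have 1: "(f \<star> S) \<psi> = (3/4) *\<^sub>C (F \<star> S') \<psi>"
      unfolding F_def[abs_def] op_convolution_combine_left[OF cl(3) f kfi]
        L1_convolution_op_convolution[OF k(1) f cl(3)] by simp
    have "(f' \<star> S') \<psi> = ((\<lambda>z. (3/4) * F z) \<star> S') \<psi> + of_real (a / 4) *\<^sub>C (k \<star> S') \<psi>"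
      unfolding f'_def[abs_def] by (rule op_convolution_combine_left[OF cl(3) _ k(1)]) (use F in simp)
    also have "((\<lambda>z. (3/4) * F z) \<star> S') \<psi> = (3/4) *\<^sub>C (F \<star> S') \<psi>"
    proof (rule cinner_eqI)
      fix \<phi>
      have "integrable lborel (\<lambda>z. (3/4) * F z)" using F by simp
      then show "cinner (((\<lambda>z. (3/4) * F z) \<star> S') \<psi>) \<phi> = cinner ((3/4) *\<^sub>C (F \<star> S') \<psi>) \<phi>"
        using F by (simp add: cinner_op_convolution[OF cl(3)] mult.assoc)
    qed
    finally have 2: "(f' \<star> S') \<psi> = (f \<star> S) \<psi> + of_real (a / 4) *\<^sub>C (k \<star> S') \<psi>"
      by (simp only: 1)
    have "of_real a *\<^sub>C S \<psi> = of_real (3/4 * a) *\<^sub>C S' \<psi> + of_real (a / 4) *\<^sub>C (k \<star> S') \<psi>"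
      unfolding S_eq[of \<psi>] by (simp add: scaleC_add_right mult.commute)
    then show ?thesis unfolding T 2 by simp
  qed
  moreover have "(LINT z|lborel. cmod (f' z - f z)) \<le> eps + a"
  proof -
    have "(LINT z|lborel. cmod (f' z - f z)) \<le>
        (LINT z|lborel. cmod (L1_convolution k f z - f z) / 4 + a / 4 * cmod (k z))"
    proof (rule integral_mono)
      fix z
      have "f' z - f z = (L1_convolution k f z - f z) / 4 + complex_of_real (a / 4) * k z"
        by (simp add: f'_def F_def field_simps)
      then have "cmod (f' z - f z) \<le> cmod ((L1_convolution k f z - f z) / 4) + cmod (complex_of_real (a / 4) * k z)"
        by (simp only: norm_triangle_ineq)
      then show "cmod (f' z - f z) \<le> cmod (L1_convolution k f z - f z) / 4 + a / 4 * cmod (k z)"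
        using a by (simp add: norm_mult norm_divide)
    qed (use f f' kfi k in auto)
    also have "\<dots> = (LINT z|lborel. cmod (L1_convolution k f z - f z)) / 4 + a / 4"
      using f kfi k by simp
    also have "\<dots> \<le> eps + a" using kf eps a by simp
    finally show ?thesis .
  qed
  moreover have "schatten_le p eps (\<lambda>\<psi>. S' \<psi> - S \<psi>)"
    using schatten_le_mono[OF D(2), of eps] eps by (simp add: S'_def)
  ultimately show ?thesis using f' S' by blast
qed

text \<open>The tolerance \<open>(1/2) ^ n\<close> in step n makes the increments of both factors
  summable. The remainder \<open>a n\<close> times \<open>S n\<close> vanishes as the
  \<open>S n\<close> stay bounded in operator norm, and the convolution is continuous in both
  factors, so the exact identity survives the limit.\<close>

theorem schatten_class_factorization:
  fixes T :: "'a::euclidean_space L2 \<Rightarrow> 'a L2"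
  assumes p: "1 \<le> p" and T: "T \<in> schatten_class p"
  shows "\<exists>f S. integrable lborel f \<and> S \<in> schatten_class p \<and> T = f \<star> S"
proof -
  have sT: "schatten p T" by (rule schatten_class_imp_schatten[OF p T])
  obtain u :: "nat \<Rightarrow> 'a L2" where u: "orthonormal u" using ex_orthonormal[OF p T] by blast
  define a :: "nat \<Rightarrow> real" where "a n = (3/4) ^ n" for n
  \<comment> \<open>\<open>P\<close> is the exact identity kept at stage n; \<open>Q\<close>
    controls the passage to the next stage. They are separated as required by dependent
    choice.\<close>
  define P where "P n X \<longleftrightarrow> integrable lborel (fst X) \<and> schatten p (snd X) \<and>
      (\<forall>\<psi>. T \<psi> = (fst X \<star> snd X) \<psi> + of_real (a n) *\<^sub>C snd X \<psi>)"
    for n and X :: "('a \<times> 'a \<Rightarrow> complex) \<times> ('a L2 \<Rightarrow> 'a L2)"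
  define Q where "Q n X Y \<longleftrightarrow> (LINT z|lborel. cmod (fst Y z - fst X z)) \<le> (1/2) ^ n + a n \<and>
      schatten_le p ((1/2) ^ n) (\<lambda>\<psi>. snd Y \<psi> - snd X \<psi>)"
    for n and X Y :: "('a \<times> 'a \<Rightarrow> complex) \<times> ('a L2 \<Rightarrow> 'a L2)"
  have "\<exists>X. \<forall>n. P n (X n) \<and> Q n (X n) (X (Suc n))"
  proof (rule dependent_nat_choice)
    have "((\<lambda>z. 0) \<star> T) \<psi> = 0" for \<psi>
      using sT by (intro cinner_eqI) (simp add: cinner_op_convolution schatten_def cinner.zero_left)
    then show "\<exists>X. P 0 X"
      using sT by (intro exI[of _ "(\<lambda>z. 0, T)"]) (simp add: P_def a_def)
    fix X n assume P: "P n X"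
    have e: "(0::real) < (1/2) ^ n" and an: "0 \<le> a n" by (simp_all add: a_def)
    from P have Tn: "T \<psi> = (fst X \<star> snd X) \<psi> + of_real (a n) *\<^sub>C snd X \<psi>" for \<psi>
      by (simp add: P_def)
    obtain f' S' where "integrable lborel f'" "schatten p S'"
      "\<forall>\<psi>. T \<psi> = (f' \<star> S') \<psi> + of_real (3/4 * a n) *\<^sub>C S' \<psi>"
      "(LINT z|lborel. cmod (f' z - fst X z)) \<le> (1/2) ^ n + a n"
      "schatten_le p ((1/2) ^ n) (\<lambda>\<psi>. S' \<psi> - snd X \<psi>)"
      using factorization_step[OF p u e an _ _ Tn] P unfolding P_def by blast
    then show "\<exists>Y. P (Suc n) Y \<and> Q n X Y"
      by (intro exI[of _ "(f', S')"]) (simp add: P_def Q_def a_def)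
  qed
  then obtain X where X: "\<And>n. P n (X n)" "\<And>n. Q n (X n) (X (Suc n))" by blast
  define f where "f n = fst (X n)" for n
  define S where "S n = snd (X n)" for n
  have f: "integrable lborel (f n)" and S: "schatten p (S n)"
    and Tn: "T \<psi> = (f n \<star> S n) \<psi> + of_real (a n) *\<^sub>C S n \<psi>" for n \<psi>
    using X(1)[of n] by (simp_all add: P_def f_def S_def)
  have df: "(LINT z|lborel. cmod (f (Suc n) z - f n z)) \<le> (1/2) ^ n + a n"
    and dS: "schatten_le p ((1/2) ^ n) (\<lambda>\<psi>. S (Suc n) \<psi> - S n \<psi>)" for n
    using X(2)[of n] by (simp_all add: Q_def f_def S_def)
  have clS: "bounded_clinear (S n)" for n using S by (simp add: schatten_def)
  have half: "summable (\<lambda>n. (1/2::real) ^ n)" by (rule summable_geometric) simp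
  have "summable (\<lambda>n. (1/2) ^ n + a n)"
    unfolding a_def by (intro summable_add half summable_geometric) simp
  then have "summable (\<lambda>n. LINT z|lborel. cmod (f (Suc n) z - f n z))"
    by (rule summable_comparison_test[rotated]) (use df in \<open>auto intro!: exI[of _ 0]\<close>)
  then obtain h where h: "integrable lborel h"
    and hlim: "(\<lambda>N. LINT z|lborel. cmod (h z - (\<Sum>n<N. f (Suc n) z - f n z))) \<longlonglongrightarrow> 0"
    using L1_series[of lborel "\<lambda>n z. f (Suc n) z - f n z"] f by auto
  define g where "g z = f 0 z + h z" for z
  have g: "integrable lborel g" unfolding g_def using f h by simp
  have glim: "(\<lambda>N. LINT z|lborel. cmod (f N z - g z)) \<longlonglongrightarrow> 0"
  proof -
    have "cmod (h z - (\<Sum>n<N. f (Suc n) z - f n z)) = cmod (f N z - g z)" for N z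
      by (simp add: sum_lessThan_telescope[of "\<lambda>n. f n z"] g_def norm_minus_commute algebra_simps)
    with hlim show ?thesis by simp
  qed
  have dS': "schatten p (\<lambda>\<psi>. S (Suc n) \<psi> - S n \<psi>)" for n
    using schatten_combine[OF S S, of "Suc n" "-1" n] by (simp add: scaleC.minus_left)
  obtain B where B: "schatten p B" and
    Btail: "\<And>N. schatten_le p (\<Sum>n. (1/2) ^ (n + N)) (\<lambda>\<psi>. B \<psi> - (\<Sum>n<N. S (Suc n) \<psi> - S n \<psi>))"
    using schatten_series[OF dS' dS half u] by blast
  define R where "R \<psi> = S 0 \<psi> + 1 *\<^sub>C B \<psi>" for \<psi>
  have R: "schatten p R" unfolding R_def[abs_def] by (rule schatten_combine[OF S B])
  have clR: "bounded_clinear R" using R by (simp add: schatten_def)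
  define t where "t N = (\<Sum>n. (1/2::real) ^ (n + N))" for N
  have tlim: "t \<longlonglongrightarrow> 0" unfolding t_def by (rule suminf_exist_split2[OF half])
  let ?D = "\<lambda>N \<psi>. S N \<psi> + (-1) *\<^sub>C R \<psi>"
  have RS: "schatten_le p (t N) (?D N)" for N
    using schatten_le_scaleC[OF Btail[of N], of "-1"]
    by (simp add: sum_lessThan_telescope[of "\<lambda>n. S n _"] R_def t_def scaleC.minus_left algebra_simps)
  have clD: "bounded_clinear (?D N)" for N
    by (rule bounded_clinear_combine[OF clS clR])
  have nRS: "norm (S N \<psi> - R \<psi>) \<le> t N * norm \<psi>" for N \<psi>
    using schatten_le_norm[OF RS[of N] clD[of N] u, where \<psi>=\<psi>]
    by (simp add: scaleC.minus_left)
  have t0: "0 \<le> t N" for N by (rule schatten_le_nonneg[OF RS u])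
  obtain K where K: "0 \<le> K" "\<And>x. norm (R x) \<le> K * norm x" using bounded_clinear_bound[OF clR] by blast
  have nS: "norm (S N \<psi>) \<le> (K + t N) * norm \<psi>" for N \<psi>
    using norm_triangle_ineq[of "R \<psi>" "S N \<psi> - R \<psi>"] K(2)[of \<psi>] nRS[where N=N and \<psi>=\<psi>] by (simp add: distrib_right)
  have "T \<psi> = (g \<star> R) \<psi>" for \<psi>
  proof -
    \<comment> \<open>The error is split as \<open>(f N - g) \<star> S N\<close> plus
      \<open>g \<star> (S N - R)\<close>; \<open>e1\<close> and \<open>e2\<close> bound the two
      parts.\<close>
    define e1 where "e1 N = (LINT z|lborel. cmod (f N z - g z)) * (K + t N) * norm \<psi>" for N
    define e2 where "e2 N = (LINT z|lborel. cmod (g z)) * t N * norm \<psi>" for N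
    have le: "norm ((f N \<star> S N) \<psi> - (g \<star> R) \<psi>) \<le> e1 N + e2 N" for N
    proof -
      have fg: "integrable lborel (\<lambda>z. f N z + (-1) * g z)" using f g by simp
      have eq: "(f N \<star> S N) \<psi> - (g \<star> R) \<psi> =
          ((\<lambda>z. f N z + (-1) * g z) \<star> S N) \<psi> + (g \<star> (?D N)) \<psi>"
        unfolding op_convolution_combine_left[OF clS f g] op_convolution_combine[OF clS clR g]
        by (simp add: scaleC.minus_left)
      have 1: "norm (((\<lambda>z. f N z + (-1) * g z) \<star> S N) \<psi>) \<le> e1 N"
        using norm_op_convolution_le[OF clS[of N] fg _ nS, where \<psi>=\<psi>] K(1) t0[of N] by (simp add: e1_def)
      have 2: "norm ((g \<star> (?D N)) \<psi>) \<le> e2 N"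
        unfolding e2_def by (intro norm_op_convolution_le clD g t0 schatten_le_norm[OF RS clD u])
      show ?thesis unfolding eq by (rule norm_triangle_mono[OF 1 2])
    qed
    have "(\<lambda>N. e1 N + e2 N) \<longlonglongrightarrow> 0 * (K + 0) * norm \<psi> + (LINT z|lborel. cmod (g z)) * 0 * norm \<psi>"
      unfolding e1_def e2_def by (intro tendsto_intros glim tlim)
    then have "(\<lambda>N. e1 N + e2 N) \<longlonglongrightarrow> 0" by simp
    then have lim1: "(\<lambda>N. (f N \<star> S N) \<psi> - (g \<star> R) \<psi>) \<longlonglongrightarrow> 0"
      by (rule Lim_null_comparison[OF always_eventually, rotated]) (simp add: le)
    have "(\<lambda>N. a N * ((K + t N) * norm \<psi>)) \<longlonglongrightarrow> 0 * ((K + 0) * norm \<psi>)"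
      unfolding a_def by (intro tendsto_intros tlim LIMSEQ_power_zero) simp
    then have "(\<lambda>N. a N * ((K + t N) * norm \<psi>)) \<longlonglongrightarrow> 0" by simp
    then have lim2: "(\<lambda>N. of_real (a N) *\<^sub>C S N \<psi>) \<longlonglongrightarrow> 0"
    proof (rule Lim_null_comparison[OF always_eventually, rotated], intro allI)
      have a0: "0 \<le> a N" for N by (simp add: a_def)
      show "norm (of_real (a N) *\<^sub>C S N \<psi>) \<le> a N * ((K + t N) * norm \<psi>)" for N
        using mult_left_mono[OF nS a0, of N] a0[of N] by simp
    qed
    have "(f N \<star> S N) \<psi> - (g \<star> R) \<psi> + of_real (a N) *\<^sub>C S N \<psi> = T \<psi> - (g \<star> R) \<psi>" for N
      unfolding Tn[of \<psi> N] by simp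
    with tendsto_add[OF lim1 lim2] have "(\<lambda>N. T \<psi> - (g \<star> R) \<psi>) \<longlonglongrightarrow> 0" by simp
    then show ?thesis by (simp add: LIMSEQ_const_iff)
  qed
  then have "T = g \<star> R" by (rule ext)
  with g schatten_imp_schatten_class[OF p R u] show ?thesis by blast
qed

theorem proposition7p4:
  fixes p :: real and T :: "(real ^ 'd) L2 \<Rightarrow> (real ^ 'd) L2"
  assumes "1 \<le> p" and "T \<in> schatten_class p"
  shows "\<exists>(f :: (real ^ 'd) \<times> (real ^ 'd) \<Rightarrow> complex) S.
           integrable lborel f \<and> S \<in> schatten_class p \<and> T = f \<star> S"
  using assms by (rule schatten_class_factorization)

end
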